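(* Let $(X,d,\mu)$ be a space of homogeneous type with dimension $n$ and $\mu(X)=+\infty$, and let $L$ be a non-negative self-adjoint operator on $L^2(X)$ satisfying $({\rm PEV}_{2,2}^{\kappa,m})$ for some $m>0$ and $\kappa>\kappa_0:=\big[\frac n2\big]+1$. Then there exist constants $C,c_0>0$ such that for any ball $B\subset X$ with radius $r_B$, any $\lambda>0$, $t\in\mathbb R$, $j\ge6$ and $f\in L^2(X)$, $$\big\|\chi_{U_j(B)}e^{itL}F(L)\chi_Bf\big\|_2\le C2^{-j\kappa_0}(\sqrt[m]{\lambda}\,r_B)^{-\kappa_0+\frac n2}(1+\lambda|t|)^{\kappa_0}(\sqrt[m]{\lambda}\,r)^{-c_0}\|\delta_\lambda F\|_{C^{\kappa_0+1}}\|f\|_2$$ for all Borel functions $F$ on $\mathbb R$ such that ${\rm supp}\,F\subseteq[-\lambda,\lambda]$, where $r=\min\{r_B,\lambda^{-1/m}\}$.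
   Context: Setting: $X$ is a metric space with distance $d$ and a nonnegative Borel measure $\mu$ with $\mu(X)=+\infty$. $B(x,r)=\{y\in X: d(x,y)<r\}$, $V(x,r)=\mu(B(x,r))$ (with $0<V(x,r)<\infty$, as usual in a space of homogeneous type). The measure is doubling: $V(x,2r)\le CV(x,r)$ for all $x\in X$, $r>0$; $n>0$ (the dimension) is a number such that $V(x,\lambda r)\le C\lambda^nV(x,r)$ for all $\lambda\ge1$, $r>0$, $x\in X$. $[\,\cdot\,]$ is the integer part, $\chi_E$ is the indicator function of $E$, and $\|T\|_{p\to q}$ is the operator norm from $L^p(X)$ to $L^q(X)$. Functions of $L$ are defined on $L^2(X)$ by the spectral theorem. Property $({\rm PEV}_{2,2}^{\kappa,m})$: there is $C>0$ such that for all $x,y\in X$, $t>0$, $$\|\chi_{B(x,t^{1/m})}e^{-tL}\chi_{B(y,t^{1/m})}\|_{2\to2}\le C\Big(1+\frac{d(x,y)}{t^{1/m}}\Big)^{-n-\kappa}.$$ For a ball $B$, $U_0(B)=B$ and $U_j(B)=2^jB\setminus2^{j-1}B$ for $j\ge1$, where $2^jB$ is the ball with the same center and radius $2^jr_B$. $\delta_\lambda F(x):=F(\lambda x)$. $\|\cdot\|_{C^k}$ is the usual norm of $C^k(\mathbb R)$ (supremum of derivatives up to order $k$). *)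

theory Defs
  imports "HOL-Analysis.Analysis"
begin

section \<open>Spaces of homogeneous type\<close>

text \<open>The metric space is the whole type, so the balls $B(x,r)$ are the library's open balls.
  The number $n$ is a dimension of the space.\<close>

definition homogeneous_type :: "'a::metric_space measure \<Rightarrow> real \<Rightarrow> bool" where
  "homogeneous_type M n \<longleftrightarrow>
     sets M = sets borel \<and>
     (\<forall>x. \<forall>r>0. 0 < emeasure M (ball x r) \<and> emeasure M (ball x r) < \<infinity>) \<and>
     (\<exists>C. \<forall>x. \<forall>r>0. measure M (ball x (2 * r)) \<le> C * measure M (ball x r)) \<and>
     n > 0 \<and>
     (\<exists>C. \<forall>x. \<forall>r>0. \<forall>l\<ge>1. measure M (ball x (l * r)) \<le> C * l powr n * measure M (ball x r))"

definition annulus :: "'a::metric_space \<Rightarrow> real \<Rightarrow> nat \<Rightarrow> 'a set" where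
  "annulus x r j = (if j = 0 then ball x r else ball x (2 ^ j * r) - ball x (2 ^ (j - 1) * r))"


section \<open>The Hilbert space of square integrable functions\<close>

text \<open>Elements of $L^2$ are represented by complex-valued square integrable functions; all
  notions below are invariant under equality almost everywhere.\<close>

definition L2 :: "'a measure \<Rightarrow> ('a \<Rightarrow> complex) set" where
  "L2 M = {f \<in> borel_measurable M. integrable M (\<lambda>x. (cmod (f x))\<^sup>2)}"

definition L2_inner :: "'a measure \<Rightarrow> ('a \<Rightarrow> complex) \<Rightarrow> ('a \<Rightarrow> complex) \<Rightarrow> complex" where
  "L2_inner M f g = (\<integral>x. f x * cnj (g x) \<partial>M)"

definition L2_norm :: "'a measure \<Rightarrow> ('a \<Rightarrow> complex) \<Rightarrow> real" where
  "L2_norm M f = sqrt (\<integral>x. (cmod (f x))\<^sup>2 \<partial>M)"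

definition cutoff :: "'a set \<Rightarrow> ('a \<Rightarrow> complex) \<Rightarrow> 'a \<Rightarrow> complex" where
  "cutoff A f = (\<lambda>x. indicator A x * f x)"

definition opnorm_2_2 :: "'a measure \<Rightarrow> (('a \<Rightarrow> complex) \<Rightarrow> ('a \<Rightarrow> complex)) \<Rightarrow> ennreal" where
  "opnorm_2_2 M T = (SUP f\<in>{f \<in> L2 M. L2_norm M f \<le> 1}. ennreal (L2_norm M (T f)))"


section \<open>Unbounded operators\<close>

text \<open>An unbounded operator is given by its domain \<open>D\<close> and a map \<open>L\<close> that matters on \<open>D\<close> only.\<close>

definition densely_defined_operator ::
    "'a measure \<Rightarrow> ('a \<Rightarrow> complex) set \<Rightarrow> (('a \<Rightarrow> complex) \<Rightarrow> ('a \<Rightarrow> complex)) \<Rightarrow> bool" where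
  "densely_defined_operator M D L \<longleftrightarrow>
     D \<subseteq> L2 M \<and>
     (\<forall>f\<in>D. \<forall>g\<in>L2 M. (AE x in M. f x = g x) \<longrightarrow> g \<in> D \<and> (AE x in M. L f x = L g x)) \<and>
     (\<lambda>x. 0) \<in> D \<and>
     (\<forall>f\<in>D. \<forall>g\<in>D. (\<lambda>x. f x + g x) \<in> D \<and> (AE x in M. L (\<lambda>x. f x + g x) x = L f x + L g x)) \<and>
     (\<forall>c. \<forall>f\<in>D. (\<lambda>x. c * f x) \<in> D \<and> (AE x in M. L (\<lambda>x. c * f x) x = c * L f x)) \<and>
     (\<forall>f\<in>D. L f \<in> L2 M) \<and>
     (\<forall>f\<in>L2 M. \<forall>\<epsilon>>0. \<exists>g\<in>D. L2_norm M (\<lambda>x. f x - g x) < \<epsilon>)"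

text \<open>\<open>L\<close> is equal to its adjoint, domains included.\<close>

definition self_adjoint_operator ::
    "'a measure \<Rightarrow> ('a \<Rightarrow> complex) set \<Rightarrow> (('a \<Rightarrow> complex) \<Rightarrow> ('a \<Rightarrow> complex)) \<Rightarrow> bool" where
  "self_adjoint_operator M D L \<longleftrightarrow>
     densely_defined_operator M D L \<and>
     (\<forall>g\<in>L2 M. \<forall>h\<in>L2 M.
        (\<forall>f\<in>D. L2_inner M (L f) g = L2_inner M f h) \<longleftrightarrow> g \<in> D \<and> (AE x in M. h x = L g x))"

definition nonneg_operator ::
    "'a measure \<Rightarrow> ('a \<Rightarrow> complex) set \<Rightarrow> (('a \<Rightarrow> complex) \<Rightarrow> ('a \<Rightarrow> complex)) \<Rightarrow> bool" where
  "nonneg_operator M D L \<longleftrightarrow> (\<forall>f\<in>D. L2_inner M (L f) f \<in> \<real>\<^sub>\<ge>\<^sub>0)"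


section \<open>Functions of a self-adjoint operator\<close>

text \<open>Projection-valued measures on the Borel subsets of the line. Linearity of the maps \<open>E A\<close>
  and their compatibility with equality almost everywhere follow from the symmetry condition.\<close>

definition projection_valued_measure ::
    "'a measure \<Rightarrow> (real set \<Rightarrow> ('a \<Rightarrow> complex) \<Rightarrow> ('a \<Rightarrow> complex)) \<Rightarrow> bool" where
  "projection_valued_measure M E \<longleftrightarrow>
     (\<forall>A\<in>sets borel. \<forall>f\<in>L2 M. E A f \<in> L2 M) \<and>
     (\<forall>A\<in>sets borel. \<forall>f\<in>L2 M. \<forall>g\<in>L2 M. L2_inner M (E A f) g = L2_inner M f (E A g)) \<and>
     (\<forall>A\<in>sets borel. \<forall>B\<in>sets borel. \<forall>f\<in>L2 M. AE x in M. E A (E B f) x = E (A \<inter> B) f x) \<and>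
     (\<forall>f\<in>L2 M. AE x in M. E UNIV f x = f x) \<and>
     (\<forall>A :: nat \<Rightarrow> real set. range A \<subseteq> sets borel \<longrightarrow> disjoint_family A \<longrightarrow>
        (\<forall>f\<in>L2 M. (\<lambda>N. L2_norm M (\<lambda>x. E (\<Union>i. A i) f x - (\<Sum>i<N. E (A i) f x)))
           \<longlonglongrightarrow> 0))"

text \<open>The scalar measure $A \mapsto \langle E(A)f,f\rangle$.\<close>

definition scalar_spectral_measure ::
    "'a measure \<Rightarrow> (real set \<Rightarrow> ('a \<Rightarrow> complex) \<Rightarrow> ('a \<Rightarrow> complex)) \<Rightarrow> ('a \<Rightarrow> complex) \<Rightarrow> real measure"
  where
  "scalar_spectral_measure M E f =
     measure_of UNIV (sets borel) (\<lambda>A. ennreal (Re (L2_inner M (E A f) f)))"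

text \<open>The domain of $F(L) = \int F\,dE$.\<close>

definition spectral_domain ::
    "'a measure \<Rightarrow> (real set \<Rightarrow> ('a \<Rightarrow> complex) \<Rightarrow> ('a \<Rightarrow> complex)) \<Rightarrow> (real \<Rightarrow> complex) \<Rightarrow>
     ('a \<Rightarrow> complex) set" where
  "spectral_domain M E F =
     {f \<in> L2 M. integrable (scalar_spectral_measure M E f) (\<lambda>s. (cmod (F s))\<^sup>2)}"

text \<open>The integral of \<open>F\<close> against the complex measure $A \mapsto \langle E(A)f,h\rangle$, which by
  polarization is $\frac14\sum_{k<4} i^k \langle E(A)(f+i^kh),f+i^kh\rangle$. It is used only for
  \<open>f\<close> and \<open>h\<close> in the domain of $F(L)$, where the four integrals converge.\<close>

definition spectral_integral ::
    "'a measure \<Rightarrow> (real set \<Rightarrow> ('a \<Rightarrow> complex) \<Rightarrow> ('a \<Rightarrow> complex)) \<Rightarrow> (real \<Rightarrow> complex) \<Rightarrow>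
     ('a \<Rightarrow> complex) \<Rightarrow> ('a \<Rightarrow> complex) \<Rightarrow> complex" where
  "spectral_integral M E F f h =
     (\<Sum>k<4. \<i> ^ k * (\<integral>s. F s \<partial>scalar_spectral_measure M E (\<lambda>x. f x + \<i> ^ k * h x))) / 4"

text \<open>\<open>E\<close> is the spectral resolution of \<open>L\<close>, that is $L = \int s\,dE(s)$ with equality of domains.
  By the spectral theorem every self-adjoint operator has one, and it is unique.\<close>

definition spectral_resolution ::
    "'a measure \<Rightarrow> (real set \<Rightarrow> ('a \<Rightarrow> complex) \<Rightarrow> ('a \<Rightarrow> complex)) \<Rightarrow>
     ('a \<Rightarrow> complex) set \<Rightarrow> (('a \<Rightarrow> complex) \<Rightarrow> ('a \<Rightarrow> complex)) \<Rightarrow> bool" where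
  "spectral_resolution M E D L \<longleftrightarrow>
     projection_valued_measure M E \<and>
     D = spectral_domain M E complex_of_real \<and>
     (\<forall>f\<in>D. \<forall>h\<in>D. L2_inner M (L f) h = spectral_integral M E complex_of_real f h)"

text \<open>The operator $F(L)$, where \<open>E\<close> is the spectral resolution of \<open>L\<close>. For \<open>f\<close> in the domain of
  $F(L)$ the condition determines \<open>g\<close> up to equality almost everywhere, because the domain is dense
  in $L^2$; for other \<open>f\<close> the value is irrelevant.\<close>

definition op_fun ::
    "'a measure \<Rightarrow> (real set \<Rightarrow> ('a \<Rightarrow> complex) \<Rightarrow> ('a \<Rightarrow> complex)) \<Rightarrow> (real \<Rightarrow> complex) \<Rightarrow>
     ('a \<Rightarrow> complex) \<Rightarrow> ('a \<Rightarrow> complex)" where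
  "op_fun M E F f =
     (SOME g. g \<in> L2 M \<and>
        (\<forall>h\<in>spectral_domain M E F. L2_inner M g h = spectral_integral M E F f h))"


section \<open>The polynomial off-diagonal estimate for the semigroup\<close>

text \<open>\<open>E\<close> is the spectral resolution of \<open>L\<close>, so that \<open>op_fun M E (\<lambda>s. exp (- t * s))\<close>
  is $e^{-tL}$.\<close>

definition PEV_2_2 ::
    "'a::metric_space measure \<Rightarrow> (real set \<Rightarrow> ('a \<Rightarrow> complex) \<Rightarrow> ('a \<Rightarrow> complex)) \<Rightarrow>
     real \<Rightarrow> real \<Rightarrow> real \<Rightarrow> bool" where
  "PEV_2_2 M E n \<kappa> m \<longleftrightarrow>
     (\<exists>C>0. \<forall>x y. \<forall>t>0.
        opnorm_2_2 M (\<lambda>f. cutoff (ball x (t powr (1 / m)))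
            (op_fun M E (\<lambda>s. complex_of_real (exp (- t * s))) (cutoff (ball y (t powr (1 / m))) f)))
        \<le> ennreal (C * (1 + dist x y / t powr (1 / m)) powr (- n - \<kappa>)))"


section \<open>The norm of \<open>C\<^sup>k\<close>\<close>

definition nth_deriv :: "nat \<Rightarrow> (real \<Rightarrow> complex) \<Rightarrow> real \<Rightarrow> complex" where
  "nth_deriv k F = ((\<lambda>G x. vector_derivative G (at x)) ^^ k) F"

definition C_k :: "nat \<Rightarrow> (real \<Rightarrow> complex) \<Rightarrow> bool" where
  "C_k k F \<longleftrightarrow>
     (\<forall>j<k. \<forall>x. nth_deriv j F differentiable at x) \<and> continuous_on UNIV (nth_deriv k F)"

definition Ck_norm :: "nat \<Rightarrow> (real \<Rightarrow> complex) \<Rightarrow> ennreal" where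
  "Ck_norm k F = (if C_k k F then SUP j\<in>{..k}. SUP x. ennreal (cmod (nth_deriv j F x)) else \<infinity>)"

end

theory Submission
  imports Defs
begin

text \<open>Put $\rho = \lambda^{-1/m}$ and let \<open>ad\<close> denote the commutator with a bounded weight \<open>d\<close> that is
  $1/\rho$-Lipschitz. Cutting $L^2$ into blocks along a $\rho$-net, the estimate (PEV) and a Schur test
  bound the iterated commutators of $T = e^{-L/\lambda}$ up to order $\kappa_0$, uniformly in \<open>d\<close>; this is
  where $\kappa > \kappa_0$ enters. If the \<open>i\<close>-th commutators of two operators have norm at most $C^i$ and
  $C'^i$, those of the product have norm at most $(C+C')^i$. Hence the commutators of $e^{ikcT}$ grow
  polynomially in \<open>k\<close>, and expanding $f(-\log u)$ in a trigonometric sum bounds the commutators of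
  $f(L/\lambda)$ by the $C^{\kappa_0+1}$ norm of \<open>f\<close>.

  For $e^{itL}F(L)$ the exponential cannot be absorbed in \<open>f\<close>, since this would cost a power of
  $1+\lambda|t|$ more than is allowed. Instead write $e^{itL}F(L) = W^N F(L)$ with $N \sim 1+\lambda|t|$ and
  $W = e^{itL/N}\psi(L/\lambda)$, where $\psi$ is a smooth cutoff equal to 1 on $[-1,1]$. Then \<open>W\<close> is a
  contraction whose commutators are bounded uniformly in \<open>t\<close>, and the product rule gives the factor
  $(1+\lambda|t|)^{\kappa_0}$. Finally, if \<open>d\<close> is the distance to \<open>B\<close>, it vanishes on \<open>B\<close>, so the
  commutator of order \<open>k\<close> of \<open>S\<close>, cut off to $U_j(B)$ and \<open>B\<close>, is $d^k S$, and dividing by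
  $d \ge 2^{j-2} r_B/\rho$ gives the decay. With $c_0 = n/2$ the remaining factors are at least 1.\<close>

section \<open>Square integrable functions\<close>

text \<open>Everything is a finite sum or a norm limit. Multiplication by \<open>d\<close> is
  bounded, so taking a commutator is norm continuous and bounds on iterated commutators survive norm
  limits; the bound on \<open>d\<close> itself does not enter the final constants. This is why the
  Fourier expansion is discrete: finite sums of powers of exp(icT) stand in for an operator-valued
  Fourier integral, and only coefficient bounds uniform in the mesh are required. Summing
  coefficients of frequency k against the growth (1 + |k|)^K by Cauchy-Schwarz costs one derivative
  beyond \<open>K = \<kappa>\<^sub>0\<close>, whence the norm of order
  \<open>\<kappa>\<^sub>0 + 1\<close>. A function of s supported in [-2,2] becomes a function of u =
  exp(-s) supported in [exp(-2), exp 2], inside (1/8, 8); this fixes the period 8 of the grid. A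
  formal obstacle shapes the first half: \<open>op_fun\<close> is a choice made by
  \<open>SOME\<close>, determined in general only almost everywhere, and the symbol exp(-ts) is
  unbounded for s < 0. So the calculus is built for arbitrary representatives, and non-negativity of
  the operator is turned into the statement that the spectral measures live on s >= 0.\<close>

lemma cnj_measurable [measurable]: "cnj \<in> borel_measurable borel"
  by (intro borel_measurable_continuous_onI continuous_intros)

lemma L2_measurable [measurable_dest]: "f \<in> L2 M \<Longrightarrow> f \<in> borel_measurable M"
  by (simp add: L2_def)

lemma L2_integrable: "f \<in> L2 M \<Longrightarrow> integrable M (\<lambda>x. (cmod (f x))\<^sup>2)"
  by (simp add: L2_def)

lemma L2_prod_integrable:
  assumes "f \<in> L2 M" "g \<in> L2 M"
  shows "integrable M (\<lambda>x. f x * cnj (g x))"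
proof (rule Bochner_Integration.integrable_bound[where f = "\<lambda>x. (cmod (f x))\<^sup>2 + (cmod (g x))\<^sup>2"])
  show "integrable M (\<lambda>x. (cmod (f x))\<^sup>2 + (cmod (g x))\<^sup>2)"
    using assms by (auto simp: L2_def)
  note [measurable] = L2_measurable[OF assms(1)] L2_measurable[OF assms(2)]
  show "(\<lambda>x. f x * cnj (g x)) \<in> borel_measurable M" by measurable
  have "cmod (f x) * cmod (g x) \<le> (cmod (f x))\<^sup>2 + (cmod (g x))\<^sup>2" for x
  proof -
    have "0 \<le> cmod (f x) * cmod (g x)" by simp
    with sum_squares_bound[of "cmod (f x)" "cmod (g x)"] show ?thesis by linarith
  qed
  then show "AE x in M. norm (f x * cnj (g x)) \<le> norm ((cmod (f x))\<^sup>2 + (cmod (g x))\<^sup>2)"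
    by (auto simp: norm_mult)
qed

lemma L2_zero [simp]: "(\<lambda>x. 0) \<in> L2 M"
  by (simp add: L2_def)

lemma L2_add:
  assumes "f \<in> L2 M" "g \<in> L2 M"
  shows "(\<lambda>x. f x + g x) \<in> L2 M"
proof -
  note [measurable] = L2_measurable[OF assms(1)] L2_measurable[OF assms(2)]
  have "integrable M (\<lambda>x. (cmod (f x + g x))\<^sup>2)"
  proof (rule Bochner_Integration.integrable_bound[where f = "\<lambda>x. 2 * (cmod (f x))\<^sup>2 + 2 * (cmod (g x))\<^sup>2"])
    show "integrable M (\<lambda>x. 2 * (cmod (f x))\<^sup>2 + 2 * (cmod (g x))\<^sup>2)"
      using assms by (auto simp: L2_def)
    have "(cmod (f x + g x))\<^sup>2 \<le> 2 * (cmod (f x))\<^sup>2 + 2 * (cmod (g x))\<^sup>2" for x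
    proof -
      have "(cmod (f x + g x))\<^sup>2 \<le> (cmod (f x) + cmod (g x))\<^sup>2"
        by (intro power_mono norm_triangle_ineq) auto
      also have "\<dots> \<le> 2 * (cmod (f x))\<^sup>2 + 2 * (cmod (g x))\<^sup>2"
        using sum_squares_bound[of "cmod (f x)" "cmod (g x)"] by (simp add: power2_sum)
      finally show ?thesis .
    qed
    then show "AE x in M. norm ((cmod (f x + g x))\<^sup>2) \<le> norm (2 * (cmod (f x))\<^sup>2 + 2 * (cmod (g x))\<^sup>2)"
      by auto
  qed measurable
  then show ?thesis by (simp add: L2_def)
qed

lemma L2_bounded_mult:
  assumes "f \<in> L2 M" and [measurable]: "m \<in> borel_measurable M" and "\<And>x. cmod (m x) \<le> c"
  shows "(\<lambda>x. m x * f x) \<in> L2 M"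
proof -
  note [measurable] = L2_measurable[OF assms(1)]
  have "integrable M (\<lambda>x. (cmod (m x * f x))\<^sup>2)"
  proof (rule Bochner_Integration.integrable_bound[where f = "\<lambda>x. c\<^sup>2 * (cmod (f x))\<^sup>2"])
    show "integrable M (\<lambda>x. c\<^sup>2 * (cmod (f x))\<^sup>2)"
      using assms by (auto simp: L2_def)
    show "AE x in M. norm ((cmod (m x * f x))\<^sup>2) \<le> norm (c\<^sup>2 * (cmod (f x))\<^sup>2)"
      using assms(3) by (auto simp: norm_mult power_mult_distrib intro!: mult_right_mono power_mono)
  qed measurable
  then show ?thesis by (simp add: L2_def)
qed

lemma L2_scale: "f \<in> L2 M \<Longrightarrow> (\<lambda>x. a * f x) \<in> L2 M"
  by (rule L2_bounded_mult[where c = "cmod a"]) auto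

lemma L2_diff: "f \<in> L2 M \<Longrightarrow> g \<in> L2 M \<Longrightarrow> (\<lambda>x. f x - g x) \<in> L2 M"
  using L2_add[of f M "\<lambda>x. (-1) * g x"] L2_scale[of g M "-1"] by simp

lemma L2_sum: "(\<And>i. i \<in> I \<Longrightarrow> f i \<in> L2 M) \<Longrightarrow> (\<lambda>x. \<Sum>i\<in>I. f i x) \<in> L2 M"
  by (induction I rule: infinite_finite_induct) (auto intro: L2_add)

lemma L2_cutoff: "f \<in> L2 M \<Longrightarrow> A \<in> sets M \<Longrightarrow> cutoff A f \<in> L2 M"
  unfolding cutoff_def by (rule L2_bounded_mult[where c = 1]) (auto simp: indicator_def)

lemma L2_norm_nonneg [simp]: "0 \<le> L2_norm M f"
  by (simp add: L2_norm_def)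

lemma L2_norm_sq: "(L2_norm M f)\<^sup>2 = (\<integral>x. (cmod (f x))\<^sup>2 \<partial>M)"
  by (simp add: L2_norm_def)

lemma nn_integral_L2: "f \<in> L2 M \<Longrightarrow> (\<integral>\<^sup>+x. ennreal ((cmod (f x))\<^sup>2) \<partial>M) = ennreal ((L2_norm M f)\<^sup>2)"
  unfolding L2_norm_sq by (rule nn_integral_eq_integral) (auto simp: L2_def)

lemma L2_if_nn_integral_le:
  assumes [measurable]: "f \<in> borel_measurable M"
    and le: "(\<integral>\<^sup>+x. ennreal ((cmod (f x))\<^sup>2) \<partial>M) \<le> ennreal (c\<^sup>2)" and "0 \<le> c"
  shows "f \<in> L2 M" "L2_norm M f \<le> c"
proof -
  have "integrable M (\<lambda>x. (cmod (f x))\<^sup>2)"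
    using le by (intro integrableI_bounded) (auto simp: order_le_less_trans)
  then show "f \<in> L2 M" by (simp add: L2_def)
  from nn_integral_L2[OF this] le have "(L2_norm M f)\<^sup>2 \<le> c\<^sup>2" by simp
  then show "L2_norm M f \<le> c" using \<open>0 \<le> c\<close> by (rule power2_le_imp_le)
qed

lemma L2_norm_cong_AE:
  assumes "f \<in> L2 M" "g \<in> L2 M" "AE x in M. f x = g x"
  shows "L2_norm M f = L2_norm M g"
  unfolding L2_norm_def using assms(3)
  by (intro arg_cong[where f = sqrt] integral_cong_AE)
     (use L2_integrable[OF assms(1)] L2_integrable[OF assms(2)] in auto)

lemma L2_norm_eq_0_iff:
  assumes "f \<in> L2 M"
  shows "L2_norm M f = 0 \<longleftrightarrow> (AE x in M. f x = 0)"
proof -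
  have "L2_norm M f = 0 \<longleftrightarrow> (\<integral>x. (cmod (f x))\<^sup>2 \<partial>M) = 0"
    by (simp add: L2_norm_def)
  also have "\<dots> \<longleftrightarrow> (AE x in M. (cmod (f x))\<^sup>2 = 0)"
    using assms by (intro integral_nonneg_eq_0_iff_AE) (auto simp: L2_def)
  finally show ?thesis by simp
qed

lemma L2_norm_mono:
  assumes "f \<in> L2 M" "g \<in> L2 M" "AE x in M. cmod (f x) \<le> cmod (g x)"
  shows "L2_norm M f \<le> L2_norm M g"
  unfolding L2_norm_def
proof (intro real_sqrt_le_mono integral_mono_AE)
  show "AE x in M. (cmod (f x))\<^sup>2 \<le> (cmod (g x))\<^sup>2"
    using assms(3) by eventually_elim (auto intro: power_mono)
qed (use assms in \<open>auto simp: L2_def\<close>)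

lemma L2_norm_scale: "L2_norm M (\<lambda>x. a * f x) = cmod a * L2_norm M f"
  by (simp add: L2_norm_def norm_mult power_mult_distrib real_sqrt_mult)

lemma L2_norm_zero [simp]: "L2_norm M (\<lambda>x. 0) = 0"
  by (simp add: L2_norm_def)

lemma L2_norm_minus_commute: "L2_norm M (\<lambda>x. f x - g x) = L2_norm M (\<lambda>x. g x - f x)"
  by (simp add: L2_norm_def norm_minus_commute)

lemma L2_inner_add_left:
  "\<lbrakk>f \<in> L2 M; g \<in> L2 M; h \<in> L2 M\<rbrakk> \<Longrightarrow>
    L2_inner M (\<lambda>x. f x + g x) h = L2_inner M f h + L2_inner M g h"
  unfolding L2_inner_def distrib_right by (intro Bochner_Integration.integral_add L2_prod_integrable)

lemma L2_inner_scale_left: "L2_inner M (\<lambda>x. a * f x) h = a * L2_inner M f h"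
  unfolding L2_inner_def mult.assoc by simp

lemma L2_inner_cnj: "L2_inner M g f = cnj (L2_inner M f g)"
  unfolding L2_inner_def by (subst Bochner_Integration.integral_cnj[symmetric]) (simp add: mult.commute)

lemma L2_inner_add_right:
  "\<lbrakk>f \<in> L2 M; g \<in> L2 M; h \<in> L2 M\<rbrakk> \<Longrightarrow>
    L2_inner M h (\<lambda>x. f x + g x) = L2_inner M h f + L2_inner M h g"
  by (subst (1 2 3) L2_inner_cnj) (simp add: L2_inner_add_left)

lemma L2_inner_scale_right: "L2_inner M h (\<lambda>x. a * f x) = cnj a * L2_inner M h f"
  by (subst (1 2) L2_inner_cnj) (simp add: L2_inner_scale_left)

lemma L2_inner_diff_left:
  assumes "f \<in> L2 M" "g \<in> L2 M" "h \<in> L2 M"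
  shows "L2_inner M (\<lambda>x. f x - g x) h = L2_inner M f h - L2_inner M g h"
  using L2_inner_add_left[of f M "\<lambda>x. (-1) * g x" h] L2_inner_scale_left[of M "-1" g h]
    L2_scale[of g M "-1"] assms by simp

lemma L2_inner_sum_left:
  assumes "\<And>i. i \<in> I \<Longrightarrow> f i \<in> L2 M" "h \<in> L2 M"
  shows "L2_inner M (\<lambda>x. \<Sum>i\<in>I. f i x) h = (\<Sum>i\<in>I. L2_inner M (f i) h)"
  using assms(1)
proof (induction I rule: infinite_finite_induct)
  case (insert i I)
  then show ?case
    using L2_inner_add_left[of "f i" M "\<lambda>x. \<Sum>i\<in>I. f i x" h] L2_sum[of I f M] assms(2) by simp
qed (auto simp: L2_inner_def)

lemma L2_inner_self: "L2_inner M f f = complex_of_real ((L2_norm M f)\<^sup>2)"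
  unfolding L2_inner_def L2_norm_sq
  by (subst integral_complex_of_real[symmetric])
     (auto intro!: Bochner_Integration.integral_cong simp: complex_norm_square[symmetric])

lemma L2_inner_cong_AE:
  assumes "f \<in> L2 M" "f' \<in> L2 M" "g \<in> L2 M" "g' \<in> L2 M"
    and "AE x in M. f x = f' x" "AE x in M. g x = g' x"
  shows "L2_inner M f g = L2_inner M f' g'"
  unfolding L2_inner_def
  by (intro integral_cong_AE)
     (use assms L2_prod_integrable[of f M g] L2_prod_integrable[of f' M g'] in auto)

lemma L2_norm_add_sq:
  assumes "f \<in> L2 M" "g \<in> L2 M"
  shows "(L2_norm M (\<lambda>x. f x + g x))\<^sup>2
           = (L2_norm M f)\<^sup>2 + (L2_norm M g)\<^sup>2 + 2 * Re (L2_inner M f g)"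
proof -
  have "complex_of_real ((L2_norm M (\<lambda>x. f x + g x))\<^sup>2)
      = L2_inner M f f + L2_inner M g f + (L2_inner M f g + L2_inner M g g)"
    unfolding L2_inner_self[symmetric]
    using assms by (simp add: L2_inner_add_left L2_inner_add_right L2_add)
  moreover have "L2_inner M g f + L2_inner M f g = complex_of_real (2 * Re (L2_inner M f g))"
    by (subst L2_inner_cnj) (simp add: complex_eq_iff)
  ultimately have "complex_of_real ((L2_norm M (\<lambda>x. f x + g x))\<^sup>2)
      = complex_of_real ((L2_norm M f)\<^sup>2 + (L2_norm M g)\<^sup>2 + 2 * Re (L2_inner M f g))"
    by (simp add: L2_inner_self algebra_simps)
  then show ?thesis by (simp only: of_real_eq_iff)
qed

lemma L2_Cauchy_Schwarz:
  assumes f: "f \<in> L2 M" and g: "g \<in> L2 M"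
  shows "cmod (L2_inner M f g) \<le> L2_norm M f * L2_norm M g"
proof -
  note [measurable] = L2_measurable[OF f] L2_measurable[OF g]
  have int: "integrable M (\<lambda>x. cmod (f x) * cmod (g x))"
    using integrable_norm[OF L2_prod_integrable[OF f g]] by (simp add: norm_mult)
  have "cmod (L2_inner M f g) \<le> (\<integral>x. cmod (f x * cnj (g x)) \<partial>M)"
    unfolding L2_inner_def by (rule integral_norm_bound)
  also have "\<dots> = (\<integral>x. cmod (f x) * cmod (g x) \<partial>M)" by (simp add: norm_mult)
  finally have 1: "cmod (L2_inner M f g) \<le> (\<integral>x. cmod (f x) * cmod (g x) \<partial>M)" .
  have "ennreal ((\<integral>x. cmod (f x) * cmod (g x) \<partial>M)\<^sup>2)
      = (\<integral>\<^sup>+x. ennreal (cmod (f x)) * ennreal (cmod (g x)) \<partial>M)\<^sup>2"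
    using nn_integral_eq_integral[OF int] by (simp add: ennreal_mult ennreal_power)
  also have "\<dots> \<le> (\<integral>\<^sup>+x. (ennreal (cmod (f x)))\<^sup>2 \<partial>M) * (\<integral>\<^sup>+x. (ennreal (cmod (g x)))\<^sup>2 \<partial>M)"
    by (rule Cauchy_Schwarz_nn_integral) auto
  also have "\<dots> = ennreal ((L2_norm M f * L2_norm M g)\<^sup>2)"
    using nn_integral_L2[OF f] nn_integral_L2[OF g]
    by (simp add: ennreal_power ennreal_mult power_mult_distrib)
  finally have "(\<integral>x. cmod (f x) * cmod (g x) \<partial>M)\<^sup>2 \<le> (L2_norm M f * L2_norm M g)\<^sup>2"
    by simp
  then have "(\<integral>x. cmod (f x) * cmod (g x) \<partial>M) \<le> L2_norm M f * L2_norm M g"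
    by (rule power2_le_imp_le) simp
  with 1 show ?thesis by simp
qed

lemma L2_triangle:
  assumes "f \<in> L2 M" "g \<in> L2 M"
  shows "L2_norm M (\<lambda>x. f x + g x) \<le> L2_norm M f + L2_norm M g"
proof -
  have "Re (L2_inner M f g) \<le> L2_norm M f * L2_norm M g"
    using L2_Cauchy_Schwarz[OF assms] complex_Re_le_cmod order_trans by blast
  then have "(L2_norm M (\<lambda>x. f x + g x))\<^sup>2 \<le> (L2_norm M f + L2_norm M g)\<^sup>2"
    unfolding L2_norm_add_sq[OF assms] by (simp add: power2_sum)
  then show ?thesis by (rule power2_le_imp_le) simp
qed

lemma L2_triangle_diff:
  assumes "f \<in> L2 M" "g \<in> L2 M"
  shows "L2_norm M (\<lambda>x. f x - g x) \<le> L2_norm M f + L2_norm M g"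
  using L2_triangle[of f M "\<lambda>x. (-1) * g x"] L2_scale[of g M "-1"] L2_norm_scale[of M "-1" g] assms
  by simp

lemma L2_triangle_sum:
  assumes "\<And>i. i \<in> I \<Longrightarrow> f i \<in> L2 M"
  shows "L2_norm M (\<lambda>x. \<Sum>i\<in>I. f i x) \<le> (\<Sum>i\<in>I. L2_norm M (f i))"
  using assms
proof (induction I rule: infinite_finite_induct)
  case (insert i I)
  have "L2_norm M (\<lambda>x. f i x + (\<Sum>i\<in>I. f i x)) \<le> L2_norm M (f i) + L2_norm M (\<lambda>x. \<Sum>i\<in>I. f i x)"
    by (intro L2_triangle L2_sum insert.prems) auto
  with insert show ?case by simp
qed auto

lemma L2_norm_bounded_mult:
  assumes "f \<in> L2 M" "m \<in> borel_measurable M" "\<And>x. cmod (m x) \<le> c"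
  shows "L2_norm M (\<lambda>x. m x * f x) \<le> c * L2_norm M f"
proof -
  have "0 \<le> c" using assms(3) norm_ge_zero order_trans by blast
  have "L2_norm M (\<lambda>x. m x * f x) \<le> L2_norm M (\<lambda>x. complex_of_real c * f x)"
    using assms \<open>0 \<le> c\<close>
    by (intro L2_norm_mono L2_bounded_mult[where c = c] L2_scale)
       (auto simp: norm_mult intro!: mult_right_mono AE_I2)
  also have "\<dots> = c * L2_norm M f" using \<open>0 \<le> c\<close> by (simp add: L2_norm_scale)
  finally show ?thesis .
qed

lemma L2_norm_cutoff_le: "f \<in> L2 M \<Longrightarrow> A \<in> sets M \<Longrightarrow> L2_norm M (cutoff A f) \<le> L2_norm M f"
  using L2_norm_bounded_mult[of f M "indicator A" 1] by (auto simp: cutoff_def indicator_def)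

text \<open>Fatou's lemma gives both the almost everywhere convergence and the norm estimate.\<close>

lemma L2_complete:
  assumes u: "\<And>k. u k \<in> L2 M" and step: "\<And>k. L2_norm M (\<lambda>x. u (Suc k) x - u k x) \<le> a k"
    and a: "summable a"
  shows "\<exists>g\<in>L2 M. (\<lambda>k. L2_norm M (\<lambda>x. u k x - g x)) \<longlonglongrightarrow> 0"
proof -
  note [measurable] = L2_measurable[OF u]
  have a0: "0 \<le> a k" for k
    using step[of k] L2_norm_nonneg order_trans by blast
  define w where "w k x = cmod (u (Suc k) x - u k x)" for k x
  have wL2: "(\<lambda>x. complex_of_real (w k x)) \<in> L2 M" for k
    using L2_diff[OF u[of "Suc k"] u[of k]] by (auto simp: L2_def w_def)
  have wn: "L2_norm M (\<lambda>x. complex_of_real (w k x)) \<le> a k" for k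
    using step[of k] by (simp add: L2_norm_def w_def)
  \<comment> \<open>The partial sums of the absolute increments are bounded in L2 by the sum of
    \<open>a\<close>. Their lower limit is therefore finite almost everywhere, and at such points
    the increments are absolutely summable.\<close>
  define G where "G N x = (\<Sum>k<N. complex_of_real (w k x))" for N x
  have GL2: "G N \<in> L2 M" for N unfolding G_def[abs_def] by (intro L2_sum wL2)
  have "L2_norm M (G N) \<le> suminf a" for N
  proof -
    have "L2_norm M (G N) \<le> (\<Sum>k<N. L2_norm M (\<lambda>x. complex_of_real (w k x)))"
      unfolding G_def[abs_def] by (intro L2_triangle_sum wL2)
    also have "\<dots> \<le> (\<Sum>k<N. a k)" by (intro sum_mono wn)
    also have "\<dots> \<le> suminf a" using a a0 by (intro sum_le_suminf) auto
    finally show ?thesis .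
  qed
  then have GN: "(\<integral>\<^sup>+x. ennreal ((cmod (G N x))\<^sup>2) \<partial>M) \<le> ennreal ((suminf a)\<^sup>2)" for N
    by (subst nn_integral_L2[OF GL2]) (auto intro!: power_mono ennreal_leI)
  have [measurable]: "G N \<in> borel_measurable M" for N using GL2 L2_measurable by blast
  have "(\<integral>\<^sup>+x. liminf (\<lambda>N. ennreal ((cmod (G N x))\<^sup>2)) \<partial>M)
      \<le> liminf (\<lambda>N. \<integral>\<^sup>+x. ennreal ((cmod (G N x))\<^sup>2) \<partial>M)"
    by (rule nn_integral_liminf) auto
  also have "\<dots> \<le> limsup (\<lambda>N. \<integral>\<^sup>+x. ennreal ((cmod (G N x))\<^sup>2) \<partial>M)"
    by (rule Liminf_le_Limsup) simp
  also have "\<dots> \<le> ennreal ((suminf a)\<^sup>2)"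
    using GN by (intro Limsup_bounded) auto
  finally have "(\<integral>\<^sup>+x. liminf (\<lambda>N. ennreal ((cmod (G N x))\<^sup>2)) \<partial>M) \<noteq> \<infinity>"
    by (auto simp: top_unique)
  then have "AE x in M. liminf (\<lambda>N. ennreal ((cmod (G N x))\<^sup>2)) \<noteq> \<infinity>"
    by (intro nn_integral_noteq_infinite) auto
  then have conv: "AE x in M. convergent (\<lambda>k. u k x)"
  proof eventually_elim
    fix x assume fin: "liminf (\<lambda>N. ennreal ((cmod (G N x))\<^sup>2)) \<noteq> \<infinity>"
    define s where "s N = (\<Sum>k<N. w k x)" for N
    have s0: "0 \<le> s N" for N by (auto simp: s_def w_def intro: sum_nonneg)
    have cG: "cmod (G N x) = s N" for N
    proof -
      have "G N x = complex_of_real (s N)" by (simp add: G_def s_def)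
      then show ?thesis using s0[of N] by simp
    qed
    have mono: "s i \<le> s j" if "i \<le> j" for i j
      unfolding s_def by (rule sum_mono2) (use that in \<open>auto simp: w_def\<close>)
    obtain c where c: "liminf (\<lambda>N. ennreal ((cmod (G N x))\<^sup>2)) = ennreal c" "0 \<le> c"
      using fin by (metis ennreal_cases infinity_ennreal_def)
    have "(s N)\<^sup>2 \<le> c" for N
    proof -
      have "ennreal ((s N)\<^sup>2) \<le> liminf (\<lambda>N. ennreal ((cmod (G N x))\<^sup>2))"
      proof (rule Liminf_bounded)
        show "\<forall>\<^sub>F n in sequentially. ennreal ((s N)\<^sup>2) \<le> ennreal ((cmod (G n x))\<^sup>2)"
          unfolding cG eventually_sequentially
          by (intro exI[of _ N]) (auto intro!: ennreal_leI power_mono mono s0)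
      qed
      with c show ?thesis by simp
    qed
    then have "s N \<le> sqrt c" for N
      by (rule real_le_rsqrt)
    then have "summable (\<lambda>k. w k x)"
      unfolding s_def by (intro summableI_nonneg_bounded[where x = "sqrt c"]) (auto simp: w_def)
    then have "summable (\<lambda>k. u (Suc k) x - u k x)"
      unfolding w_def by (rule summable_norm_cancel)
    then have "convergent (\<lambda>N. (\<Sum>k<N. u (Suc k) x - u k x) + u 0 x)"
      unfolding summable_iff_convergent by (intro convergent_add convergent_const)
    moreover have "(\<Sum>k<N. u (Suc k) x - u k x) = u N x - u 0 x" for N
      by (induction N) auto
    ultimately show "convergent (\<lambda>k. u k x)"
      by simp
  qed
  define g where "g x = lim (\<lambda>k. u k x)" for x
  have [measurable]: "g \<in> borel_measurable M" unfolding g_def[abs_def] by measurable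
  have lim: "AE x in M. (\<lambda>k. u k x) \<longlonglongrightarrow> g x"
    using conv by eventually_elim (simp add: g_def convergent_LIMSEQ_iff)
  \<comment> \<open>\<open>r k\<close> is the tail of the series of \<open>a\<close> from
    \<open>k\<close> on. It dominates every later difference \<open>u (k + p) - u k\<close>, hence,
    again by Fatou, the distance from \<open>u k\<close> to the limit.\<close>
  define r where "r k = suminf a - (\<Sum>i<k. a i)" for k
  have r0: "0 \<le> r k" for k
    unfolding r_def using sum_le_suminf[OF a, of "{..<k}"] a0 by auto
  have un: "L2_norm M (\<lambda>x. u (k + p) x - u k x) \<le> r k" for k p
  proof -
    have 1: "L2_norm M (\<lambda>x. u (k + p) x - u k x) \<le> (\<Sum>i<p. a (k + i))"
    proof (induction p)
      case (Suc p)
      have "L2_norm M (\<lambda>x. (u (k + Suc p) x - u (k + p) x) + (u (k + p) x - u k x))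
          \<le> L2_norm M (\<lambda>x. u (k + Suc p) x - u (k + p) x) + L2_norm M (\<lambda>x. u (k + p) x - u k x)"
        by (intro L2_triangle L2_diff u)
      with Suc step[of "k + p"] show ?case by simp
    qed simp
    have 2: "(\<Sum>i<p. a (k + i)) = (\<Sum>i<k+p. a i) - (\<Sum>i<k. a i)"
      by (induction p) auto
    have 3: "(\<Sum>i<k+p. a i) \<le> suminf a" using a a0 by (intro sum_le_suminf) auto
    from 1 2 3 show ?thesis unfolding r_def by linarith
  qed
  have dist: "(\<lambda>x. g x - u k x) \<in> L2 M \<and> L2_norm M (\<lambda>x. g x - u k x) \<le> r k" for k
  proof -
    have "(\<integral>\<^sup>+x. ennreal ((cmod (g x - u k x))\<^sup>2) \<partial>M)
        \<le> (\<integral>\<^sup>+x. liminf (\<lambda>p. ennreal ((cmod (u (k + p) x - u k x))\<^sup>2)) \<partial>M)"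
    proof (rule nn_integral_mono_AE)
      show "AE x in M. ennreal ((cmod (g x - u k x))\<^sup>2) \<le> liminf (\<lambda>p. ennreal ((cmod (u (k + p) x - u k x))\<^sup>2))"
        using lim
      proof eventually_elim
        fix x assume "(\<lambda>k. u k x) \<longlonglongrightarrow> g x"
        then have "(\<lambda>p. u (p + k) x) \<longlonglongrightarrow> g x" by (rule LIMSEQ_ignore_initial_segment)
        then have "(\<lambda>p. ennreal ((cmod (u (k + p) x - u k x))\<^sup>2)) \<longlonglongrightarrow> ennreal ((cmod (g x - u k x))\<^sup>2)"
          by (intro tendsto_intros) (simp add: add.commute)
        from lim_imp_Liminf[OF _ this] show
          "ennreal ((cmod (g x - u k x))\<^sup>2) \<le> liminf (\<lambda>p. ennreal ((cmod (u (k + p) x - u k x))\<^sup>2))"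
          by simp
      qed
    qed
    also have "\<dots> \<le> liminf (\<lambda>p. \<integral>\<^sup>+x. ennreal ((cmod (u (k + p) x - u k x))\<^sup>2) \<partial>M)"
      by (rule nn_integral_liminf) auto
    also have "\<dots> \<le> limsup (\<lambda>p. \<integral>\<^sup>+x. ennreal ((cmod (u (k + p) x - u k x))\<^sup>2) \<partial>M)"
      by (rule Liminf_le_Limsup) simp
    also have "\<dots> \<le> ennreal ((r k)\<^sup>2)"
    proof (rule Limsup_bounded, rule always_eventually, rule allI)
      fix p
      show "(\<integral>\<^sup>+x. ennreal ((cmod (u (k + p) x - u k x))\<^sup>2) \<partial>M) \<le> ennreal ((r k)\<^sup>2)"
        by (subst nn_integral_L2[OF L2_diff[OF u u]]) (auto intro!: ennreal_leI power_mono un)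
    qed
    finally show ?thesis
      using L2_if_nn_integral_le[of "\<lambda>x. g x - u k x" M "r k"] r0 by auto
  qed
  have "g \<in> L2 M"
    using L2_add[OF conjunct1[OF dist[of 0]] u[of 0]] by simp
  moreover have "(\<lambda>k. L2_norm M (\<lambda>x. u k x - g x)) \<longlonglongrightarrow> 0"
  proof (rule tendsto_sandwich[where f = "\<lambda>_. 0" and h = r])
    have "(\<lambda>k. suminf a - (\<Sum>i<k. a i)) \<longlonglongrightarrow> suminf a - suminf a"
      by (intro tendsto_diff tendsto_const summable_LIMSEQ a)
    then show "r \<longlonglongrightarrow> 0" unfolding r_def[abs_def] by simp
    show "\<forall>\<^sub>F k in sequentially. L2_norm M (\<lambda>x. u k x - g x) \<le> r k"
      using dist by (subst L2_norm_minus_commute) auto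
  qed auto
  ultimately show ?thesis by blast
qed

section \<open>Bounded Borel functional calculus\<close>

lemma L2_eq_AE_if_inner_eq:
  assumes u: "u \<in> L2 M" and v: "v \<in> L2 M"
    and eq: "\<And>h. h \<in> L2 M \<Longrightarrow> L2_inner M u h = L2_inner M v h"
  shows "AE x in M. u x = v x"
proof -
  let ?w = "\<lambda>x. u x - v x"
  have w: "?w \<in> L2 M" using u v by (rule L2_diff)
  have "L2_inner M ?w ?w = 0"
    using eq[OF w] by (simp add: L2_inner_diff_left[OF u v w])
  then have "L2_norm M ?w = 0" by (simp add: L2_inner_self)
  then show ?thesis using L2_norm_eq_0_iff[OF w] by auto
qed

section \<open>Bounded Borel functions and their approximation by step functions\<close>

definition bounded_borel :: "(real \<Rightarrow> complex) \<Rightarrow> bool" where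
  "bounded_borel F \<longleftrightarrow> F \<in> borel_measurable borel \<and> (\<exists>c. \<forall>s. cmod (F s) \<le> c)"

lemma bounded_borelI: "F \<in> borel_measurable borel \<Longrightarrow> (\<And>s. cmod (F s) \<le> c) \<Longrightarrow> bounded_borel F"
  by (auto simp: bounded_borel_def)

lemma bounded_borel_measurable [measurable_dest]: "bounded_borel F \<Longrightarrow> F \<in> borel_measurable borel"
  by (simp add: bounded_borel_def)

lemma bounded_borel_bound:
  assumes "bounded_borel F"
  obtains c where "0 \<le> c" "\<And>s. cmod (F s) \<le> c"
proof -
  obtain c where c: "\<And>s. cmod (F s) \<le> c" using assms by (auto simp: bounded_borel_def)
  have "0 \<le> cmod (F 0)" by simp
  also have "\<dots> \<le> c" by (rule c)
  finally show thesis using that c by blast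
qed

lemma bounded_borel_const: "bounded_borel (\<lambda>s. a)"
  by (rule bounded_borelI[of _ "cmod a"]) auto

lemma bounded_borel_indicator: "A \<in> sets borel \<Longrightarrow> bounded_borel (indicator A)"
  by (rule bounded_borelI[of _ 1]) (auto simp: indicator_def)

lemma bounded_borel_add:
  assumes F: "bounded_borel F" and G: "bounded_borel G"
  shows "bounded_borel (\<lambda>s. F s + G s)"
proof -
  obtain c where c: "\<And>s. cmod (F s) \<le> c" using F bounded_borel_bound by blast
  obtain d where d: "\<And>s. cmod (G s) \<le> d" using G bounded_borel_bound by blast
  show ?thesis
    using F G c d
    by (intro bounded_borelI[of _ "c + d"])
       (auto dest!: bounded_borel_measurable intro: norm_triangle_le add_mono)
qed

lemma bounded_borel_mult:
  assumes F: "bounded_borel F" and G: "bounded_borel G"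
  shows "bounded_borel (\<lambda>s. F s * G s)"
proof -
  obtain c where c: "0 \<le> c" "\<And>s. cmod (F s) \<le> c" using F bounded_borel_bound by blast
  obtain d where d: "\<And>s. cmod (G s) \<le> d" using G bounded_borel_bound by blast
  show ?thesis
    using F G c d
    by (intro bounded_borelI[of _ "c * d"])
       (auto dest!: bounded_borel_measurable simp: norm_mult intro: mult_mono)
qed

lemma bounded_borel_cnj:
  assumes F: "bounded_borel F" shows "bounded_borel (\<lambda>s. cnj (F s))"
proof -
  note [measurable] = bounded_borel_measurable[OF F]
  obtain c where "\<And>s. cmod (F s) \<le> c" using bounded_borel_bound[OF F] by blast
  then show ?thesis by (intro bounded_borelI[of _ c]) auto
qed

lemma bounded_borel_scale: "bounded_borel F \<Longrightarrow> bounded_borel (\<lambda>s. a * F s)"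
  by (intro bounded_borel_mult bounded_borel_const)

lemma bounded_borel_diff: "bounded_borel F \<Longrightarrow> bounded_borel G \<Longrightarrow> bounded_borel (\<lambda>s. F s - G s)"
  using bounded_borel_add[of F "\<lambda>s. (-1) * G s"] bounded_borel_scale[of G "-1"] by simp

lemma bounded_borel_sum: "(\<And>i. i \<in> I \<Longrightarrow> bounded_borel (F i)) \<Longrightarrow> bounded_borel (\<lambda>s. \<Sum>i\<in>I. F i s)"
  by (induction I rule: infinite_finite_induct) (auto intro: bounded_borel_add bounded_borel_const)

text \<open>The index type is pairs of integers because the pieces will be preimages of the cells of
  a square mesh in the complex plane.\<close>

definition step_fun :: "(int \<times> int) set \<Rightarrow> (int \<times> int \<Rightarrow> complex) \<Rightarrow> (int \<times> int \<Rightarrow> real set) \<Rightarrow> real \<Rightarrow> complex"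
  where "step_fun I a A = (\<lambda>s. \<Sum>i\<in>I. a i * indicator (A i) s)"

lemma bounded_borel_step_fun:
  "(\<And>i. i \<in> I \<Longrightarrow> A i \<in> sets borel) \<Longrightarrow> bounded_borel (step_fun I a A)"
  unfolding step_fun_def by (intro bounded_borel_sum bounded_borel_scale bounded_borel_indicator) auto

text \<open>Real and imaginary parts are rounded down to multiples of \<open>e / 2\<close>, each
  contributing at most half of the error. Boundedness of \<open>F\<close> confines the values to
  finitely many cells.\<close>

lemma bounded_borel_approx:
  assumes F: "bounded_borel F" and "0 < e"
  shows "\<exists>I a A. finite I \<and> (\<forall>i. A i \<in> sets borel) \<and> (\<forall>s. cmod (F s - step_fun I a A s) \<le> e)"
proof -
  obtain c where c: "\<And>s. cmod (F s) \<le> c" using F bounded_borel_bound by blast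
  have [measurable]: "F \<in> borel_measurable borel" using F by (rule bounded_borel_measurable)
  define d where "d = e / 2"
  have d: "0 < d" using \<open>0 < e\<close> by (simp add: d_def)
  define J where "J = {- \<lceil>c / d\<rceil> - 1 .. \<lceil>c / d\<rceil> + 1}"
  define p where "p s = (\<lfloor>Re (F s) / d\<rfloor>, \<lfloor>Im (F s) / d\<rfloor>)" for s
  define A where "A i = {s. p s = i}" for i
  define a where "a i = complex_of_real d * Complex (of_int (fst i)) (of_int (snd i))" for i :: "int \<times> int"
  have "A i = {s \<in> space borel. of_int \<lfloor>Re (F s) / d\<rfloor> = (of_int (fst i) :: real)
      \<and> of_int \<lfloor>Im (F s) / d\<rfloor> = (of_int (snd i) :: real)}" for i
    by (cases i) (auto simp: A_def p_def)
  also have "\<dots> i \<in> sets borel" for i by measurable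
  finally have A: "A i \<in> sets borel" for i .
  have rng: "\<lfloor>x / d\<rfloor> \<in> J" if "\<bar>x\<bar> \<le> c" for x
  proof -
    have "x / d \<le> c / d" "- (c / d) \<le> x / d" using that d by (auto simp: field_simps)
    then show ?thesis unfolding J_def by (auto; linarith)
  qed
  have pJ: "p s \<in> J \<times> J" for s
    unfolding p_def using c[of s] abs_Re_le_cmod[of "F s"] abs_Im_le_cmod[of "F s"]
    by (auto intro!: rng simp: mem_Times_iff)
  have "step_fun (J \<times> J) a A s = (\<Sum>i\<in>J \<times> J. if p s = i then a i else 0)" for s
    unfolding step_fun_def by (intro sum.cong) (auto simp: A_def indicator_def)
  then have st: "step_fun (J \<times> J) a A s = a (p s)" for s
    using pJ[of s] by (simp add: J_def sum.delta')
  have fl: "\<bar>x - d * of_int \<lfloor>x / d\<rfloor>\<bar> \<le> d" for x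
  proof -
    have "of_int \<lfloor>x / d\<rfloor> \<le> x / d" "x / d \<le> of_int \<lfloor>x / d\<rfloor> + 1" by linarith+
    then have "d * of_int \<lfloor>x / d\<rfloor> \<le> x" "x \<le> d * of_int \<lfloor>x / d\<rfloor> + d"
      using mult_left_mono[of "of_int \<lfloor>x / d\<rfloor>" "x / d" d]
        mult_left_mono[of "x / d" "of_int \<lfloor>x / d\<rfloor> + 1" d] d by (auto simp: distrib_left)
    then show ?thesis by linarith
  qed
  have "cmod (F s - step_fun (J \<times> J) a A s) \<le> e" for s
  proof -
    have "cmod (F s - a (p s)) \<le> \<bar>Re (F s - a (p s))\<bar> + \<bar>Im (F s - a (p s))\<bar>" by (rule cmod_le)
    also have "\<dots> \<le> d + d"
      using fl[of "Re (F s)"] fl[of "Im (F s)"] by (intro add_mono) (auto simp: a_def p_def)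
    finally show ?thesis by (simp add: st d_def)
  qed
  moreover have "finite (J \<times> J)" by (simp add: J_def)
  ultimately show ?thesis using A by blast
qed

text \<open>Complex measures on the line enter through the functionals they define on bounded Borel functions;
  these are determined by their values on indicators.\<close>

definition sup_bounded_functional :: "((real \<Rightarrow> complex) \<Rightarrow> complex) \<Rightarrow> bool" where
  "sup_bounded_functional J \<longleftrightarrow>
     (\<forall>F G. bounded_borel F \<longrightarrow> bounded_borel G \<longrightarrow> J (\<lambda>s. F s + G s) = J F + J G) \<and>
     (\<forall>F a. bounded_borel F \<longrightarrow> J (\<lambda>s. a * F s) = a * J F) \<and>
     (\<exists>K. \<forall>F c. bounded_borel F \<longrightarrow> (\<forall>s. cmod (F s) \<le> c) \<longrightarrow> cmod (J F) \<le> K * c)"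

context
  fixes J assumes J: "sup_bounded_functional J"
begin

lemma functional_add: "bounded_borel F \<Longrightarrow> bounded_borel G \<Longrightarrow> J (\<lambda>s. F s + G s) = J F + J G"
  using J by (simp add: sup_bounded_functional_def)

lemma functional_scale: "bounded_borel F \<Longrightarrow> J (\<lambda>s. a * F s) = a * J F"
  using J by (simp add: sup_bounded_functional_def)

lemma functional_bound:
  obtains K where "0 \<le> K" "\<And>F c. bounded_borel F \<Longrightarrow> (\<And>s. cmod (F s) \<le> c) \<Longrightarrow> cmod (J F) \<le> K * c"
proof -
  obtain K where K: "\<And>F c. bounded_borel F \<Longrightarrow> (\<And>s. cmod (F s) \<le> c) \<Longrightarrow> cmod (J F) \<le> K * c"
    using J unfolding sup_bounded_functional_def by metis
  have "0 \<le> cmod (J (\<lambda>s. 0))" by simp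
  also have "\<dots> \<le> K * 1" by (rule K[OF bounded_borel_const]) simp
  finally show thesis using that K by simp
qed

lemma functional_sum:
  "(\<And>i. i \<in> I \<Longrightarrow> bounded_borel (F i)) \<Longrightarrow> J (\<lambda>s. \<Sum>i\<in>I. F i s) = (\<Sum>i\<in>I. J (F i))"
proof (induction I rule: infinite_finite_induct)
  case (insert i I)
  then show ?case using functional_add[of "F i" "\<lambda>s. \<Sum>i\<in>I. F i s"] bounded_borel_sum[of I F] by simp
qed (use functional_scale[OF bounded_borel_const[of 0], of 0] in auto)

lemma functional_diff: "bounded_borel F \<Longrightarrow> bounded_borel G \<Longrightarrow> J (\<lambda>s. F s - G s) = J F - J G"
  using functional_add[of F "\<lambda>s. (-1) * G s"] functional_scale[of G "-1"] bounded_borel_scale[of G "-1"]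
  by simp

end

text \<open>Step functions are dense for the supremum norm, and each functional is continuous for
  it.\<close>

lemma functional_eqI:
  assumes J: "sup_bounded_functional J" and J': "sup_bounded_functional J'"
    and ind: "\<And>A. A \<in> sets borel \<Longrightarrow> J (indicator A) = J' (indicator A)"
    and F: "bounded_borel F"
  shows "J F = J' F"
proof -
  obtain K where K: "0 \<le> K" "\<And>F c. bounded_borel F \<Longrightarrow> (\<And>s. cmod (F s) \<le> c) \<Longrightarrow> cmod (J F) \<le> K * c"
    using functional_bound[OF J] by blast
  obtain K' where K': "0 \<le> K'" "\<And>F c. bounded_borel F \<Longrightarrow> (\<And>s. cmod (F s) \<le> c) \<Longrightarrow> cmod (J' F) \<le> K' * c"
    using functional_bound[OF J'] by blast
  have "cmod (J F - J' F) \<le> 0 + e" if "0 < e" for e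
  proof -
    \<comment> \<open>The extra 1 only prevents division by zero when both functionals have bound
      0.\<close>
    define e' where "e' = e / (K + K' + 1)"
    have e': "0 < e'" using that K K' by (simp add: e'_def)
    obtain I a A where *: "finite I" "\<And>i. A i \<in> sets borel" "\<And>s. cmod (F s - step_fun I a A s) \<le> e'"
      using bounded_borel_approx[OF F e'] by metis
    let ?G = "step_fun I a A"
    have G: "bounded_borel ?G" using * by (intro bounded_borel_step_fun)
    have step: "J ?G = (\<Sum>i\<in>I. a i * J (indicator (A i)))" if "sup_bounded_functional J" for J
      unfolding step_fun_def using *
      by (subst functional_sum[OF that])
         (auto intro!: bounded_borel_scale bounded_borel_indicator simp: functional_scale[OF that bounded_borel_indicator])
    have JG: "J ?G = J' ?G" unfolding step[OF J] step[OF J'] using ind *(2) by simp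
    have "J F - J' F = J (\<lambda>s. F s - ?G s) - J' (\<lambda>s. F s - ?G s)"
      using functional_diff[OF J F G] functional_diff[OF J' F G] JG by simp
    also have "cmod \<dots> \<le> K * e' + K' * e'"
      by (intro norm_triangle_le_diff add_mono K(2) K'(2) bounded_borel_diff F G *(3))
    also have "\<dots> \<le> (K + K' + 1) * e'" using e' by (simp add: algebra_simps)
    also have "\<dots> = e" using K(1) K'(1) by (simp add: e'_def)
    finally show ?thesis by simp
  qed
  then have "cmod (J F - J' F) \<le> 0" by (rule field_le_epsilon)
  then show ?thesis by simp
qed

lemma sup_bounded_functional_add:
  assumes J: "sup_bounded_functional J" and J': "sup_bounded_functional J'"
  shows "sup_bounded_functional (\<lambda>F. J F + J' F)"
proof -
  obtain K where K: "0 \<le> K" "\<And>F c. bounded_borel F \<Longrightarrow> (\<And>s. cmod (F s) \<le> c) \<Longrightarrow> cmod (J F) \<le> K * c"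
    using functional_bound[OF J] by blast
  obtain K' where K': "0 \<le> K'" "\<And>F c. bounded_borel F \<Longrightarrow> (\<And>s. cmod (F s) \<le> c) \<Longrightarrow> cmod (J' F) \<le> K' * c"
    using functional_bound[OF J'] by blast
  show ?thesis
    unfolding sup_bounded_functional_def
  proof (intro conjI allI impI)
    show "\<exists>K. \<forall>F c. bounded_borel F \<longrightarrow> (\<forall>s. cmod (F s) \<le> c) \<longrightarrow> cmod (J F + J' F) \<le> K * c"
      using K K' by (intro exI[of _ "K + K'"]) (auto simp: distrib_right intro!: norm_triangle_le add_mono)
  qed (auto simp: functional_add[OF J] functional_add[OF J'] functional_scale[OF J]
        functional_scale[OF J'] algebra_simps)
qed

lemma sup_bounded_functional_scale:
  assumes J: "sup_bounded_functional J"
  shows "sup_bounded_functional (\<lambda>F. a * J F)"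
proof -
  obtain K where K: "0 \<le> K" "\<And>F c. bounded_borel F \<Longrightarrow> (\<And>s. cmod (F s) \<le> c) \<Longrightarrow> cmod (J F) \<le> K * c"
    using functional_bound[OF J] by blast
  show ?thesis
    unfolding sup_bounded_functional_def
  proof (intro conjI allI impI)
    show "\<exists>K. \<forall>F c. bounded_borel F \<longrightarrow> (\<forall>s. cmod (F s) \<le> c) \<longrightarrow> cmod (a * J F) \<le> K * c"
      using K by (intro exI[of _ "cmod a * K"]) (auto simp: norm_mult mult.assoc intro!: mult_left_mono)
  qed (auto simp: functional_add[OF J] functional_scale[OF J] algebra_simps)
qed

text \<open>This is the passage from a complex measure to the measure with density \<open>G\<close>
  against it. It carries multiplicativity from indicators over to all bounded Borel
  functions.\<close>

lemma sup_bounded_functional_mult: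
  assumes J: "sup_bounded_functional J" and G: "bounded_borel G"
  shows "sup_bounded_functional (\<lambda>F. J (\<lambda>s. G s * F s))"
proof -
  obtain K where K: "0 \<le> K" "\<And>F c. bounded_borel F \<Longrightarrow> (\<And>s. cmod (F s) \<le> c) \<Longrightarrow> cmod (J F) \<le> K * c"
    using functional_bound[OF J] by blast
  obtain g where g: "0 \<le> g" "\<And>s. cmod (G s) \<le> g" using bounded_borel_bound[OF G] by blast
  show ?thesis
    unfolding sup_bounded_functional_def
  proof (intro conjI allI impI)
    show "\<exists>K. \<forall>F c. bounded_borel F \<longrightarrow> (\<forall>s. cmod (F s) \<le> c) \<longrightarrow> cmod (J (\<lambda>s. G s * F s)) \<le> K * c"
      using K g by (intro exI[of _ "K * g"])
        (auto simp: norm_mult mult.assoc intro!: K(2) mult_mono bounded_borel_mult[OF G])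
    fix F F' a assume F: "bounded_borel F"
    show "J (\<lambda>s. G s * (a * F s)) = a * J (\<lambda>s. G s * F s)"
      using functional_scale[OF J bounded_borel_mult[OF G F], of a] by (simp add: ac_simps)
    assume F': "bounded_borel F'"
    show "J (\<lambda>s. G s * (F s + F' s)) = J (\<lambda>s. G s * F s) + J (\<lambda>s. G s * F' s)"
      using functional_add[OF J bounded_borel_mult[OF G F] bounded_borel_mult[OF G F']]
      by (simp add: distrib_left)
  qed
qed

text \<open>The functional of the conjugate measure; through it the symmetry of the projections
  becomes a statement about adjoints.\<close>

lemma sup_bounded_functional_cnj:
  assumes J: "sup_bounded_functional J"
  shows "sup_bounded_functional (\<lambda>F. cnj (J (\<lambda>s. cnj (F s))))"
proof -
  obtain K where K: "0 \<le> K" "\<And>F c. bounded_borel F \<Longrightarrow> (\<And>s. cmod (F s) \<le> c) \<Longrightarrow> cmod (J F) \<le> K * c"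
    using functional_bound[OF J] by blast
  show ?thesis
    unfolding sup_bounded_functional_def
  proof (intro conjI allI impI)
    show "\<exists>K. \<forall>F c. bounded_borel F \<longrightarrow> (\<forall>s. cmod (F s) \<le> c) \<longrightarrow> cmod (cnj (J (\<lambda>s. cnj (F s)))) \<le> K * c"
      using K by (intro exI[of _ K]) (auto intro!: K(2) bounded_borel_cnj)
  qed (auto simp: functional_add[OF J] functional_scale[OF J] bounded_borel_cnj)
qed

lemma bounded_borel_integrable:
  assumes F: "bounded_borel F" and "finite_measure M" and M: "sets M = sets borel"
  shows "integrable M F"
proof -
  interpret finite_measure M by fact
  obtain c where "\<And>s. cmod (F s) \<le> c" using bounded_borel_bound[OF F] by blast
  then show ?thesis
    using bounded_borel_measurable[OF F]
    by (intro integrable_const_bound[where B = c]) (auto cong: measurable_cong_sets[OF M refl])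
qed

lemma integral_indicator_complex:
  "(\<integral>s. indicator A s \<partial>M) = complex_of_real (measure M (A \<inter> space M))"
proof -
  have "(\<lambda>s. indicator A s) = (\<lambda>s. complex_of_real (indicator A s))"
    by (auto simp: indicator_def)
  then show ?thesis by (simp only: integral_complex_of_real) simp
qed

lemma sup_bounded_functional_integral:
  assumes fin: "finite_measure M" and M: "sets M = sets borel"
  shows "sup_bounded_functional (\<lambda>F. \<integral>s. F s \<partial>M)"
  unfolding sup_bounded_functional_def
proof (intro conjI allI impI)
  show "\<exists>K. \<forall>F c. bounded_borel F \<longrightarrow> (\<forall>s. cmod (F s) \<le> c) \<longrightarrow> cmod (\<integral>s. F s \<partial>M) \<le> K * c"
  proof (intro exI[of _ "measure M (space M)"] allI impI)
    fix F c assume F: "bounded_borel F" and c: "\<forall>s. cmod (F s) \<le> c"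
    have "cmod (\<integral>s. F s \<partial>M) \<le> (\<integral>s. cmod (F s) \<partial>M)" by (rule integral_norm_bound)
    also have "\<dots> \<le> (\<integral>s. c \<partial>M)"
      using bounded_borel_integrable[OF F assms] c finite_measure.integrable_const[OF fin]
      by (intro integral_mono) auto
    finally show "cmod (\<integral>s. F s \<partial>M) \<le> measure M (space M) * c" by simp
  qed
qed (auto simp: bounded_borel_integrable[OF _ assms])

section \<open>Projection-valued measures, polarized integrals and the multiplicative
  calculus\<close>

locale spectral_measure =
  fixes M :: "'a measure" and E :: "real set \<Rightarrow> ('a \<Rightarrow> complex) \<Rightarrow> ('a \<Rightarrow> complex)"
  assumes pvm: "projection_valued_measure M E"
begin

lemma E_L2: "A \<in> sets borel \<Longrightarrow> f \<in> L2 M \<Longrightarrow> E A f \<in> L2 M"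
  using pvm by (auto simp: projection_valued_measure_def)

lemma E_sym: "\<lbrakk>A \<in> sets borel; f \<in> L2 M; g \<in> L2 M\<rbrakk> \<Longrightarrow> L2_inner M (E A f) g = L2_inner M f (E A g)"
  using pvm by (auto simp: projection_valued_measure_def)

lemma E_mult: "\<lbrakk>A \<in> sets borel; B \<in> sets borel; f \<in> L2 M\<rbrakk> \<Longrightarrow> AE x in M. E A (E B f) x = E (A \<inter> B) f x"
  using pvm by (auto simp: projection_valued_measure_def)

lemma E_UNIV: "f \<in> L2 M \<Longrightarrow> AE x in M. E UNIV f x = f x"
  using pvm by (auto simp: projection_valued_measure_def)

lemma E_inner_mult:
  assumes "A \<in> sets borel" "B \<in> sets borel" "f \<in> L2 M" "h \<in> L2 M"
  shows "L2_inner M (E A f) (E B h) = L2_inner M (E (A \<inter> B) f) h"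
proof -
  have "L2_inner M (E A f) (E B h) = L2_inner M (E B (E A f)) h"
    using assms by (simp add: E_sym E_L2)
  also have "\<dots> = L2_inner M (E (B \<inter> A) f) h"
    using assms by (intro L2_inner_cong_AE E_mult) (auto intro!: E_L2)
  finally show ?thesis by (simp add: Int_commute)
qed

lemma E_inner_self:
  "A \<in> sets borel \<Longrightarrow> f \<in> L2 M \<Longrightarrow> L2_inner M (E A f) f = complex_of_real ((L2_norm M (E A f))\<^sup>2)"
  using E_inner_mult[of A A f f] by (simp add: L2_inner_self)

text \<open>Only symmetry of \<open>E A\<close> is postulated. It moves the projection to
  \<open>h\<close>, where linearity of the inner product takes over.\<close>

lemma E_inner_linear:
  assumes "A \<in> sets borel" "f \<in> L2 M" "g \<in> L2 M" "h \<in> L2 M"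
  shows "L2_inner M (E A (\<lambda>x. f x + a * g x)) h = L2_inner M (E A f) h + a * L2_inner M (E A g) h"
  using assms
  by (simp add: E_sym L2_add L2_scale L2_inner_add_left E_L2 L2_inner_scale_left)

abbreviation \<mu> where "\<mu> \<equiv> scalar_spectral_measure M E"

abbreviation I where "I \<equiv> spectral_integral M E"

lemma E_sums:
  assumes A: "range A \<subseteq> sets borel" "disjoint_family A" and f: "f \<in> L2 M"
  shows "(\<lambda>i. Re (L2_inner M (E (A i) f) f)) sums Re (L2_inner M (E (\<Union>i. A i) f) f)"
proof -
  let ?U = "\<Union>i. A i"
  have A': "A i \<in> sets borel" for i using A by auto
  then have U: "?U \<in> sets borel" by auto
  let ?d = "\<lambda>N x. E ?U f x - (\<Sum>i<N. E (A i) f x)"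
  have lim: "(\<lambda>N. L2_norm M (?d N)) \<longlonglongrightarrow> 0"
    using pvm A f by (auto simp: projection_valued_measure_def)
  have "Re (L2_inner M (E ?U f) f) - (\<Sum>i<N. Re (L2_inner M (E (A i) f) f)) = Re (L2_inner M (?d N) f)" for N
    using A' U f by (simp add: L2_inner_diff_left L2_inner_sum_left L2_sum E_L2)
  moreover have "\<bar>Re (L2_inner M (?d N) f)\<bar> \<le> L2_norm M (?d N) * L2_norm M f" for N
    using A' U f by (intro order_trans[OF abs_Re_le_cmod] L2_Cauchy_Schwarz L2_diff L2_sum E_L2) auto
  ultimately have le: "\<bar>Re (L2_inner M (E ?U f) f) - (\<Sum>i<N. Re (L2_inner M (E (A i) f) f))\<bar>
      \<le> L2_norm M (?d N) * L2_norm M f" for N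
    by simp
  have lim': "(\<lambda>N. L2_norm M (?d N) * L2_norm M f) \<longlonglongrightarrow> 0"
    using tendsto_mult_right[OF lim, of "L2_norm M f"] by simp
  have "(\<lambda>N. Re (L2_inner M (E ?U f) f) - (\<Sum>i<N. Re (L2_inner M (E (A i) f) f))) \<longlonglongrightarrow> 0"
    by (rule Lim_null_comparison[OF _ lim']) (use le in auto)
  then have "(\<lambda>N. Re (L2_inner M (E ?U f) f) - (Re (L2_inner M (E ?U f) f) - (\<Sum>i<N. Re (L2_inner M (E (A i) f) f))))
      \<longlonglongrightarrow> Re (L2_inner M (E ?U f) f) - 0"
    by (intro tendsto_diff tendsto_const)
  then show ?thesis by (simp add: sums_def)
qed

lemma E_inner_nonneg: "A \<in> sets borel \<Longrightarrow> f \<in> L2 M \<Longrightarrow> 0 \<le> Re (L2_inner M (E A f) f)"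
  by (simp add: E_inner_self)

lemma space_\<mu> [simp]: "space (\<mu> f) = UNIV" and sets_\<mu> [simp, measurable_cong]: "sets (\<mu> f) = sets borel"
  by (simp_all add: scalar_spectral_measure_def sets.sigma_sets_eq[of borel, simplified])

lemma emeasure_\<mu>:
  assumes f: "f \<in> L2 M" and A: "A \<in> sets borel"
  shows "emeasure (\<mu> f) A = ennreal (Re (L2_inner M (E A f) f))"
proof (rule emeasure_measure_of[OF scalar_spectral_measure_def])
  \<comment> \<open>The constant sequence of empty sets is disjoint, and a convergent series with
    constant terms has terms 0.\<close>
  have "(\<lambda>i. Re (L2_inner M (E {} f) f)) sums Re (L2_inner M (E (\<Union>i::nat. {}) f) f)"
    by (rule E_sums[OF _ _ f]) (auto simp: disjoint_family_on_def)
  then have "summable (\<lambda>i::nat. Re (L2_inner M (E {} f) f))" by (rule sums_summable)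
  then have "Re (L2_inner M (E {} f) f) = 0" by (simp add: summable_const_iff)
  then show "positive (sets (\<mu> f)) (\<lambda>A. ennreal (Re (L2_inner M (E A f) f)))"
    by (simp add: positive_def)
  show "countably_additive (sets (\<mu> f)) (\<lambda>A. ennreal (Re (L2_inner M (E A f) f)))"
    unfolding sets_\<mu> countably_additive_def
  proof (intro allI impI)
    fix A :: "nat \<Rightarrow> real set"
    assume A: "range A \<subseteq> sets borel" "disjoint_family A"
    then have "A i \<in> sets borel" for i by auto
    then show "(\<Sum>i. ennreal (Re (L2_inner M (E (A i) f) f))) = ennreal (Re (L2_inner M (E (\<Union> (range A)) f) f))"
      using E_sums[OF A f] E_inner_nonneg[OF _ f] by (intro suminf_ennreal_eq) auto
  qed
qed (use A in auto)

lemma emeasure_\<mu>_norm: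
  "f \<in> L2 M \<Longrightarrow> A \<in> sets borel \<Longrightarrow> emeasure (\<mu> f) A = ennreal ((L2_norm M (E A f))\<^sup>2)"
  by (simp add: emeasure_\<mu> E_inner_self)

lemma measure_\<mu>: "f \<in> L2 M \<Longrightarrow> A \<in> sets borel \<Longrightarrow> complex_of_real (measure (\<mu> f) A) = L2_inner M (E A f) f"
  by (simp add: measure_def emeasure_\<mu>_norm E_inner_self)

lemma measure_\<mu>_UNIV: 
  assumes "f \<in> L2 M" shows "measure (\<mu> f) UNIV = (L2_norm M f)\<^sup>2"
proof -
  have "L2_norm M (E UNIV f) = L2_norm M f"
    using assms by (intro L2_norm_cong_AE E_UNIV) (auto intro: E_L2)
  then show ?thesis using assms by (simp add: measure_def emeasure_\<mu>_norm)
qed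

lemma finite_\<mu>: "f \<in> L2 M \<Longrightarrow> finite_measure (\<mu> f)"
  by (rule finite_measureI) (simp add: emeasure_\<mu>)

lemma \<mu>_eqI:
  assumes "f \<in> L2 M" "g \<in> L2 M" "\<And>A. A \<in> sets borel \<Longrightarrow> L2_inner M (E A f) f = L2_inner M (E A g) g"
  shows "\<mu> f = \<mu> g"
  by (rule measure_eqI) (auto simp: emeasure_\<mu> assms)

text \<open>Compatibility of \<open>E A\<close> with equality almost everywhere is no axiom;
  symmetry moves the projection away from the argument that is being replaced.\<close>

lemma \<mu>_cong_AE:
  assumes f: "f \<in> L2 M" and g: "g \<in> L2 M" and eq: "AE x in M. f x = g x"
  shows "\<mu> f = \<mu> g"
proof (rule \<mu>_eqI[OF f g])
  fix A :: "real set" assume A: "A \<in> sets borel"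
  have "L2_inner M (E A f) f = L2_inner M (E A f) g"
    by (intro L2_inner_cong_AE E_L2 A f g eq) auto
  also have "\<dots> = L2_inner M f (E A g)" by (intro E_sym A f g)
  also have "\<dots> = L2_inner M g (E A g)"
    by (intro L2_inner_cong_AE E_L2 A f g eq) auto
  also have "\<dots> = L2_inner M (E A g) g" by (intro E_sym[symmetric] A g)
  finally show "L2_inner M (E A f) f = L2_inner M (E A g) g" .
qed

lemma \<mu>_scale_unit:
  assumes f: "f \<in> L2 M" and a: "cmod a = 1"
  shows "\<mu> (\<lambda>x. a * f x) = \<mu> f"
proof (rule \<mu>_eqI[OF L2_scale[OF f] f])
  fix A :: "real set" assume A: "A \<in> sets borel"
  have "a * cnj a = 1" using a by (simp add: complex_norm_square[symmetric])
  then show "L2_inner M (E A (\<lambda>x. a * f x)) (\<lambda>x. a * f x) = L2_inner M (E A f) f"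
    using A f by (simp add: L2_inner_scale_right E_sym L2_scale L2_inner_scale_left E_L2 ac_simps)
qed

lemma functional_I:
  assumes "f \<in> L2 M" "h \<in> L2 M"
  shows "sup_bounded_functional (\<lambda>F. I F f h)"
proof -
  have fin: "sup_bounded_functional (\<lambda>F. \<integral>s. F s \<partial>\<mu> (\<lambda>x. f x + \<i> ^ k * h x))" for k
    using assms by (intro sup_bounded_functional_integral finite_\<mu> L2_add L2_scale) auto
  have "sup_bounded_functional (\<lambda>F. (1/4) * ((\<i> ^ 0 * (\<integral>s. F s \<partial>\<mu> (\<lambda>x. f x + \<i> ^ 0 * h x)) +
      \<i> ^ 1 * (\<integral>s. F s \<partial>\<mu> (\<lambda>x. f x + \<i> ^ 1 * h x))) + (\<i> ^ 2 * (\<integral>s. F s \<partial>\<mu> (\<lambda>x. f x + \<i> ^ 2 * h x)) +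
      \<i> ^ 3 * (\<integral>s. F s \<partial>\<mu> (\<lambda>x. f x + \<i> ^ 3 * h x)))))"
    by (intro sup_bounded_functional_add sup_bounded_functional_scale fin)
  moreover have "{..<4} = {0, 1, 2, 3 :: nat}" by auto
  ultimately show ?thesis
    unfolding spectral_integral_def by (simp add: add.assoc)
qed

lemma I_indicator:
  assumes A: "A \<in> sets borel" and f: "f \<in> L2 M" and h: "h \<in> L2 M"
  shows "I (indicator A) f h = L2_inner M (E A f) h"
proof -
  have "(\<integral>s. indicator A s \<partial>\<mu> g) = L2_inner M (E A g) g" if "g \<in> L2 M" for g
    using that A by (simp add: integral_indicator_complex measure_\<mu>)
  moreover define X :: "complex \<Rightarrow> complex" where "X a = (\<integral>s. indicator A s \<partial>\<mu> (\<lambda>x. f x + a * h x))" for a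
  \<comment> \<open>After multiplication by \<open>a\<close> with |a| = 1, the four terms carry the
    factors a, 1, a^2 and a. Over the fourth roots of unity all of them sum to zero except the
    second, which gives 4.\<close>
  ultimately have X: "X a = L2_inner M (E A f) f + cnj a * L2_inner M (E A f) h
        + a * L2_inner M (E A h) f + a * cnj a * L2_inner M (E A h) h" for a
    using A f h
    by (simp add: L2_add L2_scale E_inner_linear L2_inner_add_right L2_inner_scale_right E_L2 algebra_simps)
  have "I (indicator A) f h = (\<Sum>k<4. \<i> ^ k * X (\<i> ^ k)) / 4"
    by (simp add: spectral_integral_def X_def)
  also have "\<dots> = L2_inner M (E A f) h"
    unfolding X by (simp add: numeral_eq_Suc algebra_simps)
  finally show ?thesis .
qed

text \<open>The common pattern of the identities below: check them on indicators, where they concern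
  projections, and extend by sup-continuity.\<close>

lemma I_eqI:
  assumes "f \<in> L2 M" "h \<in> L2 M" "sup_bounded_functional J"
    and "\<And>A. A \<in> sets borel \<Longrightarrow> L2_inner M (E A f) h = J (indicator A)" and "bounded_borel F"
  shows "I F f h = J F"
  by (rule functional_eqI[OF functional_I[OF assms(1,2)] assms(3) _ assms(5)])
     (simp add: I_indicator assms)

lemma I_linear:
  assumes "bounded_borel F" "f \<in> L2 M" "g \<in> L2 M" "h \<in> L2 M"
  shows "I F (\<lambda>x. f x + a * g x) h = I F f h + a * I F g h"
  by (rule I_eqI[of _ _ "\<lambda>F. I F f h + a * I F g h"])
     (use assms in \<open>auto intro!: L2_add L2_scale sup_bounded_functional_add sup_bounded_functional_scale functional_I
        simp: I_indicator E_inner_linear\<close>)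

lemma I_cnj:
  assumes "bounded_borel F" "f \<in> L2 M" "h \<in> L2 M"
  shows "I F f h = cnj (I (\<lambda>s. cnj (F s)) h f)"
proof (rule I_eqI[of _ _ "\<lambda>F. cnj (I (\<lambda>s. cnj (F s)) h f)"])
  fix A :: "real set" assume A: "A \<in> sets borel"
  have "(\<lambda>s. cnj (indicator A s)) = indicator A" by (auto simp: indicator_def)
  then show "L2_inner M (E A f) h = cnj (I (\<lambda>s. cnj (indicator A s)) h f)"
    using A assms by (simp add: I_indicator E_sym L2_inner_cnj[symmetric])
qed (use assms in \<open>auto intro: sup_bounded_functional_cnj functional_I\<close>)

lemma I_self:
  assumes "bounded_borel F" "f \<in> L2 M"
  shows "I F f f = (\<integral>s. F s \<partial>\<mu> f)"
  by (rule I_eqI[of _ _ "\<lambda>F. \<integral>s. F s \<partial>\<mu> f"])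
     (use assms in \<open>auto intro!: sup_bounded_functional_integral finite_\<mu> simp: integral_indicator_complex measure_\<mu>\<close>)

text \<open>First instance of multiplicativity; on indicators it is the product rule for
  projections.\<close>

lemma I_E_right:
  assumes "bounded_borel F" "f \<in> L2 M" "h \<in> L2 M" "A \<in> sets borel"
  shows "I F f (E A h) = I (\<lambda>s. indicator A s * F s) f h"
proof (rule I_eqI[of _ _ "\<lambda>F. I (\<lambda>s. indicator A s * F s) f h"])
  fix B :: "real set" assume B: "B \<in> sets borel"
  have "(\<lambda>s. indicator A s * indicator B s) = (indicator (B \<inter> A) :: real \<Rightarrow> complex)"
    by (auto simp: indicator_def)
  then show "L2_inner M (E B f) (E A h) = I (\<lambda>s. indicator A s * indicator B s) f h"
    using B assms by (simp add: I_indicator E_inner_mult)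
qed (use assms in \<open>auto intro!: E_L2 functional_I bounded_borel_indicator
      sup_bounded_functional_mult[where G = "indicator A"]\<close>)

text \<open>A relation instead of the function \<open>op_fun\<close>: any representative of the
  operator qualifies, so sums, products, powers and limits of representatives can be formed freely
  and compared weakly.\<close>

definition implements :: "(real \<Rightarrow> complex) \<Rightarrow> (('a \<Rightarrow> complex) \<Rightarrow> ('a \<Rightarrow> complex)) \<Rightarrow> bool" where
  "implements F S \<longleftrightarrow> bounded_borel F \<and> (\<forall>f\<in>L2 M. S f \<in> L2 M) \<and>
     (\<forall>f\<in>L2 M. \<forall>h\<in>L2 M. L2_inner M (S f) h = I F f h)"

lemma implements_L2: "implements F S \<Longrightarrow> f \<in> L2 M \<Longrightarrow> S f \<in> L2 M"
  by (simp add: implements_def)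

lemma implements_bounded_borel: "implements F S \<Longrightarrow> bounded_borel F"
  by (simp add: implements_def)

lemma implements_inner: "implements F S \<Longrightarrow> f \<in> L2 M \<Longrightarrow> h \<in> L2 M \<Longrightarrow> L2_inner M (S f) h = I F f h"
  by (simp add: implements_def)

text \<open>For an indicator \<open>G\<close> the projection moves to \<open>h\<close> and is
  absorbed by \<open>I_E_right\<close>; the general case follows by density.\<close>

lemma I_implements_left:
  assumes S: "implements F S" and G: "bounded_borel G" and f: "f \<in> L2 M" and h: "h \<in> L2 M"
  shows "I G (S f) h = I (\<lambda>s. F s * G s) f h"
proof (rule I_eqI[of _ _ "\<lambda>G. I (\<lambda>s. F s * G s) f h"])
  fix A :: "real set" assume A: "A \<in> sets borel"
  have "L2_inner M (E A (S f)) h = L2_inner M (S f) (E A h)"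
    by (intro E_sym A h implements_L2[OF S] f)
  also have "\<dots> = I F f (E A h)" using S f h A by (intro implements_inner E_L2)
  also have "\<dots> = I (\<lambda>s. indicator A s * F s) f h"
    using S f h A by (intro I_E_right implements_bounded_borel)
  finally show "L2_inner M (E A (S f)) h = I (\<lambda>s. F s * indicator A s) f h" by (simp add: mult.commute)
qed (use assms in \<open>auto intro!: implements_L2[OF S] functional_I sup_bounded_functional_mult
      intro: implements_bounded_borel\<close>)

lemma implements_compose:
  assumes S: "implements F S" and S': "implements G S'"
  shows "implements (\<lambda>s. G s * F s) (\<lambda>f. S' (S f))"
  unfolding implements_def
proof (intro conjI ballI)
  fix f h assume f: "f \<in> L2 M" and h: "h \<in> L2 M"
  show "S' (S f) \<in> L2 M" by (intro implements_L2[OF S'] implements_L2[OF S] f)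
  have "L2_inner M (S' (S f)) h = I G (S f) h"
    by (intro implements_inner[OF S'] implements_L2[OF S] f h)
  also have "\<dots> = I (\<lambda>s. F s * G s) f h"
    by (intro I_implements_left[OF S implements_bounded_borel[OF S']] f h)
  finally show "L2_inner M (S' (S f)) h = I (\<lambda>s. G s * F s) f h" by (simp add: mult.commute)
qed (use assms in \<open>auto intro!: bounded_borel_mult dest: implements_bounded_borel implements_L2\<close>)

lemma implements_linear:
  assumes S: "implements F S" and f: "f \<in> L2 M" and g: "g \<in> L2 M"
  shows "AE x in M. S (\<lambda>x. f x + a * g x) x = S f x + a * S g x"
proof (rule L2_eq_AE_if_inner_eq)
  fix h assume h: "h \<in> L2 M"
  show "L2_inner M (S (\<lambda>x. f x + a * g x)) h = L2_inner M (\<lambda>x. S f x + a * S g x) h"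
    using S f g h
    by (simp add: implements_inner L2_add L2_scale L2_inner_add_left L2_inner_scale_left implements_L2[OF S]
        I_linear implements_bounded_borel)
qed (auto intro!: implements_L2[OF S] L2_add L2_scale f g)

text \<open>The squared norm is \<open>I F f (S f)\<close>. Conjugation exchanges the two arguments,
  after which multiplicativity in the first one produces |F|^2.\<close>

lemma implements_norm_sq:
  assumes S: "implements F S" and f: "f \<in> L2 M"
  shows "(L2_norm M (S f))\<^sup>2 = (\<integral>s. (cmod (F s))\<^sup>2 \<partial>\<mu> f)"
proof -
  have F: "bounded_borel F" using S by (rule implements_bounded_borel)
  have Sf: "S f \<in> L2 M" using S f by (rule implements_L2)
  have "complex_of_real ((L2_norm M (S f))\<^sup>2) = I F f (S f)"
    unfolding L2_inner_self[symmetric] by (rule implements_inner[OF S f Sf])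
  also have "\<dots> = cnj (I (\<lambda>s. cnj (F s)) (S f) f)" by (rule I_cnj[OF F f Sf])
  also have "I (\<lambda>s. cnj (F s)) (S f) f = I (\<lambda>s. F s * cnj (F s)) f f"
    by (rule I_implements_left[OF S bounded_borel_cnj[OF F] f f])
  also have "\<dots> = (\<integral>s. F s * cnj (F s) \<partial>\<mu> f)"
    by (rule I_self[OF bounded_borel_mult[OF F bounded_borel_cnj[OF F]] f])
  also have "\<dots> = complex_of_real (\<integral>s. (cmod (F s))\<^sup>2 \<partial>\<mu> f)"
    by (simp add: complex_norm_square[symmetric] flip: of_real_power)
  finally show ?thesis unfolding complex_cnj_complex_of_real of_real_eq_iff .
qed

text \<open>The bound on \<open>F\<close> is asked only almost everywhere for the spectral measure
  of \<open>f\<close>; this is what later restricts all estimates to s >= 0.\<close>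

lemma implements_norm_le:
  assumes S: "implements F S" and f: "f \<in> L2 M" and le: "AE s in \<mu> f. cmod (F s) \<le> c" and c: "0 \<le> c"
  shows "L2_norm M (S f) \<le> c * L2_norm M f"
proof -
  interpret finite_measure "\<mu> f" by (rule finite_\<mu>[OF f])
  have F: "bounded_borel F" using S by (rule implements_bounded_borel)
  have "integrable (\<mu> f) (\<lambda>s. norm (F s * cnj (F s)))"
    by (intro integrable_norm bounded_borel_integrable bounded_borel_mult bounded_borel_cnj F finite_\<mu> f) simp
  then have int: "integrable (\<mu> f) (\<lambda>s. (cmod (F s))\<^sup>2)"
    by (simp add: norm_mult power2_eq_square)
  have "(L2_norm M (S f))\<^sup>2 \<le> (\<integral>s. c\<^sup>2 \<partial>\<mu> f)"
    unfolding implements_norm_sq[OF S f]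
  proof (rule integral_mono_AE[OF int])
    show "AE s in \<mu> f. (cmod (F s))\<^sup>2 \<le> c\<^sup>2" using le by eventually_elim (auto intro: power_mono)
  qed simp
  also have "\<dots> = (c * L2_norm M f)\<^sup>2"
    using measure_\<mu>_UNIV[OF f] by (simp add: power_mult_distrib)
  finally show ?thesis by (rule power2_le_imp_le) (simp add: c)
qed

lemma implements_indicator: "A \<in> sets borel \<Longrightarrow> implements (indicator A) (E A)"
  by (auto simp: implements_def bounded_borel_indicator I_indicator E_L2)

lemma implements_add:
  assumes S: "implements F S" and S': "implements G S'"
  shows "implements (\<lambda>s. F s + G s) (\<lambda>f x. S f x + S' f x)"
  using assms functional_add[OF functional_I]
  by (auto simp: implements_def L2_inner_add_left intro: bounded_borel_add L2_add)

lemma implements_scale: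
  assumes S: "implements F S"
  shows "implements (\<lambda>s. a * F s) (\<lambda>f x. a * S f x)"
  using assms functional_scale[OF functional_I]
  by (auto simp: implements_def L2_inner_scale_left intro: bounded_borel_scale L2_scale)

lemma implements_diff:
  "implements F S \<Longrightarrow> implements G S' \<Longrightarrow> implements (\<lambda>s. F s - G s) (\<lambda>f x. S f x - S' f x)"
  using implements_add[of F S "\<lambda>s. (-1) * G s" "\<lambda>f x. (-1) * S' f x"] implements_scale[of G S' "-1"] by simp

lemma implements_zero: "implements (\<lambda>s. 0) (\<lambda>f x. 0)"
  using implements_scale[OF implements_indicator[of UNIV], of 0] by simp

lemma implements_sum:
  "(\<And>i. i \<in> J \<Longrightarrow> implements (F i) (S i)) \<Longrightarrow> implements (\<lambda>s. \<Sum>i\<in>J. F i s) (\<lambda>f x. \<Sum>i\<in>J. S i f x)"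
  by (induction J rule: infinite_finite_induct) (auto intro: implements_add implements_zero)

text \<open>Step functions are realized by finite combinations of projections. Uniform approximation
  at rate 2^(-k) makes their images of \<open>f\<close> a sequence with summable increments, and
  completeness supplies the limit.\<close>

lemma implements_exists:
  assumes F: "bounded_borel F"
  shows "\<exists>S. implements F S"
proof -
  have "\<exists>G S. implements G S \<and> (\<forall>s. cmod (F s - G s) \<le> (1/2) ^ k)" for k
  proof -
    obtain J a A where *: "finite J" "\<And>i. A i \<in> sets borel" "\<And>s. cmod (F s - step_fun J a A s) \<le> (1/2) ^ k"
      using bounded_borel_approx[OF F, of "(1/2) ^ k"] by (metis half_gt_zero_iff zero_less_one zero_less_power)
    have "implements (step_fun J a A) (\<lambda>f x. \<Sum>i\<in>J. a i * E (A i) f x)"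
      unfolding step_fun_def using * by (intro implements_sum implements_scale implements_indicator) auto
    with * show ?thesis by blast
  qed
  then obtain G S where S: "\<And>k. implements (G k) (S k)" and G: "\<And>k s. cmod (F s - G k s) \<le> (1/2) ^ k"
    by metis
  have "\<exists>g\<in>L2 M. (\<lambda>k. L2_norm M (\<lambda>x. S k f x - g x)) \<longlonglongrightarrow> 0" if f: "f \<in> L2 M" for f
  proof (rule L2_complete[where u = "\<lambda>k. S k f"])
    show "S k f \<in> L2 M" for k using S f by (rule implements_L2)
    show "L2_norm M (\<lambda>x. S (Suc k) f x - S k f x) \<le> 2 * (1/2) ^ k * L2_norm M f" for k
    proof (rule implements_norm_le[OF implements_diff[OF S S] f])
      show "AE s in \<mu> f. cmod (G (Suc k) s - G k s) \<le> 2 * (1/2) ^ k"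
      proof (rule AE_I2)
        fix s
        have "cmod ((F s - G k s) - (F s - G (Suc k) s)) \<le> (1/2) ^ k + (1/2) ^ Suc k"
          by (intro norm_triangle_le_diff add_mono G)
        also have "\<dots> \<le> 2 * (1/2) ^ k" by simp
        finally show "cmod (G (Suc k) s - G k s) \<le> 2 * (1/2) ^ k" by simp
      qed
    qed simp
    show "summable (\<lambda>k. 2 * (1/2) ^ k * L2_norm M f)"
      by (intro summable_mult summable_mult2 summable_geometric) simp
  qed
  then obtain T where T: "\<And>f. f \<in> L2 M \<Longrightarrow> T f \<in> L2 M"
    and lim: "\<And>f. f \<in> L2 M \<Longrightarrow> (\<lambda>k. L2_norm M (\<lambda>x. S k f x - T f x)) \<longlonglongrightarrow> 0"
    by metis
  \<comment> \<open>Both sides are limits of \<open>L2_inner M (S k f) h\<close>: one by norm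
    convergence, the other by sup-continuity of the functional.\<close>
  have "L2_inner M (T f) h = I F f h" if f: "f \<in> L2 M" and h: "h \<in> L2 M" for f h
  proof (rule LIMSEQ_unique)
    have Sf: "S k f \<in> L2 M" for k using S f by (rule implements_L2)
    have "(\<lambda>k. L2_inner M (S k f) h - L2_inner M (T f) h) \<longlonglongrightarrow> 0"
    proof (rule Lim_null_comparison)
      show "(\<lambda>k. L2_norm M (\<lambda>x. S k f x - T f x) * L2_norm M h) \<longlonglongrightarrow> 0"
        using tendsto_mult_right[OF lim[OF f]] by simp
      show "\<forall>\<^sub>F k in sequentially. norm (L2_inner M (S k f) h - L2_inner M (T f) h)
          \<le> L2_norm M (\<lambda>x. S k f x - T f x) * L2_norm M h"
        using L2_Cauchy_Schwarz[OF L2_diff[OF Sf T[OF f]] h]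
        by (auto simp: L2_inner_diff_left[OF Sf T[OF f] h])
    qed
    then show "(\<lambda>k. L2_inner M (S k f) h) \<longlonglongrightarrow> L2_inner M (T f) h" by (simp only: LIM_zero_iff)
    obtain K where K: "\<And>F c. bounded_borel F \<Longrightarrow> (\<And>s. cmod (F s) \<le> c) \<Longrightarrow> cmod (I F f h) \<le> K * c"
      using functional_bound[OF functional_I[OF f h]] by blast
    have "(\<lambda>k. I F f h - I (G k) f h) \<longlonglongrightarrow> 0"
    proof (rule Lim_null_comparison)
      show "(\<lambda>k. K * (1/2) ^ k) \<longlonglongrightarrow> 0"
        using tendsto_mult_left[OF LIMSEQ_power_zero[of "1/2::real"], of K] by simp
      have "norm (I F f h - I (G k) f h) \<le> K * (1/2) ^ k" for k
        unfolding functional_diff[OF functional_I[OF f h] F implements_bounded_borel[OF S], symmetric]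
        by (intro K bounded_borel_diff F implements_bounded_borel[OF S] G)
      then show "\<forall>\<^sub>F k in sequentially. norm (I F f h - I (G k) f h) \<le> K * (1/2) ^ k" by simp
    qed
    then have "(\<lambda>k. I F f h - (I F f h - I (G k) f h)) \<longlonglongrightarrow> I F f h - 0"
      by (intro tendsto_diff tendsto_const)
    then show "(\<lambda>k. L2_inner M (S k f) h) \<longlonglongrightarrow> I F f h"
      by (simp add: implements_inner[OF S f h])
  qed
  then have "implements F T" using F T by (simp add: implements_def)
  then show ?thesis by blast
qed

section \<open>Domains, and where the spectral measures live\<close>

lemma spectral_domain_bounded_borel:
  assumes F: "bounded_borel F" shows "spectral_domain M E F = L2 M"
proof -
  have "integrable (\<mu> f) (\<lambda>s. (cmod (F s))\<^sup>2)" if f: "f \<in> L2 M" for f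
  proof -
    interpret finite_measure "\<mu> f" by (rule finite_\<mu>[OF f])
    have "integrable (\<mu> f) (\<lambda>s. norm (F s * cnj (F s)))"
      by (intro integrable_norm bounded_borel_integrable bounded_borel_mult bounded_borel_cnj F finite_\<mu> f) simp
    then show ?thesis by (simp add: norm_mult power2_eq_square)
  qed
  then show ?thesis by (auto simp: spectral_domain_def)
qed

text \<open>For bounded \<open>F\<close> the domain is all of L2, so every representative satisfies
  the predicate under \<open>SOME\<close>, and conversely the chosen value is one.\<close>

lemma implements_op_fun:
  assumes F: "bounded_borel F" shows "implements F (op_fun M E F)"
proof -
  obtain S where S: "implements F S" using implements_exists[OF F] by blast
  have "op_fun M E F f \<in> L2 M \<and> (\<forall>h\<in>L2 M. L2_inner M (op_fun M E F f) h = I F f h)" if f: "f \<in> L2 M" for f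
    unfolding op_fun_def spectral_domain_bounded_borel[OF F]
    by (rule someI[of _ "S f"]) (use S f in \<open>auto simp: implements_def\<close>)
  then show ?thesis using F by (simp add: implements_def)
qed

text \<open>E(-A) E(A) f = E({}) f = 0. The scalar is present because polarizing with both arguments
  equal to E(A) f produces the vectors (1 + i^k) E(A) f.\<close>

lemma E_range:
  assumes f: "f \<in> L2 M" and A: "A \<in> sets borel"
  shows "AE s in \<mu> (\<lambda>x. a * E A f x). s \<in> A"
proof -
  let ?g = "E A f"
  have g: "?g \<in> L2 M" by (intro E_L2 f A)
  have A': "- A \<in> sets borel" using A by auto
  have ag: "(\<lambda>x. a * ?g x) \<in> L2 M" using g by (rule L2_scale)
  have "L2_inner M (E {} f) f = 0"
  proof -
    have "ennreal ((L2_norm M (E {} f))\<^sup>2) = 0"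
      using emeasure_\<mu>_norm[OF f, of "{}"] by simp
    then have "L2_norm M (E {} f) = 0" by (simp add: ennreal_eq_0_iff)
    then show ?thesis by (simp add: E_inner_self f)
  qed
  then have E0: "L2_norm M (E {} f) = 0" using E_inner_self[of "{}" f] f by simp
  have "L2_norm M (E (- A) ?g) = L2_norm M (E {} f)"
    by (intro L2_norm_cong_AE E_L2 g f A') (use E_mult[OF A' A f] in auto)
  then have "L2_norm M (E (- A) ?g) = 0" using E0 by simp
  moreover have "L2_norm M (E (- A) (\<lambda>x. a * ?g x)) = cmod a * L2_norm M (E (- A) ?g)"
  proof -
    have "AE x in M. E (-A) (\<lambda>x. 0 + a * ?g x) x = E (-A) (\<lambda>x. 0) x + a * E (-A) ?g x"
      by (intro implements_linear[OF implements_indicator[OF A']] g) simp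
    moreover have "AE x in M. E (-A) (\<lambda>x. 0 + 1 * 0) x = E (-A) (\<lambda>x. 0) x + 1 * E (-A) (\<lambda>x. 0) x"
      by (intro implements_linear[OF implements_indicator[OF A']]) auto
    ultimately have "AE x in M. E (-A) (\<lambda>x. a * ?g x) x = a * E (-A) ?g x"
      by eventually_elim simp
    then have "L2_norm M (E (- A) (\<lambda>x. a * ?g x)) = L2_norm M (\<lambda>x. a * E (-A) ?g x)"
      by (intro L2_norm_cong_AE E_L2 L2_scale g A') auto
    then show ?thesis by (simp add: L2_norm_scale)
  qed
  ultimately have "emeasure (\<mu> (\<lambda>x. a * ?g x)) (- A) = 0"
    by (simp add: emeasure_\<mu>_norm[OF ag A'])
  then show ?thesis
    using A' by (intro AE_I[of _ _ "- A"]) auto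
qed

lemma E_range': "f \<in> L2 M \<Longrightarrow> A \<in> sets borel \<Longrightarrow> AE s in \<mu> (E A f). s \<in> A"
  using E_range[of f A 1] by (simp only: mult_1)

text \<open>The spectral measure of \<open>E A f\<close> lives on \<open>A\<close>, so a bound for
  \<open>F\<close> there suffices even if \<open>F\<close> is unbounded elsewhere.\<close>

lemma E_in_spectral_domain:
  assumes f: "f \<in> L2 M" and A: "A \<in> sets borel" and [measurable]: "F \<in> borel_measurable borel"
    and c: "\<And>s. s \<in> A \<Longrightarrow> cmod (F s) \<le> c"
  shows "E A f \<in> spectral_domain M E F"
proof -
  have g: "E A f \<in> L2 M" by (intro E_L2 f A)
  interpret finite_measure "\<mu> (E A f)" by (rule finite_\<mu>[OF g])
  have "integrable (\<mu> (E A f)) (\<lambda>s. (cmod (F s))\<^sup>2)"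
  proof (rule integrable_const_bound[where B = "c\<^sup>2"])
    show "AE s in \<mu> (E A f). norm ((cmod (F s))\<^sup>2) \<le> c\<^sup>2"
      using E_range'[OF f A] by eventually_elim (auto intro: power_mono c)
  qed measurable
  with g show ?thesis by (simp add: spectral_domain_def)
qed

text \<open>Let g = E(A) f for a compact part A of the negative half-line. Then <Lg, g> is the
  integral of s over A, at most a negative multiple of the squared norm of g, and non-negativity
  forces g = 0.\<close>

lemma negative_part_null:
  assumes res: "spectral_resolution M E D L" and nonneg: "nonneg_operator M D L" and f: "f \<in> L2 M"
  shows "emeasure (\<mu> f) {..<0} = 0"
proof -
  \<comment> \<open>The upper end keeps s away from 0, which gives the strictly negative multiple;
    the lower end keeps s bounded, which puts \<open>E (A k) f\<close> into the domain of the
    operator.\<close>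
  define A where "A k = {- real k - 1 .. - (1 / (real k + 1))}" for k
  have A: "A k \<in> sets borel" for k by (simp add: A_def)
  have Ab: "\<bar>s\<bar> \<le> real k + 1" if "s \<in> A k" for s k
  proof -
    have "0 \<le> 1 / (real k + 1)" by simp
    moreover have "- real k - 1 \<le> s" "s \<le> - (1 / (real k + 1))" using that by (auto simp: A_def)
    ultimately show ?thesis by linarith
  qed
  have "emeasure (\<mu> f) (A k) = 0" for k
  proof -
    let ?g = "E (A k) f"
    have g: "?g \<in> L2 M" by (intro E_L2 f A)
    have D: "D = spectral_domain M E complex_of_real" using res by (simp add: spectral_resolution_def)
    have gD: "?g \<in> D" unfolding D
      by (rule E_in_spectral_domain[OF f A, where c = "real k + 1"])
         (auto dest: Ab)
    have "L2_inner M (L ?g) ?g = I complex_of_real ?g ?g"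
      using res gD by (simp add: spectral_resolution_def)
    \<comment> \<open>All four polarized measures live on \<open>A k\<close>, so the identity
      function may be cut off there and the bounded calculus applies.\<close>
    also have "\<dots> = I (\<lambda>s. indicator (A k) s * complex_of_real s) ?g ?g"
      unfolding spectral_integral_def
    proof (intro arg_cong2[where f = "(/)"] sum.cong refl arg_cong2[where f = "(*)"] integral_cong_AE)
      fix i
      have "AE s in \<mu> (\<lambda>x. ?g x + \<i> ^ i * ?g x). s \<in> A k"
        using E_range[OF f A[of k], where a = "1 + \<i> ^ i"] by (simp only: distrib_right mult_1)
      then show "AE s in \<mu> (\<lambda>x. ?g x + \<i> ^ i * ?g x). complex_of_real s = indicator (A k) s * complex_of_real s"
        by eventually_elim simp
    qed (use A in measurable)
    also have "\<dots> = (\<integral>s. indicator (A k) s * complex_of_real s \<partial>\<mu> ?g)"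
    proof (rule I_self[OF bounded_borelI[where c = "real k + 1"] g])
      show "(\<lambda>s. indicator (A k) s * complex_of_real s) \<in> borel_measurable borel" using A by measurable
      show "cmod (indicator (A k) s * complex_of_real s) \<le> real k + 1" for s
        by (auto simp: indicator_def dest: Ab)
    qed
    also have "\<dots> = complex_of_real (\<integral>s. indicator (A k) s * s \<partial>\<mu> ?g)"
      by (subst integral_complex_of_real[symmetric]) (auto intro!: Bochner_Integration.integral_cong simp: indicator_def)
    finally have eq: "L2_inner M (L ?g) ?g = complex_of_real (\<integral>s. indicator (A k) s * s \<partial>\<mu> ?g)" .
    interpret finite_measure "\<mu> ?g" by (rule finite_\<mu>[OF g])
    have "L2_inner M (L ?g) ?g \<in> \<real>\<^sub>\<ge>\<^sub>0" using nonneg gD by (simp add: nonneg_operator_def)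
    then have "0 \<le> (\<integral>s. indicator (A k) s * s \<partial>\<mu> ?g)" unfolding eq by (simp add: complex_nonneg_Reals_iff)
    also have "\<dots> \<le> (\<integral>s. - (1 / (real k + 1)) \<partial>\<mu> ?g)"
    proof (rule integral_mono_AE)
      show "integrable (\<mu> ?g) (\<lambda>s. indicator (A k) s * s)"
        using A by (intro integrable_const_bound[where B = "real k + 1"])
          (auto simp: indicator_def dest: Ab)
      show "AE s in \<mu> ?g. indicator (A k) s * s \<le> - (1 / (real k + 1))"
        using E_range'[OF f A] by eventually_elim (auto simp: A_def)
    qed simp
    also have "\<dots> = - (1 / (real k + 1)) * (L2_norm M ?g)\<^sup>2"
      using measure_\<mu>_UNIV[OF g] by simp
    finally have "(L2_norm M ?g)\<^sup>2 \<le> 0" by (simp add: field_simps)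
    then show ?thesis by (simp add: emeasure_\<mu>_norm[OF f A])
  qed
  then have "emeasure (\<mu> f) (\<Union>k. A k) = 0"
    by (intro emeasure_UN_eq_0) (use A in auto)
  moreover have "{..<0} \<subseteq> (\<Union>k. A k)"
  proof
    fix s :: real assume "s \<in> {..<0}"
    then have s: "s < 0" by simp
    obtain k where k: "max (- s) (1 / (- s)) < real k" using reals_Archimedean2 by blast
    have "1 / (- s) < real k + 1" using k by simp
    then have "1 / (real k + 1) < - s" using s by (simp add: field_simps)
    then have "s \<in> A k" using k by (auto simp: A_def)
    then show "s \<in> (\<Union>k. A k)" by blast
  qed
  ultimately show ?thesis
    using emeasure_mono[of "{..<0}" "\<Union>k. A k" "\<mu> f"] A by (auto simp: le_zero_eq)
qed

text \<open>Here \<open>F\<close> may be unbounded, so the domain of $F(L)$ need not be all of $L^2$.\<close>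

lemma op_fun_zero:
  assumes [measurable]: "F \<in> borel_measurable borel" and f: "f \<in> L2 M" and f0: "AE x in M. f x = 0"
  shows "op_fun M E F f \<in> L2 M" "AE x in M. op_fun M E F f x = 0"
proof -
  \<comment> \<open>For null \<open>f\<close> the four polarized measures all equal that of
    \<open>h\<close>, and the powers of i sum to zero.\<close>
  have I0: "I F f h = 0" if h: "h \<in> L2 M" for h
  proof -
    have "\<mu> (\<lambda>x. f x + \<i> ^ k * h x) = \<mu> (\<lambda>x. \<i> ^ k * h x)" for k
      using f0 by (intro \<mu>_cong_AE L2_add L2_scale f h) auto
    also have "\<dots> k = \<mu> h" for k by (intro \<mu>_scale_unit h) (simp add: norm_power)
    finally show ?thesis unfolding spectral_integral_def by (simp add: numeral_eq_Suc)
  qed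
  let ?g = "op_fun M E F f"
  have *: "?g \<in> L2 M \<and> (\<forall>h\<in>spectral_domain M E F. L2_inner M ?g h = I F f h)"
    unfolding op_fun_def
    by (rule someI[of _ "\<lambda>x. 0"]) (auto simp: spectral_domain_def I0 L2_inner_def)
  then show g: "?g \<in> L2 M" by simp
  have 0: "L2_inner M ?g h = 0" if "h \<in> spectral_domain M E F" for h
    using that * I0 by (auto simp: spectral_domain_def)
  \<comment> \<open>On these sets \<open>F\<close> is bounded, so the truncations of any vector to
    them lie in the domain. Testing the chosen value against its own truncations shows that each of
    them is null.\<close>
  define A where "A k = {s. cmod (F s) \<le> real k}" for k
  have "A k = {s\<in>space borel. cmod (F s) \<le> real k}" for k by (simp add: A_def)
  also have "\<dots> k \<in> sets borel" for k by measurable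
  finally have A: "A k \<in> sets borel" for k .
  have "emeasure (\<mu> ?g) (A k) = 0" for k
  proof -
    have "L2_inner M ?g (E (A k) ?g) = 0"
      by (intro 0 E_in_spectral_domain[OF g A, where c = "real k"]) (auto simp: A_def)
    then show ?thesis by (simp add: emeasure_\<mu>[OF g A] E_sym A g)
  qed
  then have "emeasure (\<mu> ?g) (\<Union>k. A k) = 0"
    by (intro emeasure_UN_eq_0) (use A in auto)
  moreover have "(\<Union>k. A k) = UNIV" using real_arch_simple by (auto simp: A_def)
  ultimately have "measure (\<mu> ?g) UNIV = 0" by (simp add: measure_def)
  then show "AE x in M. ?g x = 0" using measure_\<mu>_UNIV[OF g] L2_norm_eq_0_iff[OF g] by simp
qed

end

section \<open>Calculus on the non-negative half-line\<close>

locale nonneg_spectral_measure = spectral_measure +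
  assumes null: "f \<in> L2 M \<Longrightarrow> emeasure (scalar_spectral_measure M E f) {..<0} = 0"
begin

lemma AE_\<mu>_nonneg: "f \<in> L2 M \<Longrightarrow> AE s in \<mu> f. 0 \<le> s"
  using null[of f] by (intro AE_I[of _ _ "{..<0}"]) auto

text \<open>The predicates under \<open>SOME\<close> coincide, so the equality is literal and not
  merely almost everywhere. It will exchange the unbounded symbol exp(-ts) for a bounded
  one.\<close>

lemma op_fun_cong:
  assumes [measurable]: "F \<in> borel_measurable borel" "G \<in> borel_measurable borel"
    and eq: "\<And>s. 0 \<le> s \<Longrightarrow> F s = G s" and f: "f \<in> L2 M"
  shows "op_fun M E F f = op_fun M E G f"
proof -
  have "integrable (\<mu> f) (\<lambda>s. (cmod (F s))\<^sup>2) = integrable (\<mu> f) (\<lambda>s. (cmod (G s))\<^sup>2)"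
    if f: "f \<in> L2 M" for f
    by (rule integrable_cong_AE, measurable) (use AE_\<mu>_nonneg[OF f] in eventually_elim, simp add: eq)
  then have dom: "spectral_domain M E F = spectral_domain M E G"
    by (auto simp: spectral_domain_def)
  have "I F f h = I G f h" if h: "h \<in> L2 M" for h
    unfolding spectral_integral_def
  proof (intro arg_cong2[where f = "(/)"] sum.cong refl arg_cong2[where f = "(*)"] integral_cong_AE)
    fix i
    have "AE s in \<mu> (\<lambda>x. f x + \<i> ^ i * h x). 0 \<le> s"
      by (intro AE_\<mu>_nonneg L2_add L2_scale f h)
    then show "AE s in \<mu> (\<lambda>x. f x + \<i> ^ i * h x). F s = G s" by eventually_elim (simp add: eq)
  qed measurable
  then show ?thesis
    unfolding op_fun_def dom
    by (intro arg_cong[where f = Eps] ext conj_cong refl ball_cong) (auto simp: spectral_domain_def)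
qed

lemma implements_norm_le_nonneg:
  assumes "implements F S" "f \<in> L2 M" "\<And>s. 0 \<le> s \<Longrightarrow> cmod (F s) \<le> c" "0 \<le> c"
  shows "L2_norm M (S f) \<le> c * L2_norm M f"
  by (rule implements_norm_le[OF assms(1,2) _ assms(4)])
     (use AE_\<mu>_nonneg[OF assms(2)] in eventually_elim, simp add: assms)

text \<open>The difference of the two operators represents a function that vanishes on s >= 0, hence
  has norm 0.\<close>

lemma implements_unique:
  assumes S: "implements F S" and S': "implements G S'" and eq: "\<And>s. 0 \<le> s \<Longrightarrow> F s = G s" and f: "f \<in> L2 M"
  shows "AE x in M. S f x = S' f x"
proof -
  have "L2_norm M (\<lambda>x. S f x - S' f x) \<le> 0 * L2_norm M f"
    by (rule implements_norm_le_nonneg[OF implements_diff[OF S S'] f]) (auto simp: eq)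
  then have "L2_norm M (\<lambda>x. S f x - S' f x) = 0"
    using L2_norm_nonneg[of M "\<lambda>x. S f x - S' f x"] by linarith
  then show ?thesis
    using L2_norm_eq_0_iff[OF L2_diff[OF implements_L2[OF S f] implements_L2[OF S' f]]] by simp
qed

end

section \<open>Bounded operators and iterated commutators\<close>

text \<open>Maps act on representatives, hence linearity only almost everywhere. Together with the
  norm bound it implies compatibility with equality almost everywhere, see
  \<open>bounded_op_cong_AE\<close>.\<close>

definition bounded_op :: "'a measure \<Rightarrow> real \<Rightarrow> (('a \<Rightarrow> complex) \<Rightarrow> ('a \<Rightarrow> complex)) \<Rightarrow> bool" where
  "bounded_op M c S \<longleftrightarrow> 0 \<le> c \<and>
     (\<forall>f\<in>L2 M. S f \<in> L2 M \<and> L2_norm M (S f) \<le> c * L2_norm M f) \<and>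
     (\<forall>f\<in>L2 M. \<forall>g\<in>L2 M. \<forall>a. AE x in M. S (\<lambda>x. f x + a * g x) x = S f x + a * S g x)"

lemma bounded_op_nonneg: "bounded_op M c S \<Longrightarrow> 0 \<le> c"
  by (simp add: bounded_op_def)

lemma bounded_op_L2: "bounded_op M c S \<Longrightarrow> f \<in> L2 M \<Longrightarrow> S f \<in> L2 M"
  by (simp add: bounded_op_def)

lemma bounded_op_norm: "bounded_op M c S \<Longrightarrow> f \<in> L2 M \<Longrightarrow> L2_norm M (S f) \<le> c * L2_norm M f"
  by (simp add: bounded_op_def)

lemma bounded_op_linear:
  "bounded_op M c S \<Longrightarrow> f \<in> L2 M \<Longrightarrow> g \<in> L2 M \<Longrightarrow> AE x in M. S (\<lambda>x. f x + a * g x) x = S f x + a * S g x"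
  by (simp add: bounded_op_def)

lemma bounded_op_add:
  "bounded_op M c S \<Longrightarrow> f \<in> L2 M \<Longrightarrow> g \<in> L2 M \<Longrightarrow> AE x in M. S (\<lambda>x. f x + g x) x = S f x + S g x"
  using bounded_op_linear[of M c S f g 1] by simp

lemma bounded_op_diff:
  "bounded_op M c S \<Longrightarrow> f \<in> L2 M \<Longrightarrow> g \<in> L2 M \<Longrightarrow> AE x in M. S (\<lambda>x. f x - g x) x = S f x - S g x"
  using bounded_op_linear[of M c S f g "-1"] by simp

lemma bounded_op_0:
  assumes "bounded_op M c S" shows "AE x in M. S (\<lambda>x. 0) x = 0"
  using bounded_op_diff[OF assms, of "\<lambda>x. 0" "\<lambda>x. 0"] by simp

lemma bounded_op_scale:
  assumes S: "bounded_op M c S" and f: "f \<in> L2 M"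
  shows "AE x in M. S (\<lambda>x. a * f x) x = a * S f x"
  using bounded_op_linear[OF S L2_zero f, of a] bounded_op_0[OF S] by eventually_elim simp

lemma bounded_op_sum:
  assumes S: "bounded_op M c S" and f: "\<And>i. i \<in> I \<Longrightarrow> f i \<in> L2 M" and I: "finite I"
  shows "AE x in M. S (\<lambda>x. \<Sum>i\<in>I. f i x) x = (\<Sum>i\<in>I. S (f i) x)"
  using I f
proof (induction I)
  case (insert i I)
  have "AE x in M. S (\<lambda>x. f i x + (\<Sum>i\<in>I. f i x)) x = S (f i) x + S (\<lambda>x. \<Sum>i\<in>I. f i x) x"
    using insert by (intro bounded_op_add[OF S] L2_sum) auto
  moreover have "AE x in M. S (\<lambda>x. \<Sum>i\<in>I. f i x) x = (\<Sum>i\<in>I. S (f i) x)"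
    using insert by auto
  ultimately have "AE x in M. S (\<lambda>x. f i x + (\<Sum>i\<in>I. f i x)) x = S (f i) x + (\<Sum>i\<in>I. S (f i) x)"
    by eventually_elim simp
  with insert.hyps show ?case by simp
qed (use bounded_op_0[OF S] in simp)

lemma bounded_op_cong_AE:
  assumes S: "bounded_op M c S" and f: "f \<in> L2 M" and g: "g \<in> L2 M" and eq: "AE x in M. f x = g x"
  shows "AE x in M. S f x = S g x"
proof -
  have d: "(\<lambda>x. f x - g x) \<in> L2 M" using f g by (rule L2_diff)
  have "L2_norm M (\<lambda>x. f x - g x) = 0" using eq L2_norm_eq_0_iff[OF d] by auto
  then have "L2_norm M (S (\<lambda>x. f x - g x)) = 0"
    using bounded_op_norm[OF S d] L2_norm_nonneg[of M "S (\<lambda>x. f x - g x)"] by auto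
  then have "AE x in M. S (\<lambda>x. f x - g x) x = 0"
    using L2_norm_eq_0_iff[OF bounded_op_L2[OF S d]] by simp
  with bounded_op_diff[OF S f g] show ?thesis by eventually_elim simp
qed

lemma bounded_op_transfer:
  assumes S: "bounded_op M c S" and S': "\<And>f. f \<in> L2 M \<Longrightarrow> S' f \<in> L2 M"
    and eq: "\<And>f. f \<in> L2 M \<Longrightarrow> AE x in M. S' f x = S f x"
  shows "bounded_op M c S'"
  unfolding bounded_op_def
proof (intro conjI ballI allI)
  show "0 \<le> c" using S by (rule bounded_op_nonneg)
  fix f assume f: "f \<in> L2 M"
  show "S' f \<in> L2 M" using f by (rule S')
  have "L2_norm M (S' f) = L2_norm M (S f)"
    by (intro L2_norm_cong_AE S' f bounded_op_L2[OF S] eq)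
  then show "L2_norm M (S' f) \<le> c * L2_norm M f" using bounded_op_norm[OF S f] by simp
  fix g a assume g: "g \<in> L2 M"
  have fg: "(\<lambda>x. f x + a * g x) \<in> L2 M" by (intro L2_add L2_scale f g)
  show "AE x in M. S' (\<lambda>x. f x + a * g x) x = S' f x + a * S' g x"
    using eq[OF f] eq[OF g] eq[OF fg] bounded_op_linear[OF S f g, of a] by eventually_elim simp
qed

lemma bounded_op_mono: "bounded_op M c S \<Longrightarrow> c \<le> c' \<Longrightarrow> bounded_op M c' S"
  unfolding bounded_op_def by (meson L2_norm_nonneg mult_right_mono order_trans)

lemma bounded_op_plus:
  assumes S: "bounded_op M c S" and T: "bounded_op M c' T"
  shows "bounded_op M (c + c') (\<lambda>f x. S f x + T f x)"
  unfolding bounded_op_def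
proof (intro conjI ballI allI)
  show "0 \<le> c + c'" using bounded_op_nonneg[OF S] bounded_op_nonneg[OF T] by simp
  fix f assume f: "f \<in> L2 M"
  show "(\<lambda>x. S f x + T f x) \<in> L2 M" by (intro L2_add bounded_op_L2[OF S] bounded_op_L2[OF T] f)
  have "L2_norm M (\<lambda>x. S f x + T f x) \<le> L2_norm M (S f) + L2_norm M (T f)"
    by (intro L2_triangle bounded_op_L2[OF S] bounded_op_L2[OF T] f)
  then show "L2_norm M (\<lambda>x. S f x + T f x) \<le> (c + c') * L2_norm M f"
    using bounded_op_norm[OF S f] bounded_op_norm[OF T f] by (simp add: distrib_right)
  fix g a assume g: "g \<in> L2 M"
  show "AE x in M. S (\<lambda>x. f x + a * g x) x + T (\<lambda>x. f x + a * g x) x = (S f x + T f x) + a * (S g x + T g x)"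
    using bounded_op_linear[OF S f g, of a] bounded_op_linear[OF T f g, of a]
    by eventually_elim (simp add: algebra_simps)
qed

lemma bounded_op_times:
  assumes S: "bounded_op M c S"
  shows "bounded_op M (cmod b * c) (\<lambda>f x. b * S f x)"
  unfolding bounded_op_def
proof (intro conjI ballI allI)
  show "0 \<le> cmod b * c" using bounded_op_nonneg[OF S] by simp
  fix f assume f: "f \<in> L2 M"
  show "(\<lambda>x. b * S f x) \<in> L2 M" by (intro L2_scale bounded_op_L2[OF S] f)
  show "L2_norm M (\<lambda>x. b * S f x) \<le> cmod b * c * L2_norm M f"
    using bounded_op_norm[OF S f] by (simp add: L2_norm_scale mult.assoc mult_left_mono)
  fix g a assume g: "g \<in> L2 M"
  show "AE x in M. b * S (\<lambda>x. f x + a * g x) x = b * S f x + a * (b * S g x)"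
    using bounded_op_linear[OF S f g, of a] by eventually_elim (simp add: algebra_simps)
qed

lemma bounded_op_compose:
  assumes S: "bounded_op M c S" and T: "bounded_op M c' T"
  shows "bounded_op M (c * c') (\<lambda>f. S (T f))"
  unfolding bounded_op_def
proof (intro conjI ballI allI)
  show "0 \<le> c * c'" using bounded_op_nonneg[OF S] bounded_op_nonneg[OF T] by simp
  fix f assume f: "f \<in> L2 M"
  have Tf: "T f \<in> L2 M" by (intro bounded_op_L2[OF T] f)
  show "S (T f) \<in> L2 M" by (intro bounded_op_L2[OF S] Tf)
  have "L2_norm M (S (T f)) \<le> c * L2_norm M (T f)" by (intro bounded_op_norm[OF S] Tf)
  also have "\<dots> \<le> c * (c' * L2_norm M f)"
    by (intro mult_left_mono bounded_op_norm[OF T] f bounded_op_nonneg[OF S])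
  finally show "L2_norm M (S (T f)) \<le> c * c' * L2_norm M f" by (simp add: mult.assoc)
  fix g a assume g: "g \<in> L2 M"
  have Tg: "T g \<in> L2 M" by (intro bounded_op_L2[OF T] g)
  have "AE x in M. S (T (\<lambda>x. f x + a * g x)) x = S (\<lambda>x. T f x + a * T g x) x"
    by (intro bounded_op_cong_AE[OF S] bounded_op_linear[OF T] bounded_op_L2[OF T] L2_add L2_scale f g)
  with bounded_op_linear[OF S Tf Tg, of a]
  show "AE x in M. S (T (\<lambda>x. f x + a * g x)) x = S (T f) x + a * S (T g) x"
    by eventually_elim simp
qed

lemma bounded_op_id: "bounded_op M 1 (\<lambda>f. f)"
  by (simp add: bounded_op_def)

lemma bounded_op_null: "bounded_op M 0 (\<lambda>f x. 0)"
  by (simp add: bounded_op_def)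

lemma bounded_op_multiplier:
  assumes "m \<in> borel_measurable M" "\<And>x. cmod (m x) \<le> c"
  shows "bounded_op M c (\<lambda>f x. m x * f x)"
proof -
  have "0 \<le> c" using assms(2) norm_ge_zero order_trans by blast
  with assms show ?thesis
    unfolding bounded_op_def
    by (intro conjI ballI allI L2_bounded_mult[where c = c] L2_norm_bounded_mult) (auto simp: algebra_simps)
qed

definition commutator where
  "commutator d S = (\<lambda>f x. complex_of_real (d x) * S f x - S (\<lambda>x. complex_of_real (d x) * f x) x)"

text \<open>The \<open>i\<close>-fold commutator with \<open>d\<close> has norm at most $c\,C^i$ for all $i\le k$. In this form
  \<open>c\<close> is multiplicative and \<open>C\<close> additive under products.\<close>

primrec commutator_bound where
  "commutator_bound M d 0 c C S = bounded_op M c S"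
| "commutator_bound M d (Suc k) c C S =
     (bounded_op M c S \<and> commutator_bound M d k (c * C) C (commutator d S))"

lemma commutator_bound_imp_bounded_op: "commutator_bound M d k c C S \<Longrightarrow> bounded_op M c S"
  by (cases k) auto

lemma commutator_bound_SucD: "commutator_bound M d (Suc k) c C S \<Longrightarrow> commutator_bound M d k c C S"
  by (induction k arbitrary: c S) auto

text \<open>\<open>R\<close> serves to make commutators bounded and norm continuous. Constants that
  survive to the end do not contain it, so a distance can be truncated at any height.\<close>

locale bounded_weight =
  fixes M :: "'a measure" and d :: "'a \<Rightarrow> real" and R :: real
  assumes d_measurable [measurable]: "d \<in> borel_measurable M" and d_le: "\<And>x. \<bar>d x\<bar> \<le> R"
begin

lemma R_nonneg: "0 \<le> R"
  using d_le[of undefined] by linarith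

lemma bounded_op_d: "bounded_op M R (\<lambda>f x. complex_of_real (d x) * f x)"
  by (rule bounded_op_multiplier) (use d_le in auto)

lemmas L2_d = bounded_op_L2[OF bounded_op_d]

lemma bounded_op_commutator:
  assumes S: "bounded_op M c S"
  shows "bounded_op M (2 * R * c) (commutator d S)"
proof -
  have "bounded_op M (R * c + cmod (-1) * (c * R)) (\<lambda>f x. complex_of_real (d x) * S f x
      + (-1) * S (\<lambda>x. complex_of_real (d x) * f x) x)"
    by (intro bounded_op_plus bounded_op_times bounded_op_compose[OF bounded_op_d S]
        bounded_op_compose[OF S bounded_op_d])
  then show ?thesis by (simp add: commutator_def algebra_simps)
qed

lemma commutator_bound_mono:
  "commutator_bound M d k c C S \<Longrightarrow> c \<le> c' \<Longrightarrow> 0 \<le> C \<Longrightarrow> C \<le> C' \<Longrightarrow> commutator_bound M d k c' C' S"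
proof (induction k arbitrary: c c' S)
  case (Suc k)
  then have "0 \<le> c" by (auto dest: bounded_op_nonneg)
  with Suc have "c * C \<le> c' * C'" by (intro mult_mono) auto
  with Suc show ?case by (auto intro: bounded_op_mono)
qed (auto intro: bounded_op_mono)

lemma commutator_bound_transfer:
  "commutator_bound M d k c C S \<Longrightarrow> (\<And>f. f \<in> L2 M \<Longrightarrow> S' f \<in> L2 M) \<Longrightarrow>
    (\<And>f. f \<in> L2 M \<Longrightarrow> AE x in M. S' f x = S f x) \<Longrightarrow> commutator_bound M d k c C S'"
proof (induction k arbitrary: c S S')
  case (Suc k)
  have "commutator_bound M d k (c * C) C (commutator d S')"
  proof (rule Suc.IH)
    show "commutator_bound M d k (c * C) C (commutator d S)" using Suc.prems by simp
    fix f assume f: "f \<in> L2 M"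
    then show "commutator d S' f \<in> L2 M"
      unfolding commutator_def by (intro L2_diff L2_d Suc.prems)
    show "AE x in M. commutator d S' f x = commutator d S f x"
      using Suc.prems(3)[OF f] Suc.prems(3)[OF L2_d[OF f]]
      unfolding commutator_def by eventually_elim simp
  qed
  with Suc.prems show ?case by (auto intro: bounded_op_transfer)
qed (auto intro: bounded_op_transfer)

lemma commutator_bound_plus:
  "commutator_bound M d k c C S \<Longrightarrow> commutator_bound M d k c' C T \<Longrightarrow>
    commutator_bound M d k (c + c') C (\<lambda>f x. S f x + T f x)"
proof (induction k arbitrary: c c' S T)
  case (Suc k)
  have "commutator d (\<lambda>f x. S f x + T f x) = (\<lambda>f x. commutator d S f x + commutator d T f x)"
    by (auto simp: commutator_def algebra_simps)
  with Suc show ?case by (auto intro: bounded_op_plus simp: distrib_right)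
qed (auto intro: bounded_op_plus)

lemma commutator_bound_times:
  "commutator_bound M d k c C S \<Longrightarrow> commutator_bound M d k (cmod a * c) C (\<lambda>f x. a * S f x)"
proof (induction k arbitrary: c S)
  case (Suc k)
  have "commutator d (\<lambda>f x. a * S f x) = (\<lambda>f x. a * commutator d S f x)"
    by (auto simp: commutator_def algebra_simps)
  with Suc show ?case by (auto intro: bounded_op_times simp: mult.assoc)
qed (auto intro: bounded_op_times)

lemma commutator_bound_null: "commutator_bound M d k 0 C (\<lambda>f x. 0)"
  by (induction k) (auto simp: bounded_op_null commutator_def)

lemma commutator_bound_id: "0 \<le> C \<Longrightarrow> commutator_bound M d k 1 C (\<lambda>f. f)"
  using commutator_bound_mono[OF commutator_bound_null, where c' = C]
  by (cases k) (auto simp: bounded_op_id commutator_def)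

lemma commutator_bound_sum:
  "(\<And>i. i \<in> I \<Longrightarrow> commutator_bound M d k (c i) C (S i)) \<Longrightarrow>
    commutator_bound M d k (\<Sum>i\<in>I. c i) C (\<lambda>f x. \<Sum>i\<in>I. S i f x)"
  by (induction I rule: infinite_finite_induct)
     (auto intro: commutator_bound_null commutator_bound_plus)

text \<open>The commutator with \<open>d\<close> is a derivation.\<close>

lemma commutator_bound_compose:
  "commutator_bound M d k c C S \<Longrightarrow> commutator_bound M d k c' C' T \<Longrightarrow> 0 \<le> C \<Longrightarrow> 0 \<le> C' \<Longrightarrow>
    commutator_bound M d k (c * c') (C + C') (\<lambda>f. S (T f))"
proof (induction k arbitrary: c c' S T)
  case (Suc k)
  let ?d = "\<lambda>f x. complex_of_real (d x) * f x"
  have S: "bounded_op M c S" and T: "bounded_op M c' T"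
    and S': "commutator_bound M d k (c * C) C (commutator d S)"
    and T': "commutator_bound M d k (c' * C') C' (commutator d T)"
    using Suc.prems by auto
  have S0: "commutator_bound M d k c C S" and T0: "commutator_bound M d k c' C' T"
    using Suc.prems commutator_bound_SucD by blast+
  \<comment> \<open>The two constants add up to \<open>c * c' * (C + C')\<close>, exactly the form
    that the definition prescribes for the first commutator of an operator with constants
    \<open>c * c'\<close> and \<open>C + C'\<close>.\<close>
  have "commutator_bound M d k (c * C * c' + c * (c' * C')) (C + C')
      (\<lambda>f x. commutator d S (T f) x + S (commutator d T f) x)"
    by (intro commutator_bound_plus Suc.IH S' T0 S0 T' Suc.prems)
  then have "commutator_bound M d k (c * c' * (C + C')) (C + C')
      (\<lambda>f x. commutator d S (T f) x + S (commutator d T f) x)"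
    by (simp add: algebra_simps)
  then have "commutator_bound M d k (c * c' * (C + C')) (C + C') (commutator d (\<lambda>f. S (T f)))"
  proof (rule commutator_bound_transfer)
    fix f assume f: "f \<in> L2 M"
    have Tf: "T f \<in> L2 M" and Tdf: "T (?d f) \<in> L2 M" by (intro bounded_op_L2[OF T] f L2_d)+
    show "commutator d (\<lambda>f. S (T f)) f \<in> L2 M"
      unfolding commutator_def by (intro L2_diff L2_d bounded_op_L2[OF S] Tf Tdf)
    show "AE x in M. commutator d (\<lambda>f. S (T f)) f x = commutator d S (T f) x + S (commutator d T f) x"
      using bounded_op_diff[OF S L2_d[OF Tf] Tdf]
      unfolding commutator_def by eventually_elim simp
  qed
  with bounded_op_compose[OF S T] show ?case by simp
qed (auto intro: bounded_op_compose)

text \<open>For a contraction only \<open>C\<close> changes, and only linearly in the exponent. This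
  is the source of polynomial growth both in the frequency and in time.\<close>

lemma commutator_bound_funpow:
  assumes "commutator_bound M d k c C S" "0 \<le> C"
  shows "commutator_bound M d k (c ^ N) (real N * C) (\<lambda>f. (S ^^ N) f)"
proof (induction N)
  case (Suc N)
  have "commutator_bound M d k (c * c ^ N) (C + real N * C) (\<lambda>f. S ((S ^^ N) f))"
    using assms Suc by (intro commutator_bound_compose) auto
  then show ?case by (simp add: distrib_right)
qed (simp add: commutator_bound_id)

lemma bounded_op_limit:
  assumes S: "bounded_op M c0 S"
    and lim: "\<And>e. 0 < e \<Longrightarrow> \<exists>T. bounded_op M c T \<and> bounded_op M e (\<lambda>f x. S f x - T f x)"
  shows "bounded_op M c S"
proof -
  obtain T1 where "bounded_op M c T1" using lim[of 1] by auto
  then have c: "0 \<le> c" by (rule bounded_op_nonneg)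
  have "L2_norm M (S f) \<le> c * L2_norm M f" if f: "f \<in> L2 M" for f
  proof (rule field_le_epsilon)
    fix e :: real assume e: "0 < e"
    define e' where "e' = e / (L2_norm M f + 1)"
    have pos: "0 < L2_norm M f + 1" using L2_norm_nonneg[of M f] by linarith
    then have e': "0 < e'" using e by (simp add: e'_def)
    obtain T where T: "bounded_op M c T" and ST: "bounded_op M e' (\<lambda>f x. S f x - T f x)"
      using lim[OF e'] by auto
    have "L2_norm M (\<lambda>x. (S f x - T f x) + T f x) \<le> L2_norm M (\<lambda>x. S f x - T f x) + L2_norm M (T f)"
      using f bounded_op_L2[OF ST f] bounded_op_L2[OF T f] by (intro L2_triangle)
    also have "\<dots> \<le> e' * L2_norm M f + c * L2_norm M f"
      using f by (intro add_mono bounded_op_norm[OF T] bounded_op_norm[OF ST])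
    also have "e' * L2_norm M f \<le> e' * (L2_norm M f + 1)" using e' by (intro mult_left_mono) auto
    also have "\<dots> = e" using pos by (simp add: e'_def)
    finally show "L2_norm M (S f) \<le> c * L2_norm M f + e" by simp
  qed
  with S c show ?thesis by (auto simp: bounded_op_def)
qed

text \<open>A commutator enlarges an error in operator norm by at most the factor 2R, so it suffices
  to start the induction with a finer approximation.\<close>

lemma commutator_bound_limit:
  "bounded_op M c0 S \<Longrightarrow>
    (\<And>e. 0 < e \<Longrightarrow> \<exists>T. commutator_bound M d k c C T \<and> bounded_op M e (\<lambda>f x. S f x - T f x)) \<Longrightarrow>
    commutator_bound M d k c C S"
proof (induction k arbitrary: c0 c S)
  case 0
  then show ?case by (auto intro: bounded_op_limit)
next
  case (Suc k)
  have "bounded_op M c S"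
    by (rule bounded_op_limit[OF Suc.prems(1)])
       (use Suc.prems(2) commutator_bound_imp_bounded_op in blast)
  moreover have "commutator_bound M d k (c * C) C (commutator d S)"
  proof (rule Suc.IH)
    show "bounded_op M (2 * R * c0) (commutator d S)" by (rule bounded_op_commutator[OF Suc.prems(1)])
    fix e :: real assume e: "0 < e"
    define e' where "e' = e / (2 * R + 1)"
    have pos: "0 < 2 * R + 1" using R_nonneg by linarith
    have e': "0 < e'" using e pos by (simp add: e'_def)
    obtain T where T: "commutator_bound M d (Suc k) c C T" and ST: "bounded_op M e' (\<lambda>f x. S f x - T f x)"
      using Suc.prems(2)[OF e'] by auto
    have "commutator d (\<lambda>f x. S f x - T f x) = (\<lambda>f x. commutator d S f x - commutator d T f x)"
      by (auto simp: commutator_def algebra_simps)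
    then have "bounded_op M (2 * R * e') (\<lambda>f x. commutator d S f x - commutator d T f x)"
      using bounded_op_commutator[OF ST] by simp
    moreover have "2 * R * e' \<le> (2 * R + 1) * e'" using e' by (intro mult_right_mono) auto
    moreover have "(2 * R + 1) * e' = e" using pos by (simp add: e'_def)
    ultimately have "bounded_op M e (\<lambda>f x. commutator d S f x - commutator d T f x)"
      by (auto intro: bounded_op_mono)
    with T show "\<exists>T. commutator_bound M d k (c * C) C T \<and> bounded_op M e (\<lambda>f x. commutator d S f x - T f x)"
      by auto
  qed
  ultimately show ?case by simp
qed

lemma commutator_bound_off_diagonal:
  assumes A: "A \<in> sets M" and B: "B \<in> sets M" and dB: "\<And>x. x \<in> B \<Longrightarrow> d x = 0"
    and dA: "\<And>x. x \<in> A \<Longrightarrow> \<delta> \<le> d x" and \<delta>: "0 < \<delta>" and C: "0 \<le> C" and f: "f \<in> L2 M"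
  shows "commutator_bound M d k c C S \<Longrightarrow>
    L2_norm M (cutoff A (S (cutoff B f))) \<le> c * (C / \<delta>) ^ k * L2_norm M f"
proof (induction k arbitrary: c S)
  case 0
  then have S: "bounded_op M c S" by simp
  have Bf: "cutoff B f \<in> L2 M" by (intro L2_cutoff f B)
  have "L2_norm M (cutoff A (S (cutoff B f))) \<le> L2_norm M (S (cutoff B f))"
    by (intro L2_norm_cutoff_le bounded_op_L2[OF S] Bf A)
  also have "\<dots> \<le> c * L2_norm M (cutoff B f)" by (intro bounded_op_norm[OF S] Bf)
  also have "\<dots> \<le> c * L2_norm M f"
    by (intro mult_left_mono L2_norm_cutoff_le f B bounded_op_nonneg[OF S])
  finally show ?case by simp
next
  case (Suc k)
  then have S: "bounded_op M c S" by simp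
  have Bf: "cutoff B f \<in> L2 M" by (intro L2_cutoff f B)
  have SBf: "S (cutoff B f) \<in> L2 M" by (intro bounded_op_L2[OF S] Bf)
  have ad: "commutator d S (cutoff B f) \<in> L2 M"
    by (intro bounded_op_L2[OF bounded_op_commutator[OF S]] Bf)
  \<comment> \<open>The subtracted half of the commutator is \<open>S\<close> applied to the zero
    function, so only multiplication by \<open>d\<close> on the left remains.\<close>
  have z: "(\<lambda>x. complex_of_real (d x) * cutoff B f x) = (\<lambda>x. 0)"
    by (auto simp: cutoff_def indicator_def dB)
  have "L2_norm M (\<lambda>x. complex_of_real \<delta> * cutoff A (S (cutoff B f)) x)
      \<le> L2_norm M (cutoff A (commutator d S (cutoff B f)))"
  proof (intro L2_norm_mono L2_scale L2_cutoff SBf ad A)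
    show "AE x in M. cmod (complex_of_real \<delta> * cutoff A (S (cutoff B f)) x)
        \<le> cmod (cutoff A (commutator d S (cutoff B f)) x)"
      using bounded_op_0[OF S]
    proof eventually_elim
      case (elim x)
      then have "commutator d S (cutoff B f) x = complex_of_real (d x) * S (cutoff B f) x"
        unfolding commutator_def z by simp
      then show ?case
        using dA[of x] \<delta> by (auto simp: cutoff_def indicator_def norm_mult intro!: mult_right_mono)
    qed
  qed
  also have "\<dots> \<le> c * C * (C / \<delta>) ^ k * L2_norm M f" using Suc by simp
  finally have "\<delta> * L2_norm M (cutoff A (S (cutoff B f))) \<le> c * C * (C / \<delta>) ^ k * L2_norm M f"
    using \<delta> by (simp add: L2_norm_scale)
  then show ?case using \<delta> by (simp add: field_simps)
qed

end

section \<open>Off-diagonal decay and the Schur test\<close>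

text \<open>Unfolds the nested definition: block estimates control the iterated commutators one
  order at a time.\<close>

lemma commutator_bound_if_iterates:
  "(\<And>i. i \<le> k \<Longrightarrow> bounded_op M (c * C ^ i) ((commutator d ^^ i) S)) \<Longrightarrow> commutator_bound M d k c C S"
proof (induction k arbitrary: c S)
  case 0
  from "0.prems"[of 0] show ?case by simp
next
  case (Suc k)
  have "commutator_bound M d k (c * C) C (commutator d S)"
  proof (rule Suc.IH)
    fix i assume "i \<le> k"
    then show "bounded_op M (c * C * C ^ i) ((commutator d ^^ i) (commutator d S))"
      using Suc.prems[of "Suc i"] by (simp add: funpow_swap1 mult.assoc)
  qed
  with Suc.prems[of 0] show ?case by simp
qed

section \<open>Packing and nets in a doubling space\<close>

lemma separated_card_le:
  fixes M :: "'a::metric_space measure"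
  assumes "homogeneous_type M n"
  obtains C where "0 < C"
    "\<And>(x :: 'a) \<rho> s A. \<lbrakk>0 < \<rho>; 1 \<le> s; finite A; A \<subseteq> ball x (s * \<rho>);
        \<And>y z. \<lbrakk>y \<in> A; z \<in> A; y \<noteq> z\<rbrakk> \<Longrightarrow> \<rho> \<le> dist y z\<rbrakk> \<Longrightarrow> real (card A) \<le> C * s powr n"
proof -
  have sets: "sets M = sets borel" and n: "0 < n"
    and pos: "\<And>x r. 0 < r \<Longrightarrow> 0 < emeasure M (ball x r) \<and> emeasure M (ball x r) < \<infinity>"
    using assms by (auto simp: homogeneous_type_def)
  obtain C where C: "\<And>x r l. 0 < r \<Longrightarrow> 1 \<le> l \<Longrightarrow>
      measure M (ball x (l * r)) \<le> C * l powr n * measure M (ball x r)"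
    using assms unfolding homogeneous_type_def by blast
  have ball: "ball x r \<in> sets M" for x r by (simp add: sets)
  have V: "0 < measure M (ball x r)" if "0 < r" for x r
    using pos[OF that, of x] by (simp add: measure_def enn2real_positive_iff)
  have fm: "ball x r \<in> fmeasurable M" if "0 < r" for x r
    using pos[OF that, of x] ball by (auto simp: fmeasurable_def)
  \<comment> \<open>Radius 1 and dilation 1 in the volume growth compare a ball of positive measure
    with itself.\<close>
  have C1: "1 \<le> C"
    using C[of 1 1 undefined] V[of 1 undefined] by simp
  show thesis
  proof (rule that[of "C * C * 2 powr n * 4 powr n"])
    show "0 < C * C * 2 powr n * 4 powr n" using C1 by simp
    fix x :: 'a and \<rho> s :: real and A
    assume \<rho>: "0 < \<rho>" and s: "1 \<le> s" and A: "finite A" "A \<subseteq> ball x (s * \<rho>)"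
      and sep: "\<And>y z. \<lbrakk>y \<in> A; z \<in> A; y \<noteq> z\<rbrakk> \<Longrightarrow> \<rho> \<le> dist y z"
    have s\<rho>: "0 < s * \<rho>" "\<rho> \<le> s * \<rho>" using \<rho> s by auto
    let ?V = "measure M (ball x (s * \<rho>))"
    \<comment> \<open>Packing by volume: every ball of radius \<rho>/2 around a point of
      \<open>A\<close> has at least the fraction 1 / (C (4s)^n) of the volume of the large ball, and
      these balls are disjoint inside its double.\<close>
    have "?V \<le> C * (4 * s) powr n * measure M (ball y (\<rho> / 2))" if y: "y \<in> A" for y
    proof -
      have "ball x (s * \<rho>) \<subseteq> ball y (4 * s * (\<rho> / 2))"
      proof
        fix z assume "z \<in> ball x (s * \<rho>)"
        moreover have "dist x y < s * \<rho>" using A y by auto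
        ultimately show "z \<in> ball y (4 * s * (\<rho> / 2))"
          using dist_triangle2[of y z x] by (simp add: dist_commute mult.commute[of s])
      qed
      then have "?V \<le> measure M (ball y (4 * s * (\<rho> / 2)))"
        using \<rho> s by (intro measure_mono_fmeasurable fm ball) auto
      also have "\<dots> \<le> C * (4 * s) powr n * measure M (ball y (\<rho> / 2))"
        using \<rho> s by (intro C) auto
      finally show ?thesis .
    qed
    then have "(\<Sum>y\<in>A. ?V) \<le> (\<Sum>y\<in>A. C * (4 * s) powr n * measure M (ball y (\<rho> / 2)))"
      by (intro sum_mono) auto
    also have "\<dots> = C * (4 * s) powr n * (\<Sum>y\<in>A. measure M (ball y (\<rho> / 2)))"
      by (simp add: sum_distrib_left)
    also have "(\<Sum>y\<in>A. measure M (ball y (\<rho> / 2))) = measure M (\<Union>y\<in>A. ball y (\<rho> / 2))"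
    proof (rule measure_UNION'[symmetric])
      show "pairwise (\<lambda>y z. disjnt (ball y (\<rho> / 2)) (ball z (\<rho> / 2))) A"
      proof (rule pairwiseI)
        fix y z assume "y \<in> A" "z \<in> A" "y \<noteq> z"
        then have "\<rho> \<le> dist y z" by (rule sep)
        then show "disjnt (ball y (\<rho> / 2)) (ball z (\<rho> / 2))"
          using dist_triangle_half_r[of _ y \<rho> z]
          by (auto simp: disjnt_iff dist_commute not_less[symmetric])
      qed
    qed (use A \<rho> fm in auto)
    also have "\<dots> \<le> measure M (ball x (2 * (s * \<rho>)))"
    proof (rule measure_mono_fmeasurable)
      show "(\<Union>y\<in>A. ball y (\<rho> / 2)) \<subseteq> ball x (2 * (s * \<rho>))"
      proof
        fix z assume "z \<in> (\<Union>y\<in>A. ball y (\<rho> / 2))"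
        then obtain y where "y \<in> A" "dist y z < \<rho> / 2" by auto
        moreover have "dist x y < s * \<rho>" using A \<open>y \<in> A\<close> by auto
        ultimately show "z \<in> ball x (2 * (s * \<rho>))"
          using dist_triangle[of x z y] s\<rho>(2) \<rho> unfolding mem_ball by linarith
      qed
    qed (use A ball fm s\<rho> in auto)
    also have "\<dots> \<le> C * 2 powr n * ?V" using s\<rho> by (intro C) auto
    finally have "real (card A) * ?V \<le> C * (4 * s) powr n * (C * 2 powr n * ?V)"
      using C1 by (simp add: mult_left_mono)
    also have "\<dots> = (C * C * 2 powr n * 4 powr n * s powr n) * ?V"
      using s by (simp add: powr_mult)
    finally show "real (card A) \<le> C * C * 2 powr n * 4 powr n * s powr n"
      using V[OF s\<rho>(1)] by (simp add: mult_le_cancel_right)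
  qed
qed

text \<open>A maximal separated set covers by maximality, is countable because packing makes it
  finite in each ball, and is infinite because finitely many balls have finite total measure. Hence
  all of \<open>nat\<close> enumerates it without repetition.\<close>

lemma separated_net:
  fixes M :: "'a::metric_space measure"
  assumes hom: "homogeneous_type M n" and inf: "emeasure M (space M) = \<infinity>" and \<rho>: "0 < \<rho>"
  obtains y :: "nat \<Rightarrow> 'a" where "\<And>i j. i \<noteq> j \<Longrightarrow> \<rho> \<le> dist (y i) (y j)" "\<And>x. \<exists>i. dist x (y i) < \<rho>"
proof -
  have sets: "sets M = sets borel"
    and pos: "\<And>x r. 0 < r \<Longrightarrow> emeasure M (ball x r) < \<infinity>"
    using hom by (auto simp: homogeneous_type_def)
  have space: "space M = UNIV" using sets_eq_imp_space_eq[OF sets] by simp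
  define sep where "sep A \<longleftrightarrow> (\<forall>y\<in>A. \<forall>z\<in>A. y \<noteq> z \<longrightarrow> \<rho> \<le> dist y z)" for A :: "'a set"
  have "\<exists>A\<in>{A. sep A}. \<forall>B\<in>{A. sep A}. A \<subseteq> B \<longrightarrow> B = A"
  proof (rule subset_Zorn')
    fix \<C> assume ch: "subset.chain {A. sep A} \<C>"
    have "\<rho> \<le> dist y z" if "y \<in> \<Union>\<C>" "z \<in> \<Union>\<C>" "y \<noteq> z" for y z
    proof -
      obtain A B where AB: "A \<in> \<C>" "y \<in> A" "B \<in> \<C>" "z \<in> B" using \<open>y \<in> \<Union>\<C>\<close> \<open>z \<in> \<Union>\<C>\<close> by blast
      then have "A \<subseteq> B \<or> B \<subseteq> A" "sep A" "sep B" using ch by (auto simp: subset_chain_def)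
      with AB that(3) show ?thesis unfolding sep_def by blast
    qed
    then show "\<Union>\<C> \<in> {A. sep A}" by (auto simp: sep_def)
  qed
  then obtain A where A: "sep A" and max: "\<And>B. sep B \<Longrightarrow> A \<subseteq> B \<Longrightarrow> B = A" by blast
  have cover: "\<exists>y\<in>A. dist x y < \<rho>" for x
  proof (rule ccontr)
    assume "\<not> ?thesis"
    then have far: "\<rho> \<le> dist x y" if "y \<in> A" for y using that by (auto simp: not_less)
    then have "sep (insert x A)" using A by (auto simp: sep_def dist_commute)
    then have "x \<in> A" using max[of "insert x A"] by auto
    from far[OF this] \<rho> show False by simp
  qed
  obtain C where C: "\<And>(x :: 'a) \<rho> s A. \<lbrakk>0 < \<rho>; 1 \<le> s; finite A; A \<subseteq> ball x (s * \<rho>);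
      \<And>y z. \<lbrakk>y \<in> A; z \<in> A; y \<noteq> z\<rbrakk> \<Longrightarrow> \<rho> \<le> dist y z\<rbrakk> \<Longrightarrow> real (card A) \<le> C * s powr n"
    using separated_card_le[OF hom] by metis
  \<comment> \<open>An arbitrary base point for the exhaustion by balls.\<close>
  fix x0 :: 'a
  have fin: "finite (A \<inter> ball x0 (real (Suc k) * \<rho>))" for k
  proof (rule ccontr)
    assume "infinite (A \<inter> ball x0 (real (Suc k) * \<rho>))"
    then obtain F where F: "F \<subseteq> A \<inter> ball x0 (real (Suc k) * \<rho>)" "finite F"
        "card F = nat \<lceil>C * real (Suc k) powr n\<rceil> + 1"
      using infinite_arbitrarily_large by blast
    have "real (card F) \<le> C * real (Suc k) powr n"
      using F A \<rho> by (intro C[of \<rho> _ _ x0]) (auto simp: sep_def)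
    with F(3) show False by linarith
  qed
  have "A = (\<Union>k. A \<inter> ball x0 (real (Suc k) * \<rho>))"
  proof (intro equalityI subsetI)
    fix y assume "y \<in> A"
    obtain k where "dist x0 y / \<rho> < real k" using reals_Archimedean2 by blast
    then have "dist x0 y < real (Suc k) * \<rho>" using \<rho> by (simp add: field_simps)
    then show "y \<in> (\<Union>k. A \<inter> ball x0 (real (Suc k) * \<rho>))" using \<open>y \<in> A\<close> by auto
  qed auto
  moreover have "countable (\<Union>k. A \<inter> ball x0 (real (Suc k) * \<rho>))"
    by (intro countable_UN[OF _ countable_finite[OF fin]]) simp
  ultimately have "countable A" by simp
  have "infinite A"
  proof
    assume "finite A"
    have "space M \<subseteq> (\<Union>y\<in>A. ball y \<rho>)" using cover by (auto simp: dist_commute)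
    then have "emeasure M (space M) \<le> emeasure M (\<Union>y\<in>A. ball y \<rho>)"
      by (intro emeasure_mono) (auto simp: sets intro!: open_UN borel_open)
    also have "\<dots> \<le> (\<Sum>y\<in>A. emeasure M (ball y \<rho>))"
      using \<open>finite A\<close> by (intro emeasure_subadditive_finite) (auto simp: sets)
    also have "\<dots> < \<infinity>" using \<open>finite A\<close> pos[OF \<rho>] by (simp add: ennreal_sum_less_top)
    finally show False using inf by simp
  qed
  have bij: "bij_betw (from_nat_into A) UNIV A"
    by (rule bij_betw_from_nat_into) fact+
  show thesis
  proof (rule that[of "from_nat_into A"])
    show "\<rho> \<le> dist (from_nat_into A i) (from_nat_into A j)" if "i \<noteq> j" for i j
    proof -
      have "from_nat_into A i \<in> A" "from_nat_into A j \<in> A"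
        using bij by (auto simp: bij_betw_def)
      moreover have "from_nat_into A i \<noteq> from_nat_into A j"
        using that bij by (auto simp: bij_betw_def dest: injD)
      ultimately show ?thesis using A by (auto simp: sep_def)
    qed
    show "\<exists>i. dist x (from_nat_into A i) < \<rho>" for x
    proof -
      obtain y where "y \<in> A" "dist x y < \<rho>" using cover by blast
      moreover then obtain i where "y = from_nat_into A i" using bij by (auto simp: bij_betw_def)
      ultimately show ?thesis by blast
    qed
  qed
qed

text \<open>Dyadic shells: the k-th contains at most a multiple of 2^(kn) net points, each
  contributing at most 2^(-k(n+e)), which leaves a geometric series of ratio 2^(-e). The bound
  depends neither on the scale nor on the centre nor on the net.\<close>

lemma separated_sum_le:
  fixes M :: "'a::metric_space measure"
  assumes hom: "homogeneous_type M n" and e: "0 < e"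
  obtains H where "0 \<le> H"
    "\<And>\<rho> y x J. \<lbrakk>0 < \<rho>; \<And>i j. i \<noteq> j \<Longrightarrow> \<rho> \<le> dist (y i) (y j :: 'a); finite (J :: nat set)\<rbrakk> \<Longrightarrow>
       (\<Sum>j\<in>J. (1 + dist x (y j) / \<rho>) powr (- n - e)) \<le> H"
proof -
  have n: "0 < n" using hom by (simp add: homogeneous_type_def)
  obtain C where C0: "0 < C" and C: "\<And>(x :: 'a) \<rho> s A. \<lbrakk>0 < \<rho>; 1 \<le> s; finite A; A \<subseteq> ball x (s * \<rho>);
      \<And>y z. \<lbrakk>y \<in> A; z \<in> A; y \<noteq> z\<rbrakk> \<Longrightarrow> \<rho> \<le> dist y z\<rbrakk> \<Longrightarrow> real (card A) \<le> C * s powr n"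
    using separated_card_le[OF hom] by metis
  define q where "q = 2 powr (- e)"
  have q: "0 < q" "q < 1" using e powr_less_mono[of "- e" 0 2] by (auto simp: q_def)
  show thesis
  proof (rule that[of "C * 2 powr n * (1 / (1 - q))"])
    show "0 \<le> C * 2 powr n * (1 / (1 - q))" using C0 q by simp
    fix \<rho> :: real and y :: "nat \<Rightarrow> 'a" and x and J :: "nat set"
    assume \<rho>: "0 < \<rho>" and sep: "\<And>i j. i \<noteq> j \<Longrightarrow> \<rho> \<le> dist (y i) (y j)" and J: "finite J"
    define u where "u j = 1 + dist x (y j) / \<rho>" for j
    have u1: "1 \<le> u j" for j using \<rho> by (simp add: u_def)
    define l where "l j = nat \<lfloor>log 2 (u j)\<rfloor>" for j
    have l: "2 ^ l j \<le> u j" "u j < 2 ^ Suc (l j)" for j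
    proof -
      have "0 \<le> log 2 (u j)" using u1[of j] by simp
      then have "real (l j) = of_int \<lfloor>log 2 (u j)\<rfloor>" by (simp add: l_def)
      then have *: "real (l j) \<le> log 2 (u j)" "log 2 (u j) < real (Suc (l j))" by linarith+
      have "2 powr real (l j) \<le> u j" using *(1) u1[of j] by (simp add: le_log_iff)
      then show "2 ^ l j \<le> u j" by (simp add: powr_realpow)
      have "u j < 2 powr real (Suc (l j))" using *(2) u1[of j] by (subst (asm) log_less_iff) auto
      then show "u j < 2 ^ Suc (l j)" by (simp only: powr_realpow zero_less_numeral)
    qed
    define L where "L = Max (insert 0 (l ` J))"
    have L: "l ` J \<subseteq> {..L}" using J by (auto simp: L_def)
    have "(\<Sum>j\<in>J. u j powr (- n - e)) = (\<Sum>k\<in>{..L}. \<Sum>j\<in>{j\<in>J. l j = k}. u j powr (- n - e))"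
      using J L by (intro sum.group[symmetric]) auto
    also have "\<dots> \<le> (\<Sum>k\<in>{..L}. C * 2 powr n * q ^ k)"
    proof (rule sum_mono)
      fix k
      let ?J = "{j\<in>J. l j = k}"
      have "(\<Sum>j\<in>?J. u j powr (- n - e)) \<le> (\<Sum>j\<in>?J. (2 ^ k) powr (- n - e))"
        using l(1) n e by (intro sum_mono powr_mono2') auto
      also have "\<dots> = real (card ?J) * (2 ^ k) powr (- n - e)" by simp
      also have "card ?J = card (y ` ?J)"
        using sep \<rho> by (intro card_image[symmetric] inj_onI) (metis dist_self not_less)
      also have "real (card (y ` ?J)) \<le> C * (2 ^ Suc k) powr n"
      proof (rule C[OF \<rho>, of _ _ x])
        show "y ` ?J \<subseteq> ball x (2 ^ Suc k * \<rho>)"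
        proof
          fix z assume "z \<in> y ` ?J"
          then obtain j where j: "z = y j" "l j = k" by auto
          have "dist x z / \<rho> < 2 ^ Suc k" using l(2)[of j] j by (simp add: u_def)
          then show "z \<in> ball x (2 ^ Suc k * \<rho>)" using \<rho> by (simp add: field_simps)
        qed
        show "\<rho> \<le> dist z w" if zw: "z \<in> y ` ?J" "w \<in> y ` ?J" "z \<noteq> w" for z w
        proof -
          obtain i j where ij: "z = y i" "w = y j" using zw by auto
          with zw(3) have "i \<noteq> j" by auto
          then show ?thesis unfolding ij by (rule sep)
        qed
        show "1 \<le> (2 :: real) ^ Suc k" by (rule one_le_power) simp
      qed (use J in simp)
      also have "C * (2 ^ Suc k) powr n * (2 ^ k) powr (- n - e) = C * 2 powr n * q ^ k"
      proof -
        have "(2 ^ Suc k) powr n = 2 powr n * (2 ^ k) powr n" by (simp add: powr_mult)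
        moreover have "(2 ^ k) powr n * (2 ^ k) powr (- n - e) = (2 ^ k :: real) powr (- e)"
          by (simp add: powr_add[symmetric])
        moreover have "(2 ^ k :: real) powr (- e) = q ^ k"
          by (simp add: q_def powr_realpow[symmetric] powr_powr powr_power mult.commute)
        ultimately show ?thesis by (simp add: mult.assoc)
      qed
      finally show "(\<Sum>j\<in>?J. u j powr (- n - e)) \<le> C * 2 powr n * q ^ k"
        by (simp add: mult_right_mono)
    qed
    also have "\<dots> = C * 2 powr n * (\<Sum>k\<in>{..L}. q ^ k)" by (simp add: sum_distrib_left)
    also have "(\<Sum>k\<in>{..L}. q ^ k) \<le> (\<Sum>k. q ^ k)"
      using q by (intro sum_le_suminf summable_geometric) auto
    also have "(\<Sum>k. q ^ k) = 1 / (1 - q)" using q by (intro suminf_geometric) auto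
    finally show "(\<Sum>j\<in>J. (1 + dist x (y j) / \<rho>) powr (- n - e)) \<le> C * 2 powr n * (1 / (1 - q))"
      using C0 by (simp add: u_def mult_left_mono)
  qed
qed

section \<open>The Schur test for operators cut into blocks\<close>

lemma Schur_test_finite:
  fixes b :: "nat \<Rightarrow> nat \<Rightarrow> real"
  assumes b: "\<And>i j. 0 \<le> b i j" and H: "0 \<le> H"
    and row: "\<And>i. (\<Sum>j<N. b i j) \<le> H" and col: "\<And>j. (\<Sum>i<N. b i j) \<le> H"
  shows "(\<Sum>i<N. (\<Sum>j<N. b i j * v j)\<^sup>2) \<le> H\<^sup>2 * (\<Sum>j<N. (v j)\<^sup>2)"
proof -
  have "(\<Sum>j<N. b i j * v j)\<^sup>2 \<le> H * (\<Sum>j<N. b i j * (v j)\<^sup>2)" for i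
  proof -
    \<comment> \<open>Splitting each entry into two square roots makes one Cauchy-Schwarz factor a
      row sum; the column sums enter after exchanging the order of summation.\<close>
    have "(\<Sum>j<N. b i j * v j)\<^sup>2 = (\<Sum>j<N. sqrt (b i j) * (sqrt (b i j) * v j))\<^sup>2"
      using b by (simp add: mult.assoc[symmetric])
    also have "\<dots> \<le> (\<Sum>j<N. (sqrt (b i j))\<^sup>2) * (\<Sum>j<N. (sqrt (b i j) * v j)\<^sup>2)"
      by (rule Cauchy_Schwarz_ineq_sum)
    also have "\<dots> = (\<Sum>j<N. b i j) * (\<Sum>j<N. b i j * (v j)\<^sup>2)"
      using b by (simp add: power_mult_distrib)
    also have "\<dots> \<le> H * (\<Sum>j<N. b i j * (v j)\<^sup>2)"
      using b by (intro mult_right_mono row sum_nonneg) auto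
    finally show ?thesis .
  qed
  then have "(\<Sum>i<N. (\<Sum>j<N. b i j * v j)\<^sup>2) \<le> (\<Sum>i<N. H * (\<Sum>j<N. b i j * (v j)\<^sup>2))"
    by (rule sum_mono)
  also have "\<dots> = H * (\<Sum>j<N. (v j)\<^sup>2 * (\<Sum>i<N. b i j))"
    unfolding sum_distrib_left by (subst sum.swap) (simp add: ac_simps)
  also have "\<dots> \<le> H * (\<Sum>j<N. (v j)\<^sup>2 * H)"
    using H col by (intro mult_left_mono sum_mono) auto
  also have "H * (\<Sum>j<N. (v j)\<^sup>2 * H) = H\<^sup>2 * (\<Sum>j<N. (v j)\<^sup>2)"
    by (simp add: sum_distrib_right[symmetric] power2_eq_square[of H])
  finally show ?thesis .
qed

lemma cutoff_apply: "cutoff A f x = indicator A x * f x"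
  by (simp add: cutoff_def)

locale countable_partition =
  fixes M :: "'a measure" and Q :: "nat \<Rightarrow> 'a set"
  assumes Q_sets: "\<And>i. Q i \<in> sets M" and disj: "disjoint_family Q" and cover: "(\<Union>i. Q i) = space M"
begin

abbreviation U where "U N \<equiv> (\<Union>i<N. Q i)"

lemma U_sets: "U N \<in> sets M"
  using Q_sets by auto

lemma indicator_U: "(indicator (U N) x :: complex) = (\<Sum>i<N. indicator (Q i) x)"
  using disj by (intro indicator_UN_disjoint) (auto simp: disjoint_family_on_def)

lemma cutoff_U: "cutoff (U N) f = (\<lambda>x. \<Sum>i<N. cutoff (Q i) f x)"
  unfolding cutoff_def indicator_U by (simp add: sum_distrib_right)

lemma L2_norm_cutoff_U:
  assumes f: "f \<in> L2 M"
  shows "(L2_norm M (cutoff (U N) f))\<^sup>2 = (\<Sum>i<N. (L2_norm M (cutoff (Q i) f))\<^sup>2)"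
proof -
  have 1: "(cmod (cutoff A f x))\<^sup>2 = Re (indicator A x) * (cmod (f x))\<^sup>2" for A x
    by (auto simp: cutoff_def indicator_def)
  have "(\<integral>x. (cmod (cutoff (U N) f x))\<^sup>2 \<partial>M) = (\<integral>x. (\<Sum>i<N. (cmod (cutoff (Q i) f x))\<^sup>2) \<partial>M)"
    unfolding 1 indicator_U by (simp add: sum_distrib_right)
  also have "\<dots> = (\<Sum>i<N. \<integral>x. (cmod (cutoff (Q i) f x))\<^sup>2 \<partial>M)"
    by (intro Bochner_Integration.integral_sum L2_integrable L2_cutoff f Q_sets)
  finally show ?thesis by (simp add: L2_norm_sq)
qed

lemma cutoff_U_tendsto:
  assumes f: "f \<in> L2 M"
  shows "(\<lambda>N. L2_norm M (\<lambda>x. f x - cutoff (U N) f x)) \<longlonglongrightarrow> 0"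
proof -
  note [measurable] = L2_measurable[OF f] U_sets
  have "(\<lambda>N. \<integral>x. (cmod (f x - cutoff (U N) f x))\<^sup>2 \<partial>M) \<longlonglongrightarrow> (\<integral>x. 0 \<partial>M)"
  proof (rule integral_dominated_convergence[where w = "\<lambda>x. (cmod (f x))\<^sup>2"])
    show "integrable M (\<lambda>x. (cmod (f x))\<^sup>2)" using f by (rule L2_integrable)
    show "AE x in M. (\<lambda>N. (cmod (f x - cutoff (U N) f x))\<^sup>2) \<longlonglongrightarrow> 0"
    proof (rule AE_I2)
      fix x assume "x \<in> space M"
      then obtain i where i: "x \<in> Q i" using cover by blast
      have "(cmod (f x - cutoff (U N) f x))\<^sup>2 = 0" if "Suc i \<le> N" for N
        using that i by (auto simp: cutoff_def indicator_def)
      then have "\<forall>\<^sub>F N in sequentially. (cmod (f x - cutoff (U N) f x))\<^sup>2 = 0"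
        unfolding eventually_sequentially by blast
      then show "(\<lambda>N. (cmod (f x - cutoff (U N) f x))\<^sup>2) \<longlonglongrightarrow> 0" by (rule tendsto_eventually)
    qed
    show "AE x in M. norm ((cmod (f x - cutoff (U N) f x))\<^sup>2) \<le> (cmod (f x))\<^sup>2" for N
      by (auto simp: cutoff_def indicator_def)
    show "(\<lambda>x. (cmod (f x - cutoff (U N) f x))\<^sup>2) \<in> borel_measurable M" for N
      by (intro borel_measurable_power borel_measurable_norm L2_measurable L2_diff L2_cutoff f U_sets
            measurable_compose[OF _ borel_measurable_norm]) 
  qed simp
  then have "(\<lambda>N. sqrt (\<integral>x. (cmod (f x - cutoff (U N) f x))\<^sup>2 \<partial>M)) \<longlonglongrightarrow> sqrt 0"
    by (intro tendsto_real_sqrt) simp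
  then show ?thesis by (simp add: L2_norm_def)
qed

text \<open>The a priori bound \<open>c\<close> lets the cutoffs be removed in the limit; the
  resulting norm \<open>H\<close> comes from the blocks alone.\<close>

lemma Schur_test:
  assumes S: "bounded_op M c S" and b: "\<And>i j. 0 \<le> b i j" and H: "0 \<le> H"
    and row: "\<And>i N. (\<Sum>j<N. b i j) \<le> H" and col: "\<And>j N. (\<Sum>i<N. b i j) \<le> H"
    and blk: "\<And>i j f. f \<in> L2 M \<Longrightarrow>
      L2_norm M (cutoff (Q i) (S (cutoff (Q j) f))) \<le> b i j * L2_norm M (cutoff (Q j) f)"
  shows "bounded_op M H S"
proof -
  have "L2_norm M (S f) \<le> H * L2_norm M f" if f: "f \<in> L2 M" for f
  proof (rule LIMSEQ_le_const)
    let ?r = "\<lambda>N x. f x - cutoff (U N) f x"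
    let ?s = "\<lambda>N x. S f x - cutoff (U N) (S f) x"
    have Sf: "S f \<in> L2 M" by (intro bounded_op_L2[OF S] f)
    have Uf: "cutoff (U N) f \<in> L2 M" and r: "?r N \<in> L2 M" and s: "?s N \<in> L2 M" for N
      by (intro L2_diff L2_cutoff f U_sets Sf)+
    show "(\<lambda>N. L2_norm M (?s N) + c * L2_norm M (?r N) + H * L2_norm M f) \<longlonglongrightarrow> H * L2_norm M f"
      using tendsto_add[OF tendsto_add[OF cutoff_U_tendsto[OF Sf] tendsto_mult_left[OF cutoff_U_tendsto[OF f], of c]]
          tendsto_const[of "H * L2_norm M f"]] by simp
    have main: "L2_norm M (cutoff (U N) (S (cutoff (U N) f))) \<le> H * L2_norm M f" for N
    proof -
      have Qf: "cutoff (Q j) f \<in> L2 M" for j by (intro L2_cutoff f Q_sets)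
      have SU: "S (cutoff (U N) f) \<in> L2 M" by (intro bounded_op_L2[OF S] Uf)
      have "L2_norm M (cutoff (Q i) (S (cutoff (U N) f))) \<le> (\<Sum>j<N. b i j * L2_norm M (cutoff (Q j) f))" for i
      proof -
        have "AE x in M. S (cutoff (U N) f) x = (\<Sum>j<N. S (cutoff (Q j) f) x)"
          unfolding cutoff_U by (intro bounded_op_sum[OF S] Qf) auto
        then have "AE x in M. cutoff (Q i) (S (cutoff (U N) f)) x = (\<Sum>j<N. cutoff (Q i) (S (cutoff (Q j) f)) x)"
          by eventually_elim (simp add: cutoff_def sum_distrib_left)
        then have "L2_norm M (cutoff (Q i) (S (cutoff (U N) f)))
            = L2_norm M (\<lambda>x. \<Sum>j<N. cutoff (Q i) (S (cutoff (Q j) f)) x)"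
          by (intro L2_norm_cong_AE L2_sum L2_cutoff SU Q_sets bounded_op_L2[OF S] f)
        also have "\<dots> \<le> (\<Sum>j<N. L2_norm M (cutoff (Q i) (S (cutoff (Q j) f))))"
          by (intro L2_triangle_sum L2_cutoff Q_sets bounded_op_L2[OF S] f)
        also have "\<dots> \<le> (\<Sum>j<N. b i j * L2_norm M (cutoff (Q j) f))"
          by (intro sum_mono blk f)
        finally show ?thesis .
      qed
      then have "(L2_norm M (cutoff (U N) (S (cutoff (U N) f))))\<^sup>2
          \<le> (\<Sum>i<N. (\<Sum>j<N. b i j * L2_norm M (cutoff (Q j) f))\<^sup>2)"
        unfolding L2_norm_cutoff_U[OF SU] by (intro sum_mono power_mono) auto
      also have "\<dots> \<le> H\<^sup>2 * (\<Sum>j<N. (L2_norm M (cutoff (Q j) f))\<^sup>2)"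
        by (intro Schur_test_finite b H row col)
      also have "\<dots> = H\<^sup>2 * (L2_norm M (cutoff (U N) f))\<^sup>2" by (simp add: L2_norm_cutoff_U[OF f])
      also have "\<dots> \<le> H\<^sup>2 * (L2_norm M f)\<^sup>2"
        by (intro mult_left_mono power_mono L2_norm_cutoff_le f U_sets) auto
      also have "\<dots> = (H * L2_norm M f)\<^sup>2" by (simp add: power_mult_distrib)
      finally show ?thesis by (rule power2_le_imp_le) (simp add: H)
    qed
    have "L2_norm M (S f) \<le> L2_norm M (?s N) + c * L2_norm M (?r N) + H * L2_norm M f" for N
    proof -
      let ?a = "cutoff (U N) (S (?r N))" and ?b = "cutoff (U N) (S (cutoff (U N) f))"
      have a: "?a \<in> L2 M" and b: "?b \<in> L2 M"
        by (intro L2_cutoff U_sets bounded_op_L2[OF S] r Uf)+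
      have "AE x in M. S (?r N) x = S f x - S (cutoff (U N) f) x"
        by (intro bounded_op_diff[OF S] f Uf)
      \<comment> \<open>Three parts: what \<open>S f\<close> has outside \<open>U N\<close>, the
        image of the removed part of \<open>f\<close>, and a finite block matrix. The first two tend
        to 0.\<close>
      then have "AE x in M. S f x = ?s N x + (?a x + ?b x)"
      proof eventually_elim
        case (elim x)
        show ?case
          unfolding cutoff_apply[of "U N" "S f"] cutoff_apply[of "U N" "S (?r N)"]
            cutoff_apply[of "U N" "S (cutoff (U N) f)"] elim
          by (simp add: right_diff_distrib)
      qed
      then have "L2_norm M (S f) = L2_norm M (\<lambda>x. ?s N x + (?a x + ?b x))"
        by (intro L2_norm_cong_AE L2_add Sf s a b)
      also have "\<dots> \<le> L2_norm M (?s N) + (L2_norm M ?a + L2_norm M ?b)"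
        by (intro order_trans[OF L2_triangle] L2_add s a b add_left_mono L2_triangle)
      also have "L2_norm M ?a \<le> c * L2_norm M (?r N)"
        by (intro order_trans[OF L2_norm_cutoff_le] bounded_op_norm[OF S] bounded_op_L2[OF S] r U_sets)
      also note main[of N]
      finally show ?thesis by (simp add: add_ac)
    qed
    then show "\<exists>N. \<forall>k\<ge>N. L2_norm M (S f) \<le> L2_norm M (?s k) + c * L2_norm M (?r k) + H * L2_norm M f"
      by blast
  qed
  with S H show ?thesis by (simp add: bounded_op_def)
qed

end

text \<open>Subtracting a constant from \<open>d\<close> does not change the commutator. On the blocks \<open>Q i\<close>, \<open>Q j\<close> subtract
  the value of \<open>d\<close> at the center of \<open>Q j\<close>.\<close>

lemma (in bounded_weight) commutator_block:
  assumes S: "bounded_op M c S" and A: "A \<in> sets M" and B: "B \<in> sets M" and f: "f \<in> L2 M"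
    and dA: "\<And>x. x \<in> A \<Longrightarrow> \<bar>d x - a\<bar> \<le> u" and dB: "\<And>x. x \<in> B \<Longrightarrow> \<bar>d x - a\<bar> \<le> 1" and u: "1 \<le> u"
    and b: "\<And>g. g \<in> L2 M \<Longrightarrow> L2_norm M (cutoff A (S (cutoff B g))) \<le> b * L2_norm M (cutoff B g)" "0 \<le> b"
  shows "L2_norm M (cutoff A (commutator d S (cutoff B f))) \<le> 2 * u * b * L2_norm M (cutoff B f)"
proof -
  let ?f = "cutoff B f"
  \<comment> \<open>Extending \<open>d - a\<close> by 0 off the two sets makes it a multiplier
    bounded by \<open>u\<close>, and changes neither its product with a function cut off to
    \<open>B\<close> nor that with one cut off to \<open>A\<close>.\<close>
  define e where "e x = complex_of_real (if x \<in> A \<union> B then d x - a else 0)" for x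
  have [measurable]: "A \<in> sets M" "B \<in> sets M" by (fact A B)+
  have e: "e \<in> borel_measurable M" unfolding e_def[abs_def] by measurable
  have ele: "cmod (e x) \<le> u" for x
    using dA[of x] dB[of x] u by (auto simp: e_def simp flip: of_real_diff)
  have Bf: "?f \<in> L2 M" by (intro L2_cutoff f B)
  have eBf: "(\<lambda>x. e x * ?f x) \<in> L2 M" by (intro L2_bounded_mult[OF _ e ele] Bf)
  have SBf: "S ?f \<in> L2 M" by (intro bounded_op_L2[OF S] Bf)
  have dBf: "(\<lambda>x. complex_of_real (d x) * ?f x) \<in> L2 M" by (intro L2_d Bf)
  have ceq: "cutoff B (\<lambda>x. e x * ?f x) = (\<lambda>x. e x * ?f x)"
    by (auto simp: cutoff_def indicator_def)
  have "(\<lambda>x. e x * ?f x) = (\<lambda>x. complex_of_real (d x) * ?f x + (- complex_of_real a) * ?f x)"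
    by (auto simp: e_def cutoff_def indicator_def algebra_simps)
  then have "AE x in M. S (\<lambda>x. e x * ?f x) x = S (\<lambda>x. complex_of_real (d x) * ?f x) x + (- complex_of_real a) * S ?f x"
    using bounded_op_linear[OF S dBf Bf, of "- complex_of_real a"] by (simp only:)
  then have eq: "AE x in M. cutoff A (commutator d S ?f) x
      = e x * cutoff A (S ?f) x - cutoff A (S (\<lambda>x. e x * ?f x)) x"
    by eventually_elim (auto simp: commutator_def cutoff_def indicator_def e_def algebra_simps)
  have L: "cutoff A (S ?f) \<in> L2 M" "cutoff A (S (\<lambda>x. e x * ?f x)) \<in> L2 M"
    by (intro L2_cutoff SBf A bounded_op_L2[OF S] eBf)+
  have "L2_norm M (cutoff A (commutator d S ?f))
      = L2_norm M (\<lambda>x. e x * cutoff A (S ?f) x - cutoff A (S (\<lambda>x. e x * ?f x)) x)"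
    by (intro L2_norm_cong_AE eq L2_diff L L2_bounded_mult[OF _ e ele] L2_cutoff A
        bounded_op_L2[OF bounded_op_commutator[OF S]] Bf)
  also have "\<dots> \<le> L2_norm M (\<lambda>x. e x * cutoff A (S ?f) x) + L2_norm M (cutoff A (S (\<lambda>x. e x * ?f x)))"
    by (intro L2_triangle_diff L L2_bounded_mult[OF _ e ele])
  finally have 1: "L2_norm M (cutoff A (commutator d S ?f))
      \<le> L2_norm M (\<lambda>x. e x * cutoff A (S ?f) x) + L2_norm M (cutoff A (S (\<lambda>x. e x * ?f x)))" .
  have "L2_norm M (\<lambda>x. e x * cutoff A (S ?f) x) \<le> u * L2_norm M (cutoff A (S ?f))"
    by (intro L2_norm_bounded_mult L e ele)
  also have "\<dots> \<le> u * (b * L2_norm M ?f)" using u by (intro mult_left_mono b f) auto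
  finally have 2: "L2_norm M (\<lambda>x. e x * cutoff A (S ?f) x) \<le> u * (b * L2_norm M ?f)" .
  have "L2_norm M (cutoff A (S (\<lambda>x. e x * ?f x))) \<le> b * L2_norm M (\<lambda>x. e x * ?f x)"
    using b(1)[OF eBf] unfolding ceq .
  also have "\<dots> \<le> b * L2_norm M ?f"
  proof (intro mult_left_mono b L2_norm_mono eBf Bf AE_I2)
    fix x show "cmod (e x * ?f x) \<le> cmod (?f x)"
      using dB[of x] by (auto simp: cutoff_def indicator_def e_def norm_mult simp flip: of_real_diff
          intro!: mult_left_le_one_le)
  qed
  also have "\<dots> \<le> u * (b * L2_norm M ?f)"
    using mult_right_mono[OF u, of "b * L2_norm M ?f"] b(2) by simp
  finally show ?thesis using 1 2 by (simp add: mult.assoc)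
qed

text \<open>A commutator costs a factor 2u on a block at relative distance u. After at most K of
  them the exponent is still -n - (\<kappa> - K), which is summable over the net.\<close>

lemma commutator_bound_if_off_diagonal_decay:
  fixes M :: "'a::metric_space measure" and K :: nat
  assumes hom: "homogeneous_type M n" and inf: "emeasure M (space M) = \<infinity>" and \<kappa>: "real K < \<kappa>" and P: "0 \<le> P"
  obtains C where "1 \<le> C"
    "\<And>\<rho> T d R. \<lbrakk>0 < \<rho>; bounded_op M 1 T; bounded_weight M d R;
       \<And>x y. \<bar>d x - d y\<bar> \<le> dist x y / \<rho>;
       \<And>x y f. f \<in> L2 M \<Longrightarrow> L2_norm M (cutoff (ball x \<rho>) (T (cutoff (ball y \<rho>) f)))
          \<le> P * (1 + dist x y / \<rho>) powr (- n - \<kappa>) * L2_norm M f\<rbrakk>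
     \<Longrightarrow> commutator_bound M d K 1 C T"
proof -
  have sets: "sets M = sets borel" using hom by (simp add: homogeneous_type_def)
  have space: "space M = UNIV" using sets_eq_imp_space_eq[OF sets] by simp
  have ball: "ball x r \<in> sets M" for x r by (simp add: sets)
  define e where "e = \<kappa> - real K"
  have e: "0 < e" using \<kappa> by (simp add: e_def)
  obtain H where H0: "0 \<le> H" and H: "\<And>\<rho> y x J. \<lbrakk>0 < \<rho>; \<And>i j. i \<noteq> j \<Longrightarrow> \<rho> \<le> dist (y i) (y j :: 'a);
      finite (J :: nat set)\<rbrakk> \<Longrightarrow> (\<Sum>j\<in>J. (1 + dist x (y j) / \<rho>) powr (- n - e)) \<le> H"
    using separated_sum_le[OF hom e] by metis
  define G where "G = 2 ^ K * P * H"
  \<comment> \<open>The i-th order has to be bounded by the i-th power of the constant. With a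
    constant of at least 1, the bound \<open>G\<close> serves all positive orders, and order 0 is
    the contraction bound on \<open>T\<close>.\<close>
  show thesis
  proof (rule that[of "max 1 G"])
    fix \<rho> R :: real and T d
    assume \<rho>: "0 < \<rho>" and T: "bounded_op M 1 T" and d: "bounded_weight M d R"
      and lip: "\<And>x y. \<bar>d x - d y\<bar> \<le> dist x y / \<rho>"
      and dec: "\<And>x y f. f \<in> L2 M \<Longrightarrow> L2_norm M (cutoff (ball x \<rho>) (T (cutoff (ball y \<rho>) f)))
          \<le> P * (1 + dist x y / \<rho>) powr (- n - \<kappa>) * L2_norm M f"
    interpret bounded_weight M d R by (rule d)
    obtain y :: "nat \<Rightarrow> 'a" where sep: "\<And>i j. i \<noteq> j \<Longrightarrow> \<rho> \<le> dist (y i) (y j)"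
      and cov: "\<And>x. \<exists>i. dist x (y i) < \<rho>"
      using separated_net[OF hom inf \<rho>] by metis
    \<comment> \<open>Making the covering balls disjoint leaves each block within \<rho> of its net
      point, so the decay hypothesis for balls applies to blocks.\<close>
    define Q where "Q = disjointed (\<lambda>i. ball (y i) \<rho>)"
    have Qb: "Q i \<subseteq> ball (y i) \<rho>" for i unfolding Q_def by (rule disjointed_subset)
    interpret countable_partition M Q
    proof
      show "Q i \<in> sets M" for i
        using sets.range_disjointed_sets[of "\<lambda>i. ball (y i) \<rho>" M] ball unfolding Q_def by auto
      show "disjoint_family Q" unfolding Q_def by (rule disjoint_family_disjointed)
      show "(\<Union>i. Q i) = space M"
        unfolding Q_def UN_disjointed_eq space using cov by (auto simp: dist_commute)
    qed
    define u where "u i j = 1 + dist (y i) (y j) / \<rho>" for i j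
    have u1: "1 \<le> u i j" for i j using \<rho> by (simp add: u_def)
    let ?ad = "\<lambda>k. (commutator d ^^ k) T"
    have "\<exists>c. bounded_op M c (?ad k)" for k
      by (induction k) (use T in \<open>auto intro: bounded_op_commutator\<close>)
    then obtain c where adb: "\<And>k. bounded_op M (c k) (?ad k)" by metis
    have blk: "L2_norm M (cutoff (Q i) (?ad k (cutoff (Q j) f)))
        \<le> (2 * u i j) ^ k * (P * u i j powr (- n - \<kappa>)) * L2_norm M (cutoff (Q j) f)" if "f \<in> L2 M" for i j k f
      using that
    proof (induction k arbitrary: f)
      case 0
      have Qf: "cutoff (Q j) f \<in> L2 M" by (intro L2_cutoff 0 Q_sets)
      have TQf: "T (cutoff (Q j) f) \<in> L2 M" by (intro bounded_op_L2[OF T] Qf)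
      have "cutoff (ball (y j) \<rho>) (cutoff (Q j) f) = cutoff (Q j) f"
        using Qb[of j] by (auto simp: cutoff_apply fun_eq_iff split: split_indicator)
      then have "L2_norm M (cutoff (ball (y i) \<rho>) (T (cutoff (Q j) f)))
          \<le> P * u i j powr (- n - \<kappa>) * L2_norm M (cutoff (Q j) f)"
        using dec[OF Qf, of "y i" "y j"] by (simp add: u_def)
      moreover have "L2_norm M (cutoff (Q i) (T (cutoff (Q j) f))) \<le> L2_norm M (cutoff (ball (y i) \<rho>) (T (cutoff (Q j) f)))"
        using Qb[of i]
        by (intro L2_norm_mono L2_cutoff TQf Q_sets ball) (auto simp: cutoff_def indicator_def intro!: AE_I2)
      ultimately show ?case by simp
    next
      case (Suc k)
      have "L2_norm M (cutoff (Q i) (commutator d (?ad k) (cutoff (Q j) f)))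
          \<le> 2 * u i j * ((2 * u i j) ^ k * (P * u i j powr (- n - \<kappa>))) * L2_norm M (cutoff (Q j) f)"
      proof (rule commutator_block[OF adb Q_sets Q_sets Suc.prems, where a = "d (y j)"])
        fix x
        show "\<bar>d x - d (y j)\<bar> \<le> u i j" if "x \<in> Q i"
        proof -
          have "dist x (y j) \<le> \<rho> + dist (y i) (y j)"
            using that Qb[of i] dist_triangle[of x "y j" "y i"] by (auto simp: dist_commute)
          then have "dist x (y j) / \<rho> \<le> u i j" using \<rho> by (simp add: u_def field_simps)
          with lip[of x "y j"] show ?thesis by simp
        qed
        show "\<bar>d x - d (y j)\<bar> \<le> 1" if "x \<in> Q j"
        proof -
          have "dist x (y j) / \<rho> \<le> 1" using that Qb[of j] \<rho> by (auto simp: dist_commute field_simps)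
          with lip[of x "y j"] show ?thesis by simp
        qed
      qed (use u1[of i j] P Suc.IH in auto)
      then show ?case by (simp add: mult.assoc)
    qed
    show "commutator_bound M d K 1 (max 1 G) T"
    proof (rule commutator_bound_if_iterates)
      fix k assume k: "k \<le> K"
      define b where "b i j = 2 ^ K * P * u i j powr (- n - e)" for i j
      have b0: "0 \<le> b i j" for i j using P by (simp add: b_def)
      have "bounded_op M (max 1 G ^ k) (?ad k)"
      proof (cases "k = 0")
        case False
        have sums: "(\<Sum>j<N. b i j) \<le> G" for i N
        proof -
          have "(\<Sum>j<N. b i j) = 2 ^ K * P * (\<Sum>j<N. u i j powr (- n - e))"
            by (simp add: b_def sum_distrib_left)
          also have "\<dots> \<le> G" unfolding G_def u_def using P
            by (intro mult_left_mono H \<rho> sep) auto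
          finally show ?thesis .
        qed
        have sym: "b i j = b j i" for i j by (simp add: b_def u_def dist_commute)
        have "(\<Sum>i<N. b i j) \<le> G" for j N using sums[of j N] by (subst sym)
        moreover have "L2_norm M (cutoff (Q i) (?ad k (cutoff (Q j) f))) \<le> b i j * L2_norm M (cutoff (Q j) f)"
          if "f \<in> L2 M" for f i j
        proof -
          have "(2 * u i j) ^ k * (P * u i j powr (- n - \<kappa>)) \<le> (2 * u i j) ^ K * (P * u i j powr (- n - \<kappa>))"
            using u1[of i j] P k by (intro mult_right_mono power_increasing) auto
          also have "\<dots> = 2 ^ K * P * (u i j powr real K * u i j powr (- n - \<kappa>))"
            using u1[of i j] by (simp add: power_mult_distrib powr_realpow ac_simps)
          also have "\<dots> = b i j" by (simp add: b_def e_def powr_add[symmetric] algebra_simps)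
          finally show ?thesis
            using blk[OF that, of i k j] by (meson L2_norm_nonneg mult_right_mono order_trans)
        qed
        ultimately have "bounded_op M G (?ad k)"
          using sums H0 P by (intro Schur_test[OF adb b0]) (auto simp: G_def)
        moreover have "G \<le> max 1 G ^ k"
          using power_increasing[of 1 k "max 1 G"] False by simp
        ultimately show ?thesis by (rule bounded_op_mono)
      qed (use T in simp)
      then show "bounded_op M (1 * max 1 G ^ k) (?ad k)" by simp
    qed
  qed simp
qed

section \<open>Functions with bounded derivatives\<close>

text \<open>One \<open>B\<close> serves all orders, and derivatives are supplied as witnesses. Each
  calculus rule thus becomes an induction with a single differentiation per step.\<close>

primrec deriv_bound :: "nat \<Rightarrow> real \<Rightarrow> (real \<Rightarrow> complex) \<Rightarrow> bool" where
  "deriv_bound 0 B f \<longleftrightarrow> (\<forall>x. cmod (f x) \<le> B)"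
| "deriv_bound (Suc k) B f \<longleftrightarrow> (\<forall>x. cmod (f x) \<le> B) \<and>
     (\<exists>f'. (\<forall>x. (f has_vector_derivative f' x) (at x)) \<and> deriv_bound k B f')"

lemma deriv_bound_le: "deriv_bound k B f \<Longrightarrow> cmod (f x) \<le> B"
  by (cases k) auto

lemma deriv_bound_nonneg: "deriv_bound k B f \<Longrightarrow> 0 \<le> B"
  using deriv_bound_le[of k B f 0] norm_ge_zero order_trans by blast

lemma deriv_bound_mono: "deriv_bound k B f \<Longrightarrow> B \<le> B' \<Longrightarrow> deriv_bound k B' f"
  by (induction k arbitrary: f) (auto intro: order_trans)

lemma deriv_bound_SucI:
  "(\<And>x. cmod (f x) \<le> B) \<Longrightarrow> (\<And>x. (f has_vector_derivative f' x) (at x)) \<Longrightarrow> deriv_bound k B f' \<Longrightarrow>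
    deriv_bound (Suc k) B f"
  by auto

lemma deriv_bound_SucE:
  assumes "deriv_bound (Suc k) B f"
  obtains f' where "\<And>x. (f has_vector_derivative f' x) (at x)" "deriv_bound k B f'"
  using assms by auto

lemma deriv_bound_SucD: "deriv_bound (Suc k) B f \<Longrightarrow> deriv_bound k B f"
proof (induction k arbitrary: f)
  case (Suc k)
  from Suc.prems obtain f' where f': "\<And>x. (f has_vector_derivative f' x) (at x)" "deriv_bound (Suc k) B f'"
    by (rule deriv_bound_SucE) blast
  show ?case by (intro deriv_bound_SucI[OF deriv_bound_le[OF Suc.prems] f'(1)] Suc.IH f'(2))
qed simp

lemma deriv_bound_continuous: "deriv_bound (Suc k) B f \<Longrightarrow> continuous_on UNIV f"
  by (auto intro!: continuous_at_imp_continuous_on dest: has_vector_derivative_continuous)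

lemma deriv_bound_plus:
  "deriv_bound k B f \<Longrightarrow> deriv_bound k B' g \<Longrightarrow> deriv_bound k (B + B') (\<lambda>x. f x + g x)"
proof (induction k arbitrary: f g)
  case (Suc k)
  then obtain f' g' where *: "\<And>x. (f has_vector_derivative f' x) (at x)" "deriv_bound k B f'"
      "\<And>x. (g has_vector_derivative g' x) (at x)" "deriv_bound k B' g'"
    by auto
  then have "((\<lambda>x. f x + g x) has_vector_derivative (f' x + g' x)) (at x)" for x
    by (intro has_vector_derivative_add)
  then show ?case
    using deriv_bound_le[OF Suc.prems(1)] deriv_bound_le[OF Suc.prems(2)]
    by (intro deriv_bound_SucI[of _ _ "\<lambda>x. f' x + g' x"] norm_triangle_le add_mono Suc.IH *) auto
qed (auto intro: norm_triangle_le add_mono)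

text \<open>The product rule doubles the number of terms at each order, whence the factor
  2^k.\<close>

lemma deriv_bound_times:
  "deriv_bound k B f \<Longrightarrow> deriv_bound k B' g \<Longrightarrow> deriv_bound k (2 ^ k * (B * B')) (\<lambda>x. f x * g x)"
proof (induction k arbitrary: f g)
  case 0
  then have "0 \<le> B" using deriv_bound_nonneg by blast
  with 0 show ?case by (auto simp: norm_mult intro: mult_mono)
next
  case (Suc k)
  from Suc.prems obtain f' g' where *: "\<And>x. (f has_vector_derivative f' x) (at x)" "deriv_bound k B f'"
      "\<And>x. (g has_vector_derivative g' x) (at x)" "deriv_bound k B' g'"
    by auto
  have nn: "0 \<le> B" "0 \<le> B'" using Suc.prems deriv_bound_nonneg by blast+
  have "((\<lambda>x. f x * g x) has_vector_derivative (f x * g' x + f' x * g x)) (at x)" for x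
    using * by (intro has_vector_derivative_mult)
  moreover have "deriv_bound k (2 ^ k * (B * B') + 2 ^ k * (B * B')) (\<lambda>x. f x * g' x + f' x * g x)"
    by (intro deriv_bound_plus Suc.IH * Suc.prems[THEN deriv_bound_SucD])
  moreover have "cmod (f x * g x) \<le> 2 * 2 ^ k * (B * B')" for x
  proof -
    have "cmod (f x * g x) \<le> 1 * (B * B')"
      using deriv_bound_le[OF Suc.prems(1)] deriv_bound_le[OF Suc.prems(2)] nn
      by (simp add: norm_mult mult_mono)
    also have "\<dots> \<le> 2 ^ Suc k * (B * B')"
      using nn by (intro mult_right_mono one_le_power) auto
    finally show ?thesis by simp
  qed
  ultimately show ?case by (intro deriv_bound_SucI[of _ _ "\<lambda>x. f x * g' x + f' x * g x"]) (auto simp: mult_ac)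
qed

lemma deriv_bound_scale: "deriv_bound k B f \<Longrightarrow> deriv_bound k (cmod a * B) (\<lambda>x. a * f x)"
proof (induction k arbitrary: f)
  case (Suc k)
  then obtain f' where *: "\<And>x. (f has_vector_derivative f' x) (at x)" "deriv_bound k B f'"
    by auto
  then have "((\<lambda>x. a * f x) has_vector_derivative (a * f' x)) (at x)" for x
    by (intro has_vector_derivative_mult_right)
  then show ?case
    using deriv_bound_le[OF Suc.prems(1)]
    by (intro deriv_bound_SucI[of _ _ "\<lambda>x. a * f' x"] Suc.IH *) (auto simp: norm_mult intro: mult_left_mono)
qed (auto simp: norm_mult intro: mult_left_mono)

text \<open>Since \<open>c\<close> dominates both 1 and |a|, the single power c^k covers every order
  up to k.\<close>

lemma deriv_bound_affine:
  "deriv_bound k B f \<Longrightarrow> \<bar>a\<bar> \<le> c \<Longrightarrow> 1 \<le> c \<Longrightarrow> deriv_bound k (c ^ k * B) (\<lambda>x. f (a * x + b))"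
proof (induction k arbitrary: f)
  case (Suc k)
  then obtain f' where *: "\<And>x. (f has_vector_derivative f' x) (at x)" "deriv_bound k B f'"
    by auto
  have B: "0 \<le> B" using Suc.prems(1) by (rule deriv_bound_nonneg)
  have "((\<lambda>x. f (a * x + b)) has_vector_derivative (a *\<^sub>R f' (a * x + b))) (at x)" for x
  proof -
    have "((\<lambda>x. a * x + b) has_real_derivative a) (at x)" by (auto intro!: derivative_eq_intros)
    then have "((\<lambda>x. a * x + b) has_vector_derivative a) (at x)"
      by (simp add: has_real_derivative_iff_has_vector_derivative)
    from vector_diff_chain_at[OF this *(1)] show ?thesis by (simp add: o_def)
  qed
  then have d: "((\<lambda>x. f (a * x + b)) has_vector_derivative (complex_of_real a * f' (a * x + b))) (at x)" for x
    by (simp add: scaleR_conv_of_real)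
  have "deriv_bound k (cmod (complex_of_real a) * (c ^ k * B)) (\<lambda>x. complex_of_real a * f' (a * x + b))"
    by (intro deriv_bound_scale Suc.IH * Suc.prems)
  then have "deriv_bound k (c ^ Suc k * B) (\<lambda>x. complex_of_real a * f' (a * x + b))"
  proof (rule deriv_bound_mono)
    show "cmod (complex_of_real a) * (c ^ k * B) \<le> c ^ Suc k * B"
      using Suc.prems B by (simp add: mult.assoc mult_right_mono)
  qed
  moreover have "cmod (f (a * x + b)) \<le> c ^ Suc k * B" for x
  proof -
    have "cmod (f (a * x + b)) \<le> 1 * B" using deriv_bound_le[OF Suc.prems(1)] by simp
    also have "\<dots> \<le> c ^ Suc k * B" using B one_le_power[OF \<open>1 \<le> c\<close>] by (intro mult_right_mono)
    finally show ?thesis .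
  qed
  ultimately show ?case by (intro deriv_bound_SucI[OF _ d])
qed auto

text \<open>A derivative multiplies the coefficient by i\<theta>, whose modulus is at most 1, so the
  same bound returns at every order.\<close>

lemma deriv_bound_cis: "cmod c \<le> B \<Longrightarrow> \<bar>\<theta>\<bar> \<le> 1 \<Longrightarrow> deriv_bound k B (\<lambda>x. c * cis (\<theta> * x))"
proof (induction k arbitrary: c)
  case (Suc k)
  have "((\<lambda>x. c * cis (\<theta> * x)) has_vector_derivative ((c * (\<i> * \<theta>)) * cis (\<theta> * x))) (at x)" for x
  proof -
    have "((\<lambda>x. c * exp (\<i> * \<theta> * x)) has_vector_derivative (c * (\<i> * \<theta> * exp (\<i> * \<theta> * x)))) (at x)"
      by (auto intro!: derivative_eq_intros has_vector_derivative_real_field)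
    then show ?thesis by (simp add: cis_conv_exp mult_ac)
  qed
  moreover have "cmod (c * (\<i> * \<theta>)) \<le> B"
    using Suc.prems mult_mono[of "cmod c" B "\<bar>\<theta>\<bar>" 1] order_trans[OF norm_ge_zero Suc.prems(1)]
    by (simp add: norm_mult)
  ultimately show ?case
    using Suc.prems
    by (intro deriv_bound_SucI[of _ _ "\<lambda>x. (c * (\<i> * \<theta>)) * cis (\<theta> * x)"] Suc.IH) (auto simp: norm_mult)
qed (auto simp: norm_mult)

section \<open>Cutoff functions and the logarithmic change of variable\<close>

lemma smooth_step:
  "\<exists>B g. deriv_bound k B (\<lambda>x. complex_of_real (g x)) \<and> continuous_on UNIV g \<and>
     (\<forall>x. 0 \<le> g x \<and> g x \<le> 1) \<and> (\<forall>x\<le>0. g x = 0) \<and> (\<forall>x\<ge>1. g x = 1)"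
proof (induction k)
  case 0
  show ?case
    by (intro exI[of _ 1] exI[of _ "\<lambda>x. max 0 (min 1 x)"]) (auto intro!: continuous_intros)
next
  case (Suc k)
  then obtain B g where g: "deriv_bound k B (\<lambda>x. complex_of_real (g x))" "continuous_on UNIV g"
      "\<And>x. 0 \<le> g x" "\<And>x. g x \<le> 1" "\<And>x. x \<le> 0 \<Longrightarrow> g x = 0" "\<And>x. 1 \<le> x \<Longrightarrow> g x = 1"
    by auto
  have "\<exists>F. \<forall>x. - \<infinity> < ereal x \<longrightarrow> ereal x < \<infinity> \<longrightarrow> (F has_vector_derivative g x) (at x)"
    using g(2) by (intro einterval_antiderivative) (auto simp: continuous_on_eq_continuous_at)
  then obtain F where F: "\<And>x. (F has_real_derivative g x) (at x)"
    by (auto simp: has_real_derivative_iff_has_vector_derivative)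
  \<comment> \<open>The mean of \<open>g\<close> over the unit interval from 2y - 1 to 2y is one
    derivative smoother. That interval lies left of 0 for y <= 0 and right of 1 for y >= 1, so the
    prescribed values persist.\<close>
  define h where "h y = F (2 * y) - F (2 * y - 1)" for y
  have mvt: "\<exists>z. 2 * y - 1 < z \<and> z < 2 * y \<and> h y = g z" for y
    using MVT2[of "2 * y - 1" "2 * y" F g] F by (auto simp: h_def)
  have h01: "0 \<le> h y" "h y \<le> 1" for y using mvt[of y] g by auto
  have h': "(h has_real_derivative (2 * g (2 * y) - 2 * g (2 * y - 1))) (at y)" for y
    unfolding h_def by (auto intro!: derivative_eq_intros DERIV_chain2[OF F])
  have "((\<lambda>x. complex_of_real (h x)) has_vector_derivative
      (2 * complex_of_real (g (2 * y + 0)) + (-2) * complex_of_real (g (2 * y + (-1))))) (at y)" for y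
    using has_vector_derivative_of_real[OF h'[of y], where ?'a = complex] by simp
  moreover have "deriv_bound k (cmod 2 * (2 ^ k * B) + cmod (-2) * (2 ^ k * B))
      (\<lambda>y. 2 * complex_of_real (g (2 * y + 0)) + (-2) * complex_of_real (g (2 * y + (-1))))"
    by (intro deriv_bound_plus deriv_bound_scale deriv_bound_affine[of _ _ "\<lambda>x. complex_of_real (g x)"] g) auto
  moreover have "cmod (complex_of_real (h y)) \<le> 1" for y using h01[of y] by simp
  ultimately have "deriv_bound (Suc k) (max 1 (cmod 2 * (2 ^ k * B) + cmod (-2) * (2 ^ k * B)))
      (\<lambda>x. complex_of_real (h x))"
    by (intro deriv_bound_SucI[of _ _ "\<lambda>y. 2 * complex_of_real (g (2 * y + 0)) + (-2) * complex_of_real (g (2 * y + (-1)))"])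
       (auto intro: deriv_bound_mono simp: le_max_iff_disj)
  moreover have "continuous_on UNIV h"
    using h' by (auto intro!: continuous_at_imp_continuous_on DERIV_isCont)
  moreover have "h y = 0" if "y \<le> 0" for y using mvt[of y] g(5) that by force
  moreover have "h y = 1" if "1 \<le> y" for y using mvt[of y] g(6) that by force
  ultimately show ?case using h01 by blast
qed

text \<open>The product of a step that rises on [-2,-1] and one that falls on [1,2].\<close>

lemma smooth_cutoff:
  obtains B \<psi> where "deriv_bound k B (\<lambda>x. complex_of_real (\<psi> x))"
    "\<And>x. 0 \<le> \<psi> x" "\<And>x. \<psi> x \<le> 1" "\<And>x. \<bar>x\<bar> \<le> 1 \<Longrightarrow> \<psi> x = 1" "\<And>x. 2 \<le> \<bar>x\<bar> \<Longrightarrow> \<psi> x = 0"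
proof -
  obtain B g where g: "deriv_bound k B (\<lambda>x. complex_of_real (g x))"
      "\<And>x. 0 \<le> g x" "\<And>x. g x \<le> 1" "\<And>x. x \<le> 0 \<Longrightarrow> g x = 0" "\<And>x. 1 \<le> x \<Longrightarrow> g x = 1"
    using smooth_step by blast
  have "deriv_bound k (2 ^ k * ((1 ^ k * B) * (1 ^ k * B)))
      (\<lambda>x. complex_of_real (g (1 * x + 2)) * complex_of_real (g ((-1) * x + 2)))"
    by (intro deriv_bound_times deriv_bound_affine[of _ _ "\<lambda>x. complex_of_real (g x)"] g) auto
  then show thesis
    using g by (intro that[of _ "\<lambda>x. g (1 * x + 2) * g ((-1) * x + 2)"]) (auto simp: abs_if mult_le_one split: if_splits)
qed

text \<open>The factor u^(-i) closes the induction: the derivative of u^(-i) f(-ln u) is u^(-i-1)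
  g(-ln u) with g = -i f - f'. The support of f keeps u above exp(-2), where negative powers of u
  are bounded.\<close>

lemma deriv_bound_log:
  "\<exists>C\<ge>0. \<forall>B f. deriv_bound k B f \<longrightarrow> (\<forall>s. 2 < \<bar>s\<bar> \<longrightarrow> f s = 0) \<longrightarrow>
     deriv_bound k (C * B) (\<lambda>u. if 0 < u then complex_of_real (1 / u ^ i) * f (- ln u) else 0)"
proof (induction k arbitrary: i)
  have small: "f (- ln u) = 0" if "u < exp (- 2)" "0 < u" "\<forall>s. 2 < \<bar>s\<bar> \<longrightarrow> f s = (0::complex)" for u :: real and f
  proof -
    have "ln u < ln (exp (- 2))" using that by (intro iffD2[OF ln_less_cancel_iff]) auto
    then show ?thesis using that(3) by simp
  qed
  have bd: "cmod (if 0 < u then complex_of_real (1 / u ^ i) * f (- ln u) else 0) \<le> exp 2 ^ i * B"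
    if f: "\<And>s. cmod (f s) \<le> B" "\<forall>s. 2 < \<bar>s\<bar> \<longrightarrow> f s = 0" for u i B f
  proof -
    have B: "0 \<le> B" using f(1) norm_ge_zero order_trans by blast
    show ?thesis
    proof (cases "exp (- 2) \<le> u")
      case True
      have u: "0 < u" using True exp_gt_zero[of "- 2 :: real"] by linarith
      have "1 / u \<le> exp 2" using True u by (simp add: exp_minus field_simps)
      then have "(1 / u) ^ i \<le> exp 2 ^ i" using u by (intro power_mono) auto
      then have "(1 / u) ^ i * cmod (f (- ln u)) \<le> exp 2 ^ i * B" using f(1) by (intro mult_mono) auto
      then show ?thesis using u by (simp add: norm_mult norm_divide norm_power power_one_over)
    qed (use B small[of u f] f in auto)
  qed
  {
    case 0
    show ?case
    proof (intro exI[of _ "exp 2 ^ i"] conjI allI impI)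
      fix B f assume "deriv_bound 0 B f" "\<forall>s. 2 < \<bar>s\<bar> \<longrightarrow> f s = 0"
      then show "deriv_bound 0 (exp 2 ^ i * B) (\<lambda>u. if 0 < u then complex_of_real (1 / u ^ i) * f (- ln u) else 0)"
        using bd[of f B] by simp
    qed simp
  }
  case (Suc k)
  obtain C where C: "0 \<le> C" "\<And>B f. deriv_bound k B f \<Longrightarrow> \<forall>s. 2 < \<bar>s\<bar> \<longrightarrow> f s = 0 \<Longrightarrow>
      deriv_bound k (C * B) (\<lambda>u. if 0 < u then complex_of_real (1 / u ^ Suc i) * f (- ln u) else 0)"
    using Suc[of "Suc i"] by blast
  show ?case
  proof (intro exI[of _ "max (exp 2 ^ i) (C * (real i + 1))"] conjI allI impI)
    fix B f assume f: "deriv_bound (Suc k) B f" and f0: "\<forall>s. 2 < \<bar>s\<bar> \<longrightarrow> f s = 0"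
    have B: "0 \<le> B" using f by (rule deriv_bound_nonneg)
    obtain f' where f': "\<And>x. (f has_vector_derivative f' x) (at x)" and f'k: "deriv_bound k B f'"
      using f by auto
    \<comment> \<open>Outside [-2,2] the function vanishes on an open set, so its derivative does
      too and the induction hypothesis applies to \<open>g\<close>.\<close>
    have f'0: "f' s = 0" if "2 < \<bar>s\<bar>" for s
    proof (rule vector_derivative_unique_at[OF f'])
      have "open {s :: real. 2 < \<bar>s\<bar>}" by (intro open_Collect_less continuous_intros)
      then show "(f has_vector_derivative 0) (at s)"
        using that f0
        by (intro has_vector_derivative_transform_within_open[of "\<lambda>s. 0" 0 s "{s. 2 < \<bar>s\<bar>}" f]) auto
    qed
    define g where "g s = - (complex_of_real (real i) * f s) + (-1) * f' s" for s
    have gk: "deriv_bound k ((real i + 1) * B) g"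
    proof -
      have "deriv_bound k (cmod (- complex_of_real (real i)) * B + cmod (-1) * B)
          (\<lambda>s. (- complex_of_real (real i)) * f s + (-1) * f' s)"
        by (intro deriv_bound_plus deriv_bound_scale f'k deriv_bound_SucD[OF f])
      then show ?thesis by (simp add: g_def[abs_def] algebra_simps)
    qed
    have g0: "\<forall>s. 2 < \<bar>s\<bar> \<longrightarrow> g s = 0" using f0 f'0 by (simp add: g_def)
    let ?h = "\<lambda>u. if 0 < u then complex_of_real (1 / u ^ i) * f (- ln u) else 0"
    let ?h' = "\<lambda>u. if 0 < u then complex_of_real (1 / u ^ Suc i) * g (- ln u) else 0"
    have "(?h has_vector_derivative ?h' u) (at u)" for u
    proof (cases "0 < u")
      case True
      have l: "((\<lambda>u. - ln u) has_vector_derivative (- (1 / u))) (at u)"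
        using True by (auto intro!: derivative_eq_intros simp flip: has_real_derivative_iff_has_vector_derivative)
      have "((\<lambda>u. f (- ln u)) has_vector_derivative ((- (1 / u)) *\<^sub>R f' (- ln u))) (at u)"
        using vector_diff_chain_at[OF l f'[of "- ln u"]] by (simp add: o_def)
      moreover have "((\<lambda>u. 1 / u ^ i) has_real_derivative (- (real i / u ^ Suc i))) (at u)"
      proof (cases i)
        case (Suc i')
        have "((\<lambda>u. 1 / u ^ Suc i') has_real_derivative
            (0 * u ^ Suc i' - 1 * (real (Suc i') * u ^ i')) / (u ^ Suc i' * u ^ Suc i')) (at u)"
          using DERIV_pow[of "Suc i'" u] True by (intro DERIV_divide DERIV_const) auto
        also have "(0 * u ^ Suc i' - 1 * (real (Suc i') * u ^ i')) / (u ^ Suc i' * u ^ Suc i')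
            = - (real i / u ^ Suc i)"
          using True Suc by (simp add: field_simps)
        finally show ?thesis using Suc by simp
      qed simp
      then have "((\<lambda>u. complex_of_real (1 / u ^ i)) has_vector_derivative complex_of_real (- (real i / u ^ Suc i))) (at u)"
        by (rule has_vector_derivative_of_real)
      ultimately have "((\<lambda>u. complex_of_real (1 / u ^ i) * f (- ln u)) has_vector_derivative
          (complex_of_real (1 / u ^ i) * ((- (1 / u)) *\<^sub>R f' (- ln u)) +
           complex_of_real (- (real i / u ^ Suc i)) * f (- ln u))) (at u)"
        by (intro has_vector_derivative_mult)
      also have "complex_of_real (1 / u ^ i) * ((- (1 / u)) *\<^sub>R f' (- ln u)) +
           complex_of_real (- (real i / u ^ Suc i)) * f (- ln u) = ?h' u"
        using True by (simp add: g_def scaleR_conv_of_real field_simps)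
      finally show ?thesis
        by (rule has_vector_derivative_transform_within_open[where S = "{0<..}"]) (use True in auto)
    next
      case False
      \<comment> \<open>The function vanishes identically to the left of exp(-2), so the case
        distinction at 0 does no harm to smoothness.\<close>
      have "(?h has_vector_derivative 0) (at u)"
        by (rule has_vector_derivative_transform_within_open[where S = "{..<exp (- 2)}" and f = "\<lambda>_. 0"])
           (use False small[of _ f] f0 in \<open>auto intro: le_less_trans[of _ 0]\<close>)
      then show ?thesis using False by simp
    qed
    moreover have "deriv_bound k (max (exp 2 ^ i) (C * (real i + 1)) * B) ?h'"
    proof (rule deriv_bound_mono[OF C(2)[OF gk g0]])
      show "C * ((real i + 1) * B) \<le> max (exp 2 ^ i) (C * (real i + 1)) * B"
        using B by (simp only: mult.assoc[symmetric]) (intro mult_right_mono, auto)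
    qed
    moreover have "cmod (?h u) \<le> max (exp 2 ^ i) (C * (real i + 1)) * B" for u
      by (rule order_trans[OF bd[OF deriv_bound_le[OF f] f0]]) (intro mult_right_mono B max.cobounded1)
    ultimately show "deriv_bound (Suc k) (max (exp 2 ^ i) (C * (real i + 1)) * B) ?h"
      by (intro deriv_bound_SucI[of ?h _ ?h'])
  qed (simp add: le_max_iff_disj)
qed

section \<open>Discrete Fourier interpolation\<close>

definition fdiff :: "real \<Rightarrow> (real \<Rightarrow> complex) \<Rightarrow> real \<Rightarrow> complex" where
  "fdiff \<eta> f = (\<lambda>x. f (x + \<eta>) - f x)"

text \<open>Differences commute with differentiation, which allows one mean value inequality for
  each order of the difference.\<close>

lemma fdiff_iterate_derivative:
  "(\<And>x. (f has_vector_derivative f' x) (at x)) \<Longrightarrow>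
    ((fdiff \<eta> ^^ k) f has_vector_derivative (fdiff \<eta> ^^ k) f' x) (at x)"
proof (induction k arbitrary: x)
  case (Suc k)
  have "((\<lambda>x. (fdiff \<eta> ^^ k) f (x + \<eta>)) has_vector_derivative (fdiff \<eta> ^^ k) f' (x + \<eta>)) (at x)"
  proof -
    have "((\<lambda>x. x + \<eta>) has_real_derivative 1) (at x)" by (auto intro!: derivative_eq_intros)
    then have "((\<lambda>x. x + \<eta>) has_vector_derivative 1) (at x)"
      by (simp add: has_real_derivative_iff_has_vector_derivative)
    from vector_diff_chain_at[OF this Suc.IH[OF Suc.prems]] show ?thesis by (simp add: o_def)
  qed
  then show ?case
    unfolding funpow.simps o_apply fdiff_def[of _ "(fdiff \<eta> ^^ k) f"] fdiff_def[of _ "(fdiff \<eta> ^^ k) f'"]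
    by (intro has_vector_derivative_diff Suc.IH Suc.prems)
qed auto

lemma norm_diff_le_if_derivative_le:
  assumes "\<And>x. (f has_vector_derivative f' x) (at x)" "\<And>x. norm (f' x) \<le> B"
  shows "norm (f y - f x) \<le> B * \<bar>y - x\<bar>"
proof -
  have "norm (f y - f x) \<le> B * norm (y - x)"
  proof (rule differentiable_bound[of UNIV f "\<lambda>x h. h *\<^sub>R f' x"])
    fix x
    show "(f has_derivative (\<lambda>h. h *\<^sub>R f' x)) (at x within UNIV)"
      using assms(1)[of x] by (simp add: has_vector_derivative_def)
    show "onorm (\<lambda>h. h *\<^sub>R f' x) \<le> B"
      by (rule onorm_le) (use mult_right_mono[OF assms(2)[of x] abs_ge_zero] in \<open>simp add: mult.commute[of "norm (f' x)"]\<close>)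
  qed auto
  then show ?thesis by simp
qed

lemma fdiff_iterate_le:
  "deriv_bound k B f \<Longrightarrow> 0 \<le> \<eta> \<Longrightarrow> cmod ((fdiff \<eta> ^^ k) f x) \<le> B * \<eta> ^ k"
proof (induction k arbitrary: f x)
  case (Suc k)
  then obtain f' where f': "\<And>x. (f has_vector_derivative f' x) (at x)" "deriv_bound k B f'" by auto
  have "cmod ((fdiff \<eta> ^^ k) f (x + \<eta>) - (fdiff \<eta> ^^ k) f x) \<le> B * \<eta> ^ k * \<bar>x + \<eta> - x\<bar>"
    by (intro norm_diff_le_if_derivative_le[OF fdiff_iterate_derivative[OF f'(1)]] Suc.IH f' Suc.prems)
  then show ?case using Suc.prems(2) by (simp add: fdiff_def[of _ "(fdiff \<eta> ^^ k) f"] mult_ac)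
qed auto

text \<open>Forward differences look ahead by at most \<open>q * \<eta>\<close>, so only the left
  margin of the zero set shrinks.\<close>

lemma fdiff_iterate_eq_0:
  assumes "\<And>x. x \<le> a \<Longrightarrow> h x = 0" "\<And>x. b \<le> x \<Longrightarrow> h x = 0" "0 \<le> \<eta>"
  shows "x \<le> a - real q * \<eta> \<or> b \<le> x \<Longrightarrow> (fdiff \<eta> ^^ q) h x = 0"
proof (induction q arbitrary: x)
  case (Suc q)
  have "(fdiff \<eta> ^^ q) h (x + \<eta>) = 0" "(fdiff \<eta> ^^ q) h x = 0"
    using Suc.prems \<open>0 \<le> \<eta>\<close> by (auto intro!: Suc.IH simp: algebra_simps)
  then show ?case by (simp add: fdiff_def[of _ "(fdiff \<eta> ^^ q) h"])
qed (use assms in auto)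

lemma cmod_cis_minus_1: "cmod (cis t - 1) = 2 * \<bar>sin (t / 2)\<bar>"
  using dist_exp_i_1[of t] by (simp add: cis_conv_exp)

lemma cmod_cis_diff_le: "cmod (cis s - cis t) \<le> \<bar>s - t\<bar>"
proof -
  have "cis s - cis t = cis t * (cis (s - t) - 1)" by (simp add: right_diff_distrib cis_mult)
  then have "cmod (cis s - cis t) = 2 * \<bar>sin ((s - t) / 2)\<bar>"
    by (simp add: norm_mult cmod_cis_minus_1)
  also have "\<dots> \<le> 2 * \<bar>(s - t) / 2\<bar>" by (intro mult_left_mono abs_sin_x_le_abs_x) simp
  finally show ?thesis by simp
qed

text \<open>A crude form of Jordan's inequality. Up to pi/6 the derivative of the sine is at least
  1/2; beyond, the sine itself is at least 1/2, while x/4 is at most 1/2.\<close>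

lemma sin_ge_quarter:
  assumes "0 \<le> x" "x \<le> pi / 2"
  shows "x / 4 \<le> sin x"
proof (cases "x \<le> pi / 6")
  case True
  show ?thesis
  proof (cases "x = 0")
    case False
    then have "0 < x" using assms by simp
    then obtain z where z: "0 < z" "z < x" "sin x - sin 0 = (x - 0) * cos z"
      using MVT2[of 0 x sin cos] DERIV_sin by blast
    have "cos (pi / 3) \<le> cos z" using z True by (intro cos_monotone_0_pi_le) auto
    then have "1 / 2 \<le> cos z" by (simp add: cos_60)
    then have "x * (1 / 2) \<le> x * cos z" using \<open>0 < x\<close> by (intro mult_left_mono) auto
    with z(3) \<open>0 < x\<close> show ?thesis by simp
  qed simp
next
  case False
  have "sin (pi / 6) \<le> sin x" using False assms by (intro sin_monotone_2pi_le) auto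
  then have "1 / 2 \<le> sin x" by (simp add: sin_30)
  moreover have "x / 4 \<le> 1 / 2" using assms pi_less_4 by simp
  ultimately show ?thesis by simp
qed

lemma cmod_cis_minus_1_ge:
  assumes "\<bar>t\<bar> \<le> pi"
  shows "\<bar>t\<bar> / 4 \<le> cmod (cis t - 1)"
proof -
  have "\<bar>t\<bar> / 2 / 4 \<le> sin (\<bar>t\<bar> / 2)" using assms by (intro sin_ge_quarter) auto
  also have "\<dots> \<le> \<bar>sin (t / 2)\<bar>" by (cases "0 \<le> t") auto
  finally show ?thesis by (simp add: cmod_cis_minus_1)
qed

text \<open>Discrete Fourier interpolation on the grid $8j/N$, $0\le j<N$, $N=2m+1$. The frequencies are the
  integers between $-m$ and $m$; the $i$-th one is $i-m$.\<close>

locale grid =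
  fixes m :: nat
begin

definition N :: nat where "N = 2 * m + 1"

definition freq :: "nat \<Rightarrow> real" where "freq i = real i - real m"

definition coef :: "(real \<Rightarrow> complex) \<Rightarrow> nat \<Rightarrow> complex" where
  "coef h i = (\<Sum>j<N. h (8 * real j / real N) * cis (- (2 * pi * freq i * real j / real N))) / of_nat N"

lemma N_pos: "0 < real N" by (simp add: N_def)

lemma freq_le: "i < N \<Longrightarrow> \<bar>freq i\<bar> \<le> real m"
  by (auto simp: N_def freq_def)

text \<open>Up to a unimodular factor due to the centring of the frequencies, this is a geometric
  sum in an N-th root of unity; |l - j| < N excludes the root 1.\<close>

lemma orthogonality:
  assumes "j < N" "l < N"
  shows "(\<Sum>i<N. cis (2 * pi * freq i * (real l - real j) / real N)) = (if j = l then of_nat N else 0)"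
proof (cases "j = l")
  case False
  define z where "z = cis (2 * pi * (real l - real j) / real N)"
  have zi: "cis (2 * pi * freq i * (real l - real j) / real N)
      = cis (- (2 * pi * real m * (real l - real j) / real N)) * z ^ i" for i
  proof -
    have "2 * pi * freq i * (real l - real j) / real N
        = - (2 * pi * real m * (real l - real j) / real N) + real i * (2 * pi * (real l - real j) / real N)"
      using N_pos by (simp add: freq_def field_simps)
    moreover have "z ^ i = cis (real i * (2 * pi * (real l - real j) / real N))"
      unfolding z_def by (rule Complex.DeMoivre)
    ultimately show ?thesis by (simp only: cis_mult)
  qed
  have "z ^ N = cis (2 * pi * (real_of_int (int l - int j)))"
    using N_pos by (simp add: z_def Complex.DeMoivre)
  then have zN: "z ^ N = 1" by (simp only: cis_multiple_2pi Ints_of_int)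
  have "z \<noteq> 1"
  proof
    assume "z = 1"
    then have "cos (2 * pi * (real l - real j) / real N) = 1" by (simp add: z_def complex_eq_iff)
    then obtain n :: int where "2 * pi * (real l - real j) / real N = of_int n * 2 * pi"
      unfolding cos_one_2pi_int by auto
    then have "2 * pi * ((real l - real j) / real N) = 2 * pi * of_int n" by simp
    then have "(real l - real j) / real N = of_int n" by (subst (asm) mult_cancel_left) simp
    then have "real l - real j = of_int n * real N" using N_pos by (simp add: field_simps)
    then have "real_of_int (int l - int j) = real_of_int (n * int N)" by simp
    then have eq: "int l - int j = n * int N" by (simp only: of_int_eq_iff)
    have "\<bar>int l - int j\<bar> < int N" using assms by auto
    then have "\<bar>n\<bar> * int N < 1 * int N" unfolding eq by (simp add: abs_mult)
    then have "\<bar>n\<bar> < 1" by (rule mult_right_less_imp_less) simp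
    then have "n = 0" by simp
    with eq False show False by simp
  qed
  then show ?thesis using False zN by (simp add: zi sum_distrib_left[symmetric] sum_gp_strict)
qed simp

lemma interpolation:
  assumes "l < N"
  shows "(\<Sum>i<N. coef h i * cis (2 * pi * freq i * real l / real N)) = h (8 * real l / real N)"
proof -
  let ?a = "\<lambda>j. h (8 * real j / real N)"
  have "(\<Sum>i<N. coef h i * cis (2 * pi * freq i * real l / real N))
      = (\<Sum>i<N. \<Sum>j<N. ?a j / of_nat N * cis (2 * pi * freq i * (real l - real j) / real N))"
    unfolding coef_def sum_divide_distrib sum_distrib_right
  proof (intro sum.cong refl)
    fix i j
    have "cis (2 * pi * freq i * (real l - real j) / real N)
        = cis (- (2 * pi * freq i * real j / real N)) * cis (2 * pi * freq i * real l / real N)"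
      unfolding cis_mult by (simp add: diff_divide_distrib right_diff_distrib)
    then show "?a j * cis (- (2 * pi * freq i * real j / real N)) / of_nat N * cis (2 * pi * freq i * real l / real N)
        = ?a j / of_nat N * cis (2 * pi * freq i * (real l - real j) / real N)"
      by simp
  qed
  also have "\<dots> = (\<Sum>j<N. ?a j / of_nat N * (\<Sum>i<N. cis (2 * pi * freq i * (real l - real j) / real N)))"
    by (subst sum.swap) (simp add: sum_distrib_left)
  also have "\<dots> = (\<Sum>j<N. if j = l then ?a j else 0)"
    using N_pos assms by (intro sum.cong refl) (auto simp: orthogonality)
  finally show ?thesis using assms by simp
qed

text \<open>The conjugated coefficient is expanded by definition, and the sum over frequencies is
  then inverted by \<open>interpolation\<close>.\<close>

lemma Parseval:
  "(\<Sum>i<N. (cmod (coef h i))\<^sup>2) = (\<Sum>j<N. (cmod (h (8 * real j / real N)))\<^sup>2) / real N"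
proof -
  let ?a = "\<lambda>j. h (8 * real j / real N)"
  have "complex_of_real (\<Sum>i<N. (cmod (coef h i))\<^sup>2) = (\<Sum>i<N. coef h i * cnj (coef h i))"
    by (simp only: of_real_sum complex_norm_square[symmetric])
  also have "\<dots> = (\<Sum>i<N. \<Sum>l<N. cnj (?a l) / of_nat N * (coef h i * cis (2 * pi * freq i * real l / real N)))"
    by (intro sum.cong refl)
       (simp add: coef_def[of h] cis_cnj sum_divide_distrib sum_distrib_left sum_distrib_right mult_ac)
  also have "\<dots> = (\<Sum>l<N. cnj (?a l) / of_nat N * (\<Sum>i<N. coef h i * cis (2 * pi * freq i * real l / real N)))"
    by (subst sum.swap) (simp add: sum_distrib_left)
  also have "\<dots> = (\<Sum>l<N. cnj (?a l) / of_nat N * ?a l)" by (simp add: interpolation)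
  also have "\<dots> = complex_of_real ((\<Sum>j<N. (cmod (?a j))\<^sup>2) / real N)"
  proof -
    have "cnj z / of_nat N * z = complex_of_real ((cmod z)\<^sup>2 / real N)" for z
      using complex_norm_square[of z] by (simp add: mult.commute)
    then show ?thesis by (simp only: sum_divide_distrib of_real_sum)
  qed
  finally show ?thesis by (simp only: of_real_eq_iff)
qed

text \<open>Differencing with one mesh width shifts the samples. As both end values vanish, the
  shift is cyclic and multiplies the coefficient by a root of unity.\<close>

lemma coef_fdiff:
  assumes "h 0 = 0" "h 8 = 0"
  shows "coef (fdiff (8 / real N) h) i = (cis (2 * pi * freq i / real N) - 1) * coef h i"
proof -
  let ?e = "\<lambda>j. cis (- (2 * pi * freq i * real j / real N))"
  let ?g = "\<lambda>j. h (8 * real j / real N) * ?e j"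
  have "(\<Sum>j<N. h (8 * real j / real N + 8 / real N) * ?e j) = (\<Sum>j<N. cis (2 * pi * freq i / real N) * ?g (Suc j))"
  proof (intro sum.cong refl)
    fix j
    have "8 * real j / real N + 8 / real N = 8 * real (Suc j) / real N"
      by (simp add: add_divide_distrib[symmetric])
    moreover have "?e j = cis (2 * pi * freq i / real N) * ?e (Suc j)"
      unfolding cis_mult by (simp add: add_divide_distrib[symmetric] diff_divide_distrib[symmetric] algebra_simps)
    ultimately show "h (8 * real j / real N + 8 / real N) * ?e j = cis (2 * pi * freq i / real N) * ?g (Suc j)"
      by (simp only: mult_ac)
  qed
  also have "\<dots> = cis (2 * pi * freq i / real N) * (\<Sum>j<N. ?g (Suc j))"
    by (simp add: sum_distrib_left)
  also have "(\<Sum>j<N. ?g (Suc j)) = (\<Sum>j<N. ?g j)"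
  proof -
    have "?g 0 = 0" "?g N = 0" using assms N_pos by auto
    moreover have "(\<Sum>j<Suc N. ?g j) = ?g 0 + (\<Sum>j<N. ?g (Suc j))" by (rule sum.lessThan_Suc_shift)
    ultimately show ?thesis by (simp add: sum.lessThan_Suc del: of_nat_Suc)
  qed
  finally show ?thesis
    by (simp add: coef_def fdiff_def left_diff_distrib sum_subtractf diff_divide_distrib)
qed

text \<open>Each intermediate difference must vanish at 0 again; the margin \<open>a\<close> on the
  left has room for \<open>q\<close> of them.\<close>

lemma coef_fdiff_iterate:
  assumes "\<And>x. x \<le> a \<Longrightarrow> h x = 0" "\<And>x. 8 \<le> x \<Longrightarrow> h x = 0" "real q * (8 / real N) \<le> a"
  shows "coef ((fdiff (8 / real N) ^^ q) h) i = (cis (2 * pi * freq i / real N) - 1) ^ q * coef h i"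
  using assms(3)
proof (induction q)
  case (Suc q)
  have "real q * (8 / real N) \<le> real (Suc q) * (8 / real N)" by (intro mult_right_mono) auto
  then have q: "real q * (8 / real N) \<le> a" using Suc.prems by linarith
  have "(fdiff (8 / real N) ^^ q) h 0 = 0" "(fdiff (8 / real N) ^^ q) h 8 = 0"
    using q by (auto intro!: fdiff_iterate_eq_0[OF assms(1,2)])
  from coef_fdiff[OF this] Suc.IH[OF q] show ?case by simp
qed simp

text \<open>The discrete counterpart of bounding |k|^p times the Fourier coefficient by the p-th
  derivative. |freq|/N is dominated by the symbol of the difference, Parseval returns to differences
  of order p, and their size (8/N)^p cancels N^p, so the bound is uniform in N.\<close>

lemma coef_weighted_le:
  assumes B: "deriv_bound p B h" and h: "\<And>x. x \<le> a \<Longrightarrow> h x = 0" "\<And>x. 8 \<le> x \<Longrightarrow> h x = 0"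
    and a: "real p * (8 / real N) \<le> a"
  shows "(\<Sum>i<N. (\<bar>freq i\<bar> ^ p * cmod (coef h i))\<^sup>2) \<le> (8 ^ p * B)\<^sup>2"
proof -
  let ?\<eta> = "8 / real N"
  have "\<bar>freq i\<bar> / real N \<le> cmod (cis (2 * pi * freq i / real N) - 1)" if "i < N" for i
  proof -
    have f: "\<bar>freq i\<bar> \<le> real m" using that by (rule freq_le)
    \<comment> \<open>Centring the frequencies keeps the angle in [-pi, pi], where |cis - 1| is
      comparable with it.\<close>
    have "\<bar>2 * pi * freq i / real N\<bar> = pi * (2 * \<bar>freq i\<bar> / real N)" using N_pos by (simp add: abs_mult)
    also have "2 * \<bar>freq i\<bar> / real N \<le> 1" using f by (simp add: N_def divide_le_eq)
    finally have "\<bar>2 * pi * freq i / real N\<bar> \<le> pi" by simp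
    then have "\<bar>2 * pi * freq i / real N\<bar> / 4 \<le> cmod (cis (2 * pi * freq i / real N) - 1)"
      by (rule cmod_cis_minus_1_ge)
    moreover have "\<bar>freq i\<bar> / real N \<le> \<bar>2 * pi * freq i / real N\<bar> / 4"
    proof -
      have "2 * \<bar>freq i\<bar> \<le> pi * \<bar>freq i\<bar>" using pi_ge_two by (intro mult_right_mono) auto
      then show ?thesis using N_pos by (simp add: abs_mult field_simps)
    qed
    ultimately show ?thesis by linarith
  qed
  then have "(\<bar>freq i\<bar> / real N) ^ p * cmod (coef h i) \<le> cmod (coef ((fdiff ?\<eta> ^^ p) h) i)" if "i < N" for i
    using that N_pos
    by (subst coef_fdiff_iterate[OF h a]) (simp_all add: norm_mult norm_power mult_right_mono power_mono)
  then have "(\<Sum>i<N. ((\<bar>freq i\<bar> / real N) ^ p * cmod (coef h i))\<^sup>2)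
      \<le> (\<Sum>i<N. (cmod (coef ((fdiff ?\<eta> ^^ p) h) i))\<^sup>2)"
    using N_pos by (intro sum_mono power_mono) auto
  also have "\<dots> = (\<Sum>j<N. (cmod ((fdiff ?\<eta> ^^ p) h (8 * real j / real N)))\<^sup>2) / real N"
    by (rule Parseval)
  also have "\<dots> \<le> (\<Sum>j<N. (B * ?\<eta> ^ p)\<^sup>2) / real N"
    using N_pos by (intro divide_right_mono sum_mono power_mono fdiff_iterate_le[OF B]) auto
  also have "\<dots> = (B * ?\<eta> ^ p)\<^sup>2" using N_pos by simp
  finally have "real N ^ (2 * p) * (\<Sum>i<N. ((\<bar>freq i\<bar> / real N) ^ p * cmod (coef h i))\<^sup>2)
      \<le> real N ^ (2 * p) * (B * ?\<eta> ^ p)\<^sup>2"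
    by (intro mult_left_mono) auto
  also have "real N ^ (2 * p) * (B * ?\<eta> ^ p)\<^sup>2 = (real N ^ p * (B * ?\<eta> ^ p))\<^sup>2"
    by (simp add: power_mult_distrib power_mult mult.commute[of 2] flip: power_mult)
  also have "real N ^ p * (B * ?\<eta> ^ p) = 8 ^ p * B"
    using N_pos by (simp add: power_divide)
  also have "real N ^ (2 * p) * (\<Sum>i<N. ((\<bar>freq i\<bar> / real N) ^ p * cmod (coef h i))\<^sup>2)
      = (\<Sum>i<N. (\<bar>freq i\<bar> ^ p * cmod (coef h i))\<^sup>2)"
    unfolding sum_distrib_left
  proof (intro sum.cong refl)
    fix i
    have "\<bar>freq i\<bar> ^ p = real N ^ p * (\<bar>freq i\<bar> / real N) ^ p" using N_pos by (simp add: power_divide)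
    then show "real N ^ (2 * p) * ((\<bar>freq i\<bar> / real N) ^ p * cmod (coef h i))\<^sup>2
        = (\<bar>freq i\<bar> ^ p * cmod (coef h i))\<^sup>2"
      by (simp only: power_mult_distrib power_mult mult.commute[of 2] mult_ac power_even_eq)
  qed
  finally show ?thesis .
qed

text \<open>Comparison with a telescoping series, once for the negative and once for the other
  frequencies.\<close>

lemma sum_inverse_squares_le: "(\<Sum>i<N. 1 / (1 + \<bar>freq i\<bar>)\<^sup>2) \<le> 4"
proof -
  have "(\<Sum>k<Suc q. 1 / (1 + real k)\<^sup>2) \<le> 2 - 1 / (real q + 1)" for q
  proof (induction q)
    case (Suc q)
    have "(real q + 1) * (real q + 2) \<le> (1 + real (Suc q))\<^sup>2"
      by (simp add: power2_eq_square algebra_simps)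
    then have "1 / (1 + real (Suc q))\<^sup>2 \<le> 1 / ((real q + 1) * (real q + 2))"
      by (intro divide_left_mono mult_pos_pos) simp_all
    also have "\<dots> = 1 / (real q + 1) - 1 / (real (Suc q) + 1)" by (simp add: field_simps)
    finally show ?case using Suc by simp
  qed simp
  then have aux': "(\<Sum>k<Suc q. 1 / (1 + real k)\<^sup>2) \<le> 2" for q
    by (rule order_trans) simp
  have aux: "(\<Sum>k<q. 1 / (1 + real k)\<^sup>2) \<le> 2" for q
    by (rule order_trans[OF _ aux'[of q]]) (rule sum_mono2, auto)
  have split: "{..<N} = {..<m} \<union> {m..<m + Suc m}" by (auto simp: N_def)
  have "(\<Sum>i<N. 1 / (1 + \<bar>freq i\<bar>)\<^sup>2)
      = (\<Sum>i<m. 1 / (1 + \<bar>freq i\<bar>)\<^sup>2) + (\<Sum>i=m..<m + Suc m. 1 / (1 + \<bar>freq i\<bar>)\<^sup>2)"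
    unfolding split by (rule sum.union_disjoint) auto
  also have "(\<Sum>i<m. 1 / (1 + \<bar>freq i\<bar>)\<^sup>2) \<le> (\<Sum>i<m. 1 / (1 + real (m - Suc i))\<^sup>2)"
    by (intro sum_mono divide_left_mono power_mono mult_pos_pos) (auto simp: freq_def)
  also have "\<dots> = (\<Sum>k<m. 1 / (1 + real k)\<^sup>2)" by (rule sum.nat_diff_reindex)
  also have "\<dots> \<le> 2" by (rule aux)
  also have "(\<Sum>i=m..<m + Suc m. 1 / (1 + \<bar>freq i\<bar>)\<^sup>2) = (\<Sum>k<Suc m. 1 / (1 + real k)\<^sup>2)"
    using sum.shift_bounds_nat_ivl[of "\<lambda>i. 1 / (1 + \<bar>freq i\<bar>)\<^sup>2" 0 m "Suc m"]
    by (simp add: freq_def lessThan_atLeast0 add.commute)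
  also have "\<dots> \<le> 2" by (rule aux)
  finally show ?thesis by simp
qed

text \<open>An extra weight 1 + |freq| is split off for Cauchy-Schwarz, which spends the derivative
  of order K + 1. The base 16 is 8 from the length of the grid times 2 from 1 + |freq| <= 2 |freq|;
  the factor 2 is the root of the bound 4 for the inverse squares.\<close>

lemma coef_sum_le:
  assumes B: "deriv_bound (Suc K) B h" and h: "\<And>x. x \<le> a \<Longrightarrow> h x = 0" "\<And>x. 8 \<le> x \<Longrightarrow> h x = 0"
    and a: "real (Suc K) * (8 / real N) \<le> a"
  shows "(\<Sum>i<N. cmod (coef h i) * (1 + \<bar>freq i\<bar>) ^ K) \<le> 2 * (1 + 16 ^ Suc K) * B"
proof -
  let ?p = "Suc K"
  have B0: "0 \<le> B" using B by (rule deriv_bound_nonneg)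
  have "((1 + \<bar>freq i\<bar>) ^ ?p * cmod (coef h i))\<^sup>2
      \<le> (cmod (coef h i))\<^sup>2 + (2 ^ ?p)\<^sup>2 * (\<bar>freq i\<bar> ^ ?p * cmod (coef h i))\<^sup>2" for i
  proof (cases "i = m")
    case False
    \<comment> \<open>Index \<open>m\<close> carries the frequency 0; all other frequencies have
      modulus at least 1.\<close>
    then have "1 + \<bar>freq i\<bar> \<le> 2 * \<bar>freq i\<bar>" by (auto simp: freq_def)
    then have "(1 + \<bar>freq i\<bar>) ^ ?p * cmod (coef h i) \<le> (2 * \<bar>freq i\<bar>) ^ ?p * cmod (coef h i)"
      by (intro mult_right_mono power_mono) auto
    then have "((1 + \<bar>freq i\<bar>) ^ ?p * cmod (coef h i))\<^sup>2 \<le> (2 ^ ?p * (\<bar>freq i\<bar> ^ ?p * cmod (coef h i)))\<^sup>2"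
      by (intro power_mono) (auto simp: power_mult_distrib mult_ac)
    also have "\<dots> = (2 ^ ?p)\<^sup>2 * (\<bar>freq i\<bar> ^ ?p * cmod (coef h i))\<^sup>2" by (rule power_mult_distrib)
    also have "\<dots> \<le> (cmod (coef h i))\<^sup>2 + \<dots>" by simp
    finally show ?thesis .
  qed (simp add: freq_def)
  then have "(\<Sum>i<N. ((1 + \<bar>freq i\<bar>) ^ ?p * cmod (coef h i))\<^sup>2)
      \<le> (\<Sum>i<N. (cmod (coef h i))\<^sup>2) + (2 ^ ?p)\<^sup>2 * (\<Sum>i<N. (\<bar>freq i\<bar> ^ ?p * cmod (coef h i))\<^sup>2)"
    unfolding sum_distrib_left sum.distrib[symmetric] by (rule sum_mono)
  also have "(\<Sum>i<N. (cmod (coef h i))\<^sup>2) \<le> B\<^sup>2"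
  proof -
    have "(\<Sum>j<N. (cmod (h (8 * real j / real N)))\<^sup>2) \<le> (\<Sum>j<N. B\<^sup>2)"
      by (intro sum_mono power_mono deriv_bound_le[OF B]) auto
    then show ?thesis unfolding Parseval using N_pos by (simp add: divide_le_eq mult.commute)
  qed
  also have "(\<Sum>i<N. (\<bar>freq i\<bar> ^ ?p * cmod (coef h i))\<^sup>2) \<le> (8 ^ ?p * B)\<^sup>2"
    by (rule coef_weighted_le[OF B h a])
  also have "B\<^sup>2 + (2 ^ ?p)\<^sup>2 * (8 ^ ?p * B)\<^sup>2 = B\<^sup>2 + (16 ^ ?p * B)\<^sup>2"
  proof -
    have "(2::real) ^ ?p * 8 ^ ?p = 16 ^ ?p" unfolding power_mult_distrib[symmetric] by simp
    then show ?thesis by (simp only: power_mult_distrib[symmetric] mult.assoc[symmetric])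
  qed
  also have "\<dots> \<le> ((1 + 16 ^ ?p) * B)\<^sup>2"
    using B0 by (simp add: distrib_right power2_sum del: power_Suc)
  finally have 1: "(\<Sum>i<N. ((1 + \<bar>freq i\<bar>) ^ ?p * cmod (coef h i))\<^sup>2) \<le> ((1 + 16 ^ ?p) * B)\<^sup>2"
    by simp
  have "(\<Sum>i<N. cmod (coef h i) * (1 + \<bar>freq i\<bar>) ^ K)\<^sup>2
      = (\<Sum>i<N. ((1 + \<bar>freq i\<bar>) ^ ?p * cmod (coef h i)) * (1 / (1 + \<bar>freq i\<bar>)))\<^sup>2"
    by (intro arg_cong[where f = "\<lambda>x. x\<^sup>2"] sum.cong refl) (simp add: field_simps add_nonneg_eq_0_iff)
  also have "\<dots> \<le> (\<Sum>i<N. ((1 + \<bar>freq i\<bar>) ^ ?p * cmod (coef h i))\<^sup>2) * (\<Sum>i<N. (1 / (1 + \<bar>freq i\<bar>))\<^sup>2)"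
    by (rule Cauchy_Schwarz_ineq_sum)
  also have "\<dots> \<le> ((1 + 16 ^ ?p) * B)\<^sup>2 * 4"
    using sum_inverse_squares_le by (intro mult_mono 1 sum_nonneg) (auto simp: power_divide)
  also have "\<dots> = (2 * (1 + 16 ^ ?p) * B)\<^sup>2"
    by (simp only: mult.assoc power_mult_distrib[of 2]) simp
  finally show ?thesis
    by (rule power2_le_imp_le) (use B0 in simp)
qed

text \<open>The interpolant equals \<open>h\<close> at a grid point within 8/N of x, and both
  functions are Lipschitz with constants uniform in N; for the interpolant this is the weighted
  coefficient bound with K >= 1.\<close>

lemma interpolation_error:
  assumes B: "deriv_bound (Suc K) B h" and h: "\<And>x. x \<le> a \<Longrightarrow> h x = 0" "\<And>x. 8 \<le> x \<Longrightarrow> h x = 0"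
    and a: "real (Suc K) * (8 / real N) \<le> a" and K: "1 \<le> K" and x: "0 \<le> x" "x \<le> 1"
  shows "cmod (h x - (\<Sum>i<N. coef h i * cis (pi * freq i * x / 4))) \<le> (2 * (1 + 16 ^ Suc K) + 1) * B * (8 / real N)"
proof -
  let ?H = "\<lambda>x. \<Sum>i<N. coef h i * cis (pi * freq i * x / 4)"
  let ?C = "2 * (1 + 16 ^ Suc K) * B"
  have B0: "0 \<le> B" using B by (rule deriv_bound_nonneg)
  define l where "l = nat \<lfloor>x * real N / 8\<rfloor>"
  define y where "y = 8 * real l / real N"
  have "0 \<le> x * real N / 8" using x by simp
  then have "real l = of_int \<lfloor>x * real N / 8\<rfloor>" by (simp add: l_def)
  then have lx: "real l \<le> x * real N / 8" "x * real N / 8 \<le> real l + 1" by linarith+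
  have "x * real N / 8 < real N" using x N_pos mult_right_mono[of x 1 "real N"] by simp
  then have l: "l < N" using lx by simp
  have xy: "\<bar>x - y\<bar> \<le> 8 / real N"
  proof -
    have "x - y = (x * real N - 8 * real l) / real N" using N_pos by (simp add: y_def field_simps)
    moreover have "\<bar>x * real N - 8 * real l\<bar> \<le> 8" using lx by linarith
    ultimately show ?thesis using N_pos by (simp add: divide_right_mono)
  qed
  have hy: "?H y = h y"
    using interpolation[OF l, of h] by (simp add: y_def mult_ac)
  have "cmod (h x - h y) \<le> B * \<bar>x - y\<bar>"
    using B by (elim deriv_bound_SucE) (intro norm_diff_le_if_derivative_le, auto intro: deriv_bound_le)
  moreover have "cmod (?H x - ?H y) \<le> ?C * \<bar>x - y\<bar>"
  proof -
    have "cmod (?H x - ?H y) \<le> (\<Sum>i<N. cmod (coef h i * (cis (pi * freq i * x / 4) - cis (pi * freq i * y / 4))))"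
      unfolding sum_subtractf[symmetric] right_diff_distrib[symmetric] by (rule norm_sum)
    also have "\<dots> \<le> (\<Sum>i<N. cmod (coef h i) * (1 + \<bar>freq i\<bar>) ^ K * \<bar>x - y\<bar>)"
    proof (rule sum_mono)
      fix i
      have "cmod (cis (pi * freq i * x / 4) - cis (pi * freq i * y / 4)) \<le> \<bar>pi * freq i * x / 4 - pi * freq i * y / 4\<bar>"
        by (rule cmod_cis_diff_le)
      also have "\<dots> = pi / 4 * (\<bar>freq i\<bar> * \<bar>x - y\<bar>)"
      proof -
        have "pi * freq i * x / 4 - pi * freq i * y / 4 = pi / 4 * (freq i * (x - y))"
          by (simp add: field_simps)
        then show ?thesis by (simp only: abs_mult) simp
      qed
      \<comment> \<open>With period 8 a unit of frequency turns by pi/4 < 1 per unit of x.\<close>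
      also have "\<dots> \<le> 1 * (\<bar>freq i\<bar> * \<bar>x - y\<bar>)"
        using pi_less_4 by (intro mult_right_mono) auto
      also have "\<dots> \<le> (1 + \<bar>freq i\<bar>) ^ K * \<bar>x - y\<bar>"
        using power_increasing[OF K, of "1 + \<bar>freq i\<bar>"] by (simp add: mult_right_mono)
      finally show "cmod (coef h i * (cis (pi * freq i * x / 4) - cis (pi * freq i * y / 4)))
          \<le> cmod (coef h i) * (1 + \<bar>freq i\<bar>) ^ K * \<bar>x - y\<bar>"
        by (simp add: norm_mult mult.assoc mult_left_mono)
    qed
    also have "\<dots> \<le> ?C * \<bar>x - y\<bar>"
      unfolding sum_distrib_right[symmetric] by (intro mult_right_mono coef_sum_le[OF B h a]) auto
    finally show ?thesis .
  qed
  moreover have "cmod (h x - ?H x) \<le> cmod (h x - h y) + cmod (?H x - ?H y)"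
    using norm_triangle_ineq4[of "h x - h y" "?H x - ?H y"] by (simp add: hy)
  ultimately have "cmod (h x - ?H x) \<le> (?C + B) * \<bar>x - y\<bar>" by (simp add: distrib_right)
  also have "\<dots> \<le> (?C + B) * (8 / real N)" using B0 xy by (intro mult_left_mono) auto
  finally show ?thesis by (simp add: distrib_right)
qed

end

text \<open>The coefficient bound is independent of \<epsilon>, which is what makes a norm limit
  possible afterwards.\<close>

lemma trigonometric_approximation:
  assumes K: "1 \<le> K" and B: "deriv_bound (Suc K) B h"
    and h: "\<And>x. x \<le> 1 / 8 \<Longrightarrow> h x = 0" "\<And>x. 8 \<le> x \<Longrightarrow> h x = 0" and \<epsilon>: "0 < \<epsilon>"
  obtains m c where "(\<Sum>i<2 * m + 1. cmod (c i) * (1 + \<bar>real i - real m\<bar>) ^ K) \<le> 2 * (1 + 16 ^ Suc K) * B"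
    "\<And>x. 0 \<le> x \<Longrightarrow> x \<le> 1 \<Longrightarrow>
       cmod (h x - (\<Sum>i<2 * m + 1. c i * cis (pi * (real i - real m) * x / 4))) \<le> \<epsilon>"
proof -
  let ?D = "(2 * (1 + 16 ^ Suc K) + 1) * B * 8"
  \<comment> \<open>The first entry gives K + 1 differences of mesh 8/N room within the margin 1/8;
    the second makes the interpolation error at most \<epsilon>.\<close>
  obtain m where m: "max (64 * real (Suc K)) (?D / \<epsilon>) < real m" using reals_Archimedean2 by blast
  interpret grid m .
  have mN: "real m \<le> real N" by (simp add: N_def)
  have "real (Suc K) * 64 \<le> real N" using m mN by linarith
  then have a: "real (Suc K) * (8 / real N) \<le> 1 / 8" using N_pos by (simp add: field_simps)
  have "?D / \<epsilon> \<le> real N" using m mN by linarith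
  then have "?D / real N \<le> \<epsilon>" using \<epsilon> N_pos by (simp add: field_simps)
  then have e: "(2 * (1 + 16 ^ Suc K) + 1) * B * (8 / real N) \<le> \<epsilon>" by simp
  show thesis
    using that[of "coef h" m] coef_sum_le[OF B h a] order_trans[OF interpolation_error[OF B h a K] e]
    unfolding freq_def N_def by blast
qed

section \<open>Commutators of functions of the operator\<close>

lemma suminf_exp: "(\<Sum>n. inverse (fact n) * x ^ n) = exp (x :: real)"
  by (simp add: exp_def divide_inverse mult.commute)

lemma power_le_exp: "0 \<le> x \<Longrightarrow> x ^ k \<le> fact k * exp (x :: real)"
proof -
  assume x: "0 \<le> x"
  have "(\<Sum>n\<in>{k}. inverse (fact n) * x ^ n) \<le> (\<Sum>n. inverse (fact n) * x ^ n)"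
    using x by (intro sum_le_suminf summable_exp) auto
  also have "\<dots> = exp x" by (rule suminf_exp)
  finally show ?thesis by (simp add: field_simps)
qed

lemma (in spectral_measure) implements_id: "implements (\<lambda>s. 1) (\<lambda>f. f)"
proof -
  have "L2_inner M f h = I (\<lambda>s. 1) f h" if "f \<in> L2 M" "h \<in> L2 M" for f h
  proof -
    have "L2_inner M f h = L2_inner M (E UNIV f) h"
      using that E_UNIV[of f] by (intro L2_inner_cong_AE E_L2) auto
    also have "\<dots> = I (indicator UNIV) f h" by (intro I_indicator[symmetric] that) simp
    also have "indicator UNIV = (\<lambda>s :: real. 1 :: complex)" by auto
    finally show ?thesis .
  qed
  then show ?thesis by (simp add: implements_def bounded_borel_const)
qed

lemma (in spectral_measure) implements_funpow:
  assumes "implements F S" shows "implements (\<lambda>s. F s ^ k) (\<lambda>f. (S ^^ k) f)"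
proof (induction k)
  case (Suc k)
  then show ?case using implements_compose[OF Suc assms] by (simp add: mult.commute)
qed (simp add: implements_id)

lemma (in nonneg_spectral_measure) implements_bounded_op:
  assumes S: "implements F S" and c: "\<And>s. 0 \<le> s \<Longrightarrow> cmod (F s) \<le> c"
  shows "bounded_op M c S"
proof -
  have "0 \<le> c" using c[of 0] norm_ge_zero order_trans by blast
  then show ?thesis
    using implements_L2[OF S] implements_norm_le_nonneg[OF S _ c] implements_linear[OF S]
    by (auto simp: bounded_op_def)
qed

text \<open>Moves growth from \<open>C\<close> into \<open>c\<close>: among the orders up to k the
  largest factor is a^k. Summing operators requires a common \<open>C\<close>.\<close>

lemma (in bounded_weight) commutator_bound_rescale:
  "commutator_bound M d k c (a * C) S \<Longrightarrow> 1 \<le> a \<Longrightarrow> commutator_bound M d k (c * a ^ k) C S"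
proof (induction k arbitrary: c S)
  case (Suc k)
  from Suc.prems have S: "bounded_op M c S" by simp
  have "c * 1 \<le> c * a ^ Suc k"
    using bounded_op_nonneg[OF S] Suc.prems by (intro mult_left_mono one_le_power) auto
  then have "bounded_op M (c * a ^ Suc k) S" using S by (auto intro: bounded_op_mono)
  moreover have "commutator_bound M d k (c * (a * C) * a ^ k) C (commutator d S)"
    using Suc.prems by (intro Suc.IH) auto
  ultimately show ?case by (simp add: mult_ac)
qed auto

text \<open>The reverse exchange for a contraction: a C^i <= (aC)^i for i >= 1, and order 0 is the
  norm bound. With leading constant 1, powers of the operator do not accumulate powers of
  \<open>a\<close>.\<close>

lemma (in bounded_weight) commutator_bound_normalize:
  assumes S: "commutator_bound M d k a C S" and "bounded_op M 1 S" and a: "1 \<le> a" and C: "0 \<le> C"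
  shows "commutator_bound M d k 1 (a * C) S"
proof (cases k)
  case (Suc k')
  have "C \<le> a * C" using mult_right_mono[OF a C] by simp
  moreover have cb: "commutator_bound M d k' (a * C) C (commutator d S)" using S Suc by simp
  ultimately have "commutator_bound M d k' (a * C) (a * C) (commutator d S)"
    using commutator_bound_mono[OF cb order_refl C] by blast
  with assms(2) show ?thesis unfolding Suc commutator_bound.simps mult_1 by blast
qed (use assms in simp)

text \<open>A bound for the sum of (j+1)^K / j! over all j, obtained from (j+1)^K <= K!
  exp(j+1).\<close>

definition exp_const :: "nat \<Rightarrow> real" where "exp_const K = fact K * exp 1 * exp (exp 1)"

lemma exp_const_ge_1: "1 \<le> exp_const K"
proof -
  have "1 * 1 * 1 \<le> fact K * exp 1 * exp (exp (1::real))"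
    by (intro mult_mono) (auto simp: fact_ge_1)
  then show ?thesis by (simp add: exp_const_def)
qed

text \<open>The positive part makes the symbol bounded on the whole line; for s >= 0 it is that of
  the semigroup at time 1/l.\<close>

locale heat_commutator = nonneg_spectral_measure M E + bounded_weight M d R
  for M :: "'a measure" and E d R +
  fixes l C\<^sub>0 :: real and K :: nat and b :: "real \<Rightarrow> real"
  defines "b \<equiv> \<lambda>s. exp (- (max 0 s / l))"
  assumes l: "0 < l" and C\<^sub>0: "1 \<le> C\<^sub>0" and K: "1 \<le> K"
    and T: "commutator_bound M d K 1 C\<^sub>0 (op_fun M E (\<lambda>s. complex_of_real (b s)))"
begin

abbreviation T where "T \<equiv> op_fun M E (\<lambda>s. complex_of_real (b s))"

abbreviation C\<^sub>1 where "C\<^sub>1 \<equiv> exp_const K * C\<^sub>0"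

lemma b_measurable [measurable]: "b \<in> borel_measurable borel"
  unfolding b_def by measurable

lemma b_01: "0 < b s" "b s \<le> 1"
  using l by (auto simp: b_def)

lemma bounded_borel_compose_b:
  assumes "h \<in> borel_measurable borel" "\<And>u. cmod (h u) \<le> c"
  shows "bounded_borel (\<lambda>s. h (b s))"
  using assms by (intro bounded_borelI[of _ c]) auto

lemma implements_T: "implements (\<lambda>s. complex_of_real (b s)) T"
  using b_01 by (intro implements_op_fun bounded_borelI[of _ 1]) (auto simp: less_imp_le)

lemma C\<^sub>1_ge_1: "1 \<le> C\<^sub>1"
proof -
  have "1 * 1 \<le> C\<^sub>1"
    by (rule mult_mono[OF exp_const_ge_1 C\<^sub>0]) (use exp_const_ge_1[of K] in auto)
  then show ?thesis by simp
qed

text \<open>The power series of $e^{icT}$ converges in norm together with the iterated commutators.\<close>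

lemma commutator_bound_cis:
  assumes c: "\<bar>c\<bar> \<le> 1" and V: "implements (\<lambda>s. cis (c * b s)) V"
  shows "commutator_bound M d K 1 C\<^sub>1 V"
proof -
  have V1: "bounded_op M 1 V" by (rule implements_bounded_op[OF V]) simp
  have "commutator_bound M d K (exp_const K) C\<^sub>0 V"
  proof (rule commutator_bound_limit[OF V1])
    fix e :: real assume e: "0 < e"
    obtain n where n: "1 / e < real n" using reals_Archimedean2 by blast
    let ?a = "\<lambda>j. (\<i> * complex_of_real c) ^ j / fact j"
    let ?V = "\<lambda>f x. \<Sum>j\<in>{..n}. ?a j * (T ^^ j) f x"
    \<comment> \<open>Rescaling asks for a factor of at least 1, so \<open>j + 1\<close> takes the
      place of \<open>j\<close>; this covers the zeroth power.\<close>
    have "commutator_bound M d K (cmod (?a j) * (1 ^ j * (real j + 1) ^ K)) C\<^sub>0 (\<lambda>f x. ?a j * (T ^^ j) f x)" for j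
    proof (intro commutator_bound_times commutator_bound_rescale)
      have "commutator_bound M d K (1 ^ j) (real j * C\<^sub>0) (\<lambda>f. (T ^^ j) f)"
        using C\<^sub>0 by (intro commutator_bound_funpow T) auto
      then show "commutator_bound M d K (1 ^ j) ((real j + 1) * C\<^sub>0) (T ^^ j)"
        by (rule commutator_bound_mono) (use C\<^sub>0 in \<open>auto intro: mult_right_mono\<close>)
    qed simp
    then have "commutator_bound M d K (\<Sum>j\<in>{..n}. cmod (?a j) * (1 ^ j * (real j + 1) ^ K)) C\<^sub>0 ?V"
      by (intro commutator_bound_sum)
    moreover have "(\<Sum>j\<in>{..n}. cmod (?a j) * (1 ^ j * (real j + 1) ^ K)) \<le> exp_const K"
    proof -
      have "cmod (?a j) * (1 ^ j * (real j + 1) ^ K) \<le> fact K * exp 1 * (inverse (fact j) * exp 1 ^ j)" for j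
      proof -
        have "cmod (?a j) * (1 ^ j * (real j + 1) ^ K) \<le> (1 / fact j) * (fact K * exp (real j + 1))"
        proof (rule mult_mono)
          show "cmod (?a j) \<le> 1 / fact j"
            using c by (simp add: norm_divide norm_mult norm_power power_le_one divide_right_mono)
          show "1 ^ j * (real j + 1) ^ K \<le> fact K * exp (real j + 1)"
            using power_le_exp[of "real j + 1" K] by simp
        qed auto
        also have "\<dots> = fact K * exp 1 * (inverse (fact j) * exp 1 ^ j)"
          by (simp add: exp_add exp_of_nat_mult[symmetric] divide_inverse mult_ac)
        finally show ?thesis .
      qed
      then have "(\<Sum>j\<in>{..n}. cmod (?a j) * (1 ^ j * (real j + 1) ^ K))
          \<le> (\<Sum>j\<in>{..n}. fact K * exp 1 * (inverse (fact j) * exp 1 ^ j))"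
        by (rule sum_mono)
      also have "\<dots> = fact K * exp 1 * (\<Sum>j\<in>{..n}. inverse (fact j) * exp 1 ^ j)"
        by (simp add: sum_distrib_left)
      also have "(\<Sum>j\<in>{..n}. inverse (fact j) * exp 1 ^ j) \<le> (\<Sum>j. inverse (fact j) * exp (1::real) ^ j)"
        by (intro sum_le_suminf summable_exp) auto
      also have "\<dots> = exp (exp 1)" by (rule suminf_exp)
      finally show ?thesis by (simp add: exp_const_def mult_left_mono)
    qed
    ultimately have "commutator_bound M d K (exp_const K) C\<^sub>0 ?V"
      by (rule commutator_bound_mono) (use C\<^sub>0 in auto)
    moreover have "bounded_op M e (\<lambda>f x. V f x - ?V f x)"
    proof (rule implements_bounded_op[OF implements_diff[OF V]])
      show "implements (\<lambda>s. \<Sum>j\<in>{..n}. ?a j * complex_of_real (b s) ^ j) ?V"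
        by (intro implements_sum implements_scale implements_funpow implements_T)
      fix s
      let ?z = "\<i> * complex_of_real (c * b s)"
      have "cmod ?z \<le> 1" using c b_01[of s] mult_mono[of "\<bar>c\<bar>" 1 "b s" 1] by (simp add: norm_mult abs_mult)
      then have z: "cmod ?z ^ Suc n \<le> 1" by (intro power_le_one) auto
      \<comment> \<open>The exponent is imaginary and of modulus at most 1, so the remainder is at
        most 1/n!.\<close>
      have "cmod (exp ?z - (\<Sum>j\<le>n. ?z ^ j / fact j)) \<le> exp \<bar>Re ?z\<bar> * cmod ?z ^ Suc n / fact n"
        by (rule Taylor_exp)
      also have "\<dots> \<le> 1 / fact n"
        using z by (simp add: divide_right_mono del: power_Suc)
      also have "\<dots> \<le> e"
      proof -
        have "real n \<le> fact n" using fact_ge_self[of n] by (metis of_nat_fact of_nat_le_iff)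
        then have "1 / e < fact n" using n by linarith
        then show ?thesis using e by (simp add: field_simps)
      qed
      finally show "cmod (cis (c * b s) - (\<Sum>j\<in>{..n}. ?a j * complex_of_real (b s) ^ j)) \<le> e"
        by (simp add: cis_conv_exp power_mult_distrib mult_ac)
    qed
    ultimately show "\<exists>S. commutator_bound M d K (exp_const K) C\<^sub>0 S \<and> bounded_op M e (\<lambda>f x. V f x - S f x)"
      by blast
  qed
  \<comment> \<open>\<open>V\<close> is a contraction, so the constant of the series can be moved
    into \<open>C\<^sub>1\<close>.\<close>
  then show ?thesis
    using V1 exp_const_ge_1 C\<^sub>0 by (intro commutator_bound_normalize) auto
qed

text \<open>An integer frequency is a power of exp(icT) with c = pi/4 or -pi/4, within the range |c|
  <= 1 already treated. The power costs (1 + |frequency|)^K.\<close>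

lemma commutator_bound_frequency:
  obtains S where "implements (\<lambda>s. cis (pi * (real i - real m) * b s / 4)) S"
    "commutator_bound M d K ((1 + \<bar>real i - real m\<bar>) ^ K) C\<^sub>1 S"
proof -
  define k where "k = (if m \<le> i then i - m else m - i)"
  define c where "c = (if m \<le> i then pi / 4 else - (pi / 4))"
  have ck: "c * real k = pi * (real i - real m) / 4" by (auto simp: c_def k_def of_nat_diff right_diff_distrib diff_divide_distrib)
  have rk: "real k = \<bar>real i - real m\<bar>" by (auto simp: k_def)
  have c1: "\<bar>c\<bar> \<le> 1" using pi_less_4 by (simp add: c_def)
  have "bounded_borel (\<lambda>s. cis (c * b s))"
    by (rule bounded_borelI[of _ 1]) (auto intro!: borel_measurable_continuous_on[of cis] continuous_on_cis continuous_intros)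
  then obtain V where V: "implements (\<lambda>s. cis (c * b s)) V" using implements_exists by blast
  have "implements (\<lambda>s. cis (c * b s) ^ k) (\<lambda>f. (V ^^ k) f)" by (rule implements_funpow[OF V])
  also have "(\<lambda>s. cis (c * b s) ^ k) = (\<lambda>s. cis (pi * (real i - real m) * b s / 4))"
  proof
    fix s
    have "real k * (c * b s) = pi * (real i - real m) * b s / 4"
      using arg_cong[OF ck, of "\<lambda>x. x * b s"] by (simp add: mult_ac)
    then show "cis (c * b s) ^ k = cis (pi * (real i - real m) * b s / 4)"
      by (simp only: Complex.DeMoivre)
  qed
  finally have 1: "implements (\<lambda>s. cis (pi * (real i - real m) * b s / 4)) (\<lambda>f. (V ^^ k) f)" .
  have "commutator_bound M d K (1 ^ k) (real k * C\<^sub>1) (\<lambda>f. (V ^^ k) f)"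
    using C\<^sub>1_ge_1 by (intro commutator_bound_funpow commutator_bound_cis[OF c1 V]) auto
  then have "commutator_bound M d K 1 ((1 + \<bar>real i - real m\<bar>) * C\<^sub>1) (\<lambda>f. (V ^^ k) f)"
    by (rule commutator_bound_mono) (use C\<^sub>1_ge_1 in \<open>auto simp: rk intro: mult_right_mono\<close>)
  then have "commutator_bound M d K (1 * (1 + \<bar>real i - real m\<bar>) ^ K) C\<^sub>1 (\<lambda>f. (V ^^ k) f)"
    by (rule commutator_bound_rescale) simp
  with 1 show thesis using that by simp
qed

text \<open>Trigonometric sums approximate \<open>h\<close> uniformly on [0,1], where
  \<open>b\<close> takes its values, with commutator bounds that do not depend on the
  accuracy.\<close>

lemma commutator_bound_smooth:
  assumes B: "deriv_bound (Suc K) B h" and h: "\<And>x. x \<le> 1 / 8 \<Longrightarrow> h x = 0" "\<And>x. 8 \<le> x \<Longrightarrow> h x = 0"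
    and H: "implements (\<lambda>s. h (b s)) H"
  shows "commutator_bound M d K (2 * (1 + 16 ^ Suc K) * B) C\<^sub>1 H"
proof (rule commutator_bound_limit)
  show "bounded_op M B H"
    by (rule implements_bounded_op[OF H]) (rule deriv_bound_le[OF B])
  fix e :: real assume e: "0 < e"
  obtain m c where c: "(\<Sum>i<2 * m + 1. cmod (c i) * (1 + \<bar>real i - real m\<bar>) ^ K) \<le> 2 * (1 + 16 ^ Suc K) * B"
    and approx: "\<And>x. 0 \<le> x \<Longrightarrow> x \<le> 1 \<Longrightarrow>
       cmod (h x - (\<Sum>i<2 * m + 1. c i * cis (pi * (real i - real m) * x / 4))) \<le> e"
    by (rule trigonometric_approximation[OF K B h e]) (assumption+, rule that)
  have "\<exists>S. implements (\<lambda>s. cis (pi * (real i - real m) * b s / 4)) S \<and>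
      commutator_bound M d K ((1 + \<bar>real i - real m\<bar>) ^ K) C\<^sub>1 S" for i
    using commutator_bound_frequency by blast
  then obtain S where S: "\<And>i. implements (\<lambda>s. cis (pi * (real i - real m) * b s / 4)) (S i)"
      "\<And>i. commutator_bound M d K ((1 + \<bar>real i - real m\<bar>) ^ K) C\<^sub>1 (S i)"
    by metis
  let ?S = "\<lambda>f x. \<Sum>i<2 * m + 1. c i * S i f x"
  have "commutator_bound M d K (\<Sum>i<2 * m + 1. cmod (c i) * (1 + \<bar>real i - real m\<bar>) ^ K) C\<^sub>1 ?S"
    by (intro commutator_bound_sum commutator_bound_times S)
  then have "commutator_bound M d K (2 * (1 + 16 ^ Suc K) * B) C\<^sub>1 ?S"
    by (rule commutator_bound_mono) (use c C\<^sub>1_ge_1 in auto)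
  moreover have "bounded_op M e (\<lambda>f x. H f x - ?S f x)"
    by (rule implements_bounded_op[OF implements_diff[OF H]], rule implements_sum, rule implements_scale, rule S)
       (use approx b_01 in \<open>auto simp: less_imp_le\<close>)
  ultimately show "\<exists>S. commutator_bound M d K (2 * (1 + 16 ^ Suc K) * B) C\<^sub>1 S \<and> bounded_op M e (\<lambda>f x. H f x - S f x)"
    by blast
qed

text \<open>Substitute u = b(s), so that -ln u = s/l for s >= 0. As exp 2 < 8, the support of f(-ln
  u) fits between 1/8 and 8.\<close>

lemma commutator_bound_multiplier:
  assumes Cl: "\<And>B f. deriv_bound (Suc K) B f \<Longrightarrow> \<forall>s. 2 < \<bar>s\<bar> \<longrightarrow> f s = 0 \<Longrightarrow>
      deriv_bound (Suc K) (Cl * B) (\<lambda>u. if 0 < u then complex_of_real (1 / u ^ 0) * f (- ln u) else 0)"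
    and B: "deriv_bound (Suc K) B f" and f0: "\<And>s. 2 < \<bar>s\<bar> \<Longrightarrow> f s = 0"
    and S: "implements F S" and F: "\<And>s. 0 \<le> s \<Longrightarrow> F s = f (s / l)"
  shows "commutator_bound M d K (2 * (1 + 16 ^ Suc K) * (Cl * B)) C\<^sub>1 S"
proof -
  define h where "h u = (if 0 < u then complex_of_real (1 / u ^ 0) * f (- ln u) else 0)" for u :: real
  have h: "deriv_bound (Suc K) (Cl * B) h"
    unfolding h_def[abs_def] using B f0 by (intro Cl) auto
  have exp2: "exp 2 < (8 :: real)"
  proof -
    have "exp 2 = exp 1 * exp (1 :: real)" by (simp add: exp_add[symmetric])
    also have "\<dots> < (272 / 100) * (272 / 100)" using e_less_272 by (intro mult_strict_mono) auto
    finally show ?thesis by simp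
  qed
  have ln8: "2 < ln (8 :: real)" using exp2 ln_less_cancel_iff[of "exp 2" "8 :: real"] by simp
  have h1: "h x = 0" if "x \<le> 1 / 8" for x
  proof (cases "0 < x")
    case True
    then have "ln x \<le> ln (1 / 8)" using that by simp
    then have "2 < - ln x" using ln8 by (simp add: ln_div)
    then show ?thesis by (simp add: h_def f0)
  qed (simp add: h_def)
  have h8: "h x = 0" if "8 \<le> x" for x
  proof -
    have "ln 8 \<le> ln x" using that by simp
    then show ?thesis using ln8 by (simp add: h_def f0)
  qed
  have "h \<in> borel_measurable borel"
    by (intro borel_measurable_continuous_onI deriv_bound_continuous[OF h])
  then have "bounded_borel (\<lambda>s. h (b s))"
    by (rule bounded_borel_compose_b) (rule deriv_bound_le[OF h])
  then obtain H where H: "implements (\<lambda>s. h (b s)) H" using implements_exists by blast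
  have "commutator_bound M d K (2 * (1 + 16 ^ Suc K) * (Cl * B)) C\<^sub>1 H"
    by (rule commutator_bound_smooth[OF h h1 h8 H])
  then show ?thesis
  proof (rule commutator_bound_transfer)
    fix g assume g: "g \<in> L2 M"
    then show "S g \<in> L2 M" by (rule implements_L2[OF S])
    show "AE x in M. S g x = H g x"
      by (rule implements_unique[OF S H _ g]) (simp add: F h_def b_def max_def)
  qed
qed

end

section \<open>The localized propagator as a power of a contraction\<close>

lemma propagator_commutator_bound:
  assumes K: "1 \<le> K" and C\<^sub>0: "1 \<le> C\<^sub>0"
  obtains A C where "0 \<le> A" "0 \<le> C"
    "\<And>(M :: 'a measure) E d R l t B F.
      \<lbrakk>nonneg_spectral_measure M E; bounded_weight M d R; 0 < l;
       commutator_bound M d K 1 C\<^sub>0 (op_fun M E (\<lambda>s. complex_of_real (exp (- (max 0 s / l)))));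
       deriv_bound (Suc K) B (\<lambda>s. F (l * s)); \<And>s. l < \<bar>s\<bar> \<Longrightarrow> F s = 0; F \<in> borel_measurable borel\<rbrakk>
      \<Longrightarrow> commutator_bound M d K (A * B) (C * (1 + l * \<bar>t\<bar>))
           (\<lambda>f. op_fun M E (\<lambda>s. exp (\<i> * complex_of_real (t * s))) (op_fun M E F f))"
proof -
  obtain Cl where Cl0: "0 \<le> Cl" and Cl: "\<And>B f. deriv_bound (Suc K) B f \<Longrightarrow> \<forall>s. 2 < \<bar>s\<bar> \<longrightarrow> f s = 0 \<Longrightarrow>
      deriv_bound (Suc K) (Cl * B) (\<lambda>u. if 0 < u then complex_of_real (1 / u ^ 0) * f (- ln u) else 0)"
    using deriv_bound_log[of "Suc K" 0] by blast
  obtain B\<^sub>\<psi> \<psi> where \<psi>: "deriv_bound (Suc K) B\<^sub>\<psi> (\<lambda>x. complex_of_real (\<psi> x))"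
    "\<And>x. 0 \<le> \<psi> x" "\<And>x. \<psi> x \<le> 1" "\<And>x. \<bar>x\<bar> \<le> 1 \<Longrightarrow> \<psi> x = 1" "\<And>x. 2 \<le> \<bar>x\<bar> \<Longrightarrow> \<psi> x = 0"
    by (rule smooth_cutoff[of "Suc K"]) blast
  define P where "P = 2 * (1 + 16 ^ Suc K) * Cl"
  have P: "0 \<le> P" using Cl0 by (simp add: P_def)
  define C\<^sub>1 where "C\<^sub>1 = exp_const K * C\<^sub>0"
  \<comment> \<open>A bound on the commutators of the contraction \<open>W\<close> constructed
    below, uniform in t because its phase \<theta> satisfies |\<theta>| <= 1; normalization requires
    at least 1.\<close>
  define a where "a = max 1 (P * (2 ^ Suc K * (1 * B\<^sub>\<psi>)))"
  have C\<^sub>1: "0 \<le> C\<^sub>1" using C\<^sub>0 exp_const_ge_1[of K] by (simp add: C\<^sub>1_def)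
  show thesis
  proof (rule that[of P "2 * (a * C\<^sub>1 + C\<^sub>1)"])
    show "0 \<le> P" by (rule P)
    show "0 \<le> 2 * (a * C\<^sub>1 + C\<^sub>1)" using C\<^sub>1 by (simp add: a_def)
    fix M :: "'a measure" and E d R l t B F
    assume E: "nonneg_spectral_measure M E" and d: "bounded_weight M d R" and l: "0 < l"
      and T: "commutator_bound M d K 1 C\<^sub>0 (op_fun M E (\<lambda>s. complex_of_real (exp (- (max 0 s / l)))))"
      and B: "deriv_bound (Suc K) B (\<lambda>s. F (l * s))" and F0: "\<And>s. l < \<bar>s\<bar> \<Longrightarrow> F s = 0"
      and Fm: "F \<in> borel_measurable borel"
    interpret nonneg_spectral_measure M E by (rule E)
    interpret bounded_weight M d R by (rule d)
    interpret heat_commutator M E d R l C\<^sub>0 K "\<lambda>s. exp (- (max 0 s / l))"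
      by unfold_locales (use l C\<^sub>0 K T in auto)
    \<comment> \<open>The added 1 keeps the number of factors positive at t = 0.\<close>
    define N where "N = nat \<lceil>l * \<bar>t\<bar>\<rceil> + 1"
    have "0 \<le> l * \<bar>t\<bar>" using l by simp
    then have N: "l * \<bar>t\<bar> \<le> real N" "real N \<le> l * \<bar>t\<bar> + 2" "0 < real N"
      unfolding N_def by linarith+
    define \<theta> where "\<theta> = l * t / real N"
    have \<theta>: "\<bar>\<theta>\<bar> \<le> 1" using N l by (simp add: \<theta>_def abs_mult)
    define w where "w s = cis (\<theta> * s) * complex_of_real (\<psi> s)" for s
    have w: "deriv_bound (Suc K) (2 ^ Suc K * (1 * B\<^sub>\<psi>)) w"
      unfolding w_def[abs_def] using deriv_bound_cis[of 1 1 \<theta> "Suc K"] \<theta>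
      by (intro deriv_bound_times \<psi>) auto
    have w1: "cmod (w s) \<le> 1" for s using \<psi>(2,3)[of s] by (simp add: w_def norm_mult)
    have "bounded_borel (\<lambda>s. w (s / l))"
    proof (rule bounded_borelI)
      have "continuous_on UNIV (\<lambda>s. w (s / l))"
        by (rule continuous_on_compose2[OF deriv_bound_continuous[OF w]]) (use l in \<open>auto intro!: continuous_intros\<close>)
      then show "(\<lambda>s. w (s / l)) \<in> borel_measurable borel" by (rule borel_measurable_continuous_onI)
    qed (rule w1)
    then obtain W where W: "implements (\<lambda>s. w (s / l)) W" using implements_exists by blast
    have "commutator_bound M d K (2 * (1 + 16 ^ Suc K) * (Cl * (2 ^ Suc K * (1 * B\<^sub>\<psi>)))) C\<^sub>1 W"
      unfolding C\<^sub>1_def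
      by (rule commutator_bound_multiplier[OF Cl w _ W]) (auto simp: w_def \<psi>(5))
    then have "commutator_bound M d K a C\<^sub>1 W"
      by (rule commutator_bound_mono) (use C\<^sub>1 in \<open>auto simp: a_def P_def mult_ac\<close>)
    moreover have "bounded_op M 1 W" by (rule implements_bounded_op[OF W]) (rule w1)
    \<comment> \<open>Normalizing before taking powers avoids a factor a^N.\<close>
    ultimately have "commutator_bound M d K 1 (a * C\<^sub>1) W"
      using C\<^sub>1 by (intro commutator_bound_normalize) (auto simp: a_def)
    then have WN: "commutator_bound M d K (1 ^ N) (real N * (a * C\<^sub>1)) (\<lambda>f. (W ^^ N) f)"
      using C\<^sub>1 by (intro commutator_bound_funpow) (auto simp: a_def)
    have Fb: "bounded_borel F"
    proof (rule bounded_borelI[OF Fm])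
      show "cmod (F s) \<le> B" for s using deriv_bound_le[OF B, of "s / l"] l by simp
    qed
    let ?S = "op_fun M E F" and ?e = "\<lambda>s. exp (\<i> * complex_of_real (t * s))"
    have S: "implements F ?S" by (rule implements_op_fun[OF Fb])
    have eb: "bounded_borel ?e"
      by (rule bounded_borelI[of _ 1]) (auto intro!: borel_measurable_continuous_onI continuous_intros)
    have S': "implements ?e (op_fun M E ?e)" by (rule implements_op_fun[OF eb])
    have "commutator_bound M d K (2 * (1 + 16 ^ Suc K) * (Cl * B)) C\<^sub>1 ?S"
      unfolding C\<^sub>1_def
    proof (rule commutator_bound_multiplier[OF Cl B _ S])
      show "F (l * s) = 0" if "2 < \<bar>s\<bar>" for s
        using that l mult_strict_left_mono[of 1 "\<bar>s\<bar>" l] by (intro F0) (simp add: abs_mult)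
    qed (use l in auto)
    then have "commutator_bound M d K (1 ^ N * (P * B)) (real N * (a * C\<^sub>1) + C\<^sub>1) (\<lambda>f. (W ^^ N) (?S f))"
      using C\<^sub>1 by (intro commutator_bound_compose WN) (auto simp: P_def a_def mult.assoc)
    then have "commutator_bound M d K (1 ^ N * (P * B)) (real N * (a * C\<^sub>1) + C\<^sub>1)
        (\<lambda>f. op_fun M E ?e (?S f))"
    proof (rule commutator_bound_transfer)
      fix f assume f: "f \<in> L2 M"
      show "op_fun M E ?e (?S f) \<in> L2 M" by (intro implements_L2[OF S'] implements_L2[OF S] f)
      show "AE x in M. op_fun M E ?e (?S f) x = (W ^^ N) (?S f) x"
      proof (rule implements_unique[OF implements_compose[OF S S'] implements_compose[OF S implements_funpow[OF W]] _ f])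
        fix s :: real assume s: "0 \<le> s"
        \<comment> \<open>Beyond l both sides vanish with \<open>F\<close>; up to l the cutoff
          equals 1 and the N phases multiply to exp(its).\<close>
        show "?e s * F s = w (s / l) ^ N * F s"
        proof (cases "l < s")
          case False
          then have "\<psi> (s / l) = 1" using s l by (intro \<psi>) auto
          then have "w (s / l) ^ N = cis (\<theta> * (s / l)) ^ N" by (simp add: w_def)
          also have "\<dots> = cis (real N * (\<theta> * (s / l)))" by (rule Complex.DeMoivre)
          also have "real N * (\<theta> * (s / l)) = t * s" using N l by (simp add: \<theta>_def)
          finally show ?thesis by (simp add: cis_conv_exp)
        qed (use F0[of s] in auto)
      qed
    qed
    then show "commutator_bound M d K (P * B) (2 * (a * C\<^sub>1 + C\<^sub>1) * (1 + l * \<bar>t\<bar>)) (\<lambda>f. op_fun M E ?e (?S f))"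
    proof (rule commutator_bound_mono)
      have a0: "0 \<le> a * C\<^sub>1" using C\<^sub>1 by (simp add: a_def)
      have lt: "0 \<le> l * \<bar>t\<bar>" using l by simp
      have "real N * (a * C\<^sub>1) \<le> 2 * (1 + l * \<bar>t\<bar>) * (a * C\<^sub>1)"
        using N lt a0 by (intro mult_right_mono) auto
      moreover have "1 * C\<^sub>1 \<le> 2 * (1 + l * \<bar>t\<bar>) * C\<^sub>1"
        using lt C\<^sub>1 by (intro mult_right_mono) auto
      ultimately show "real N * (a * C\<^sub>1) + C\<^sub>1 \<le> 2 * (a * C\<^sub>1 + C\<^sub>1) * (1 + l * \<bar>t\<bar>)"
        by (simp add: algebra_simps)
      show "0 \<le> real N * (a * C\<^sub>1) + C\<^sub>1" using a0 C\<^sub>1 by simp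
    qed simp
  qed
qed

section \<open>The off-diagonal estimate\<close>

lemma bounded_op_cutoff: "A \<in> sets M \<Longrightarrow> bounded_op M 1 (cutoff A)"
  using bounded_op_multiplier[of "indicator A" M 1]
  by (simp add: cutoff_def[abs_def] indicator_def)

text \<open>The supremum ranges over the unit ball only; homogeneity, valid almost everywhere, gives
  the other vectors.\<close>

lemma opnorm_2_2_bound:
  assumes S: "bounded_op M c0 S" and c: "0 \<le> c" and le: "opnorm_2_2 M S \<le> ennreal c" and f: "f \<in> L2 M"
  shows "L2_norm M (S f) \<le> c * L2_norm M f"
proof (cases "L2_norm M f = 0")
  case True
  with bounded_op_norm[OF S f] show ?thesis by simp
next
  case False
  then have pos: "0 < L2_norm M f" using L2_norm_nonneg[of M f] by linarith
  let ?a = "complex_of_real (1 / L2_norm M f)"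
  have g: "(\<lambda>x. ?a * f x) \<in> L2 M" using f by (rule L2_scale)
  have "L2_norm M (\<lambda>x. ?a * f x) \<le> 1" unfolding L2_norm_scale using pos by (simp add: norm_divide)
  then have "ennreal (L2_norm M (S (\<lambda>x. ?a * f x))) \<le> opnorm_2_2 M S"
    unfolding opnorm_2_2_def using g by (intro SUP_upper) auto
  then have "L2_norm M (S (\<lambda>x. ?a * f x)) \<le> c" using le c by (metis ennreal_le_iff order_trans)
  moreover have "L2_norm M (S (\<lambda>x. ?a * f x)) = L2_norm M (\<lambda>x. ?a * S f x)"
    by (intro L2_norm_cong_AE bounded_op_scale[OF S] f L2_scale bounded_op_L2[OF S])
  ultimately have "cmod ?a * L2_norm M (S f) \<le> c" unfolding L2_norm_scale by simp
  then show ?thesis using pos by (simp add: norm_divide divide_le_eq)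
qed

lemma nth_deriv_Suc: "nth_deriv (Suc k) F x = vector_derivative (nth_deriv k F) (at x)"
  by (simp add: nth_deriv_def)

lemma Ck_norm_finite:
  assumes "Ck_norm k F \<noteq> \<infinity>"
  obtains B where "0 \<le> B" "Ck_norm k F = ennreal B" "deriv_bound k B F"
proof -
  have Ck: "C_k k F" using assms by (auto simp: Ck_norm_def split: if_splits)
  obtain B where B: "0 \<le> B" "Ck_norm k F = ennreal B"
    using assms by (cases "Ck_norm k F") auto
  have le: "cmod (nth_deriv j F x) \<le> B" if "j \<le> k" for j x
  proof -
    have "ennreal (cmod (nth_deriv j F x)) \<le> (SUP j\<in>{..k}. SUP x. ennreal (cmod (nth_deriv j F x)))"
      using that by (intro SUP_upper2[of j] SUP_upper2[of x]) auto
    also have "\<dots> = ennreal B" using Ck B by (simp add: Ck_norm_def)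
    finally show ?thesis using B by simp
  qed
  \<comment> \<open>\<open>i\<close> counts the derivatives still available at order
    \<open>j\<close>, so the induction descends from the top order.\<close>
  have "deriv_bound i B (nth_deriv j F)" if "i + j = k" for i j
    using that
  proof (induction i arbitrary: j)
    case (Suc i)
    have "(nth_deriv j F has_vector_derivative nth_deriv (Suc j) F x) (at x)" for x
      using Ck Suc.prems unfolding nth_deriv_Suc vector_derivative_works[symmetric] by (simp add: C_k_def)
    then show ?case using Suc.IH[of "Suc j"] Suc.prems by (intro deriv_bound_SucI[OF le]) auto
  qed (use le in simp)
  from this[of k 0] have "deriv_bound k B F" by (simp add: nth_deriv_def)
  with B show thesis using that by blast
qed

lemma ennreal_mult_infinity: "0 < a \<Longrightarrow> 0 < b \<Longrightarrow> ennreal a * \<infinity> * ennreal b = \<infinity>"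
  by (simp add: ennreal_mult_top ennreal_top_mult)

text \<open>For x < 1 the two powers cancel; for x >= 1 the second one is 1.\<close>

lemma min_powr_ge_1:
  fixes x a :: real
  assumes "0 < x" "0 \<le> a"
  shows "1 \<le> x powr a * min x 1 powr (- a)"
proof (cases "1 \<le> x")
  case False
  have "x powr a * x powr (- a) = 1" using assms by (simp add: powr_minus)
  then show ?thesis using False by (simp add: min_def)
qed (use assms in \<open>simp add: min_def ge_one_powr_ge_zero\<close>)

text \<open>The distance to \<open>ball x r\<close> is truncated, so that multiplication by it is a bounded operator.\<close>

lemma annulus_decay:
  fixes M :: "'a::metric_space measure"
  assumes sets: "sets M = sets borel" and r: "0 < r" and \<rho>: "0 < \<rho>" and j: "2 \<le> j"
    and S: "\<And>d R. bounded_weight M d R \<Longrightarrow> (\<And>y z. \<bar>d y - d z\<bar> \<le> dist y z / \<rho>) \<Longrightarrow> commutator_bound M d K c C S"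
    and C: "0 \<le> C" and f: "f \<in> L2 M"
  shows "L2_norm M (cutoff (annulus x r j) (S (cutoff (ball x r) f))) \<le> c * (C / (2 ^ j * r / \<rho> / 4)) ^ K * L2_norm M f"
proof -
  \<comment> \<open>Truncation at 2^j r does not affect the lower bound on the annulus, where the
    distance minus r is at least 2^(j-1) r - r >= 2^(j-2) r.\<close>
  define d where "d y = min (2 ^ j * r) (max 0 (dist y x - r)) / \<rho>" for y
  have ball: "ball y s \<in> sets M" for y s by (simp add: sets)
  have ann: "annulus x r j \<in> sets M" using ball by (auto simp: annulus_def)
  have "continuous_on UNIV d"
    unfolding d_def[abs_def] using \<rho> by (intro continuous_intros) auto
  then have "d \<in> borel_measurable M"
    using borel_measurable_continuous_onI measurable_cong_sets[OF sets refl] by blast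
  then have d: "bounded_weight M d (2 ^ j * r / \<rho>)"
    using r \<rho> by unfold_locales (auto simp: d_def abs_mult divide_right_mono)
  have lip: "\<bar>d y - d z\<bar> \<le> dist y z / \<rho>" for y z
  proof -
    have "\<bar>dist y x - dist z x\<bar> \<le> dist y z"
      using dist_triangle[of y x z] dist_triangle[of z x y] by (simp add: abs_le_iff dist_commute)
    then have "\<bar>min (2 ^ j * r) (max 0 (dist y x - r)) - min (2 ^ j * r) (max 0 (dist z x - r))\<bar> \<le> dist y z"
      by linarith
    then show ?thesis using \<rho> by (simp add: d_def diff_divide_distrib[symmetric] abs_divide divide_right_mono)
  qed
  interpret bounded_weight M d "2 ^ j * r / \<rho>" by (rule d)
  show ?thesis
  proof (rule commutator_bound_off_diagonal[OF ann ball _ _ _ C f S[OF d lip]])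
    show "d y = 0" if "y \<in> ball x r" for y
    proof -
      have "0 < 2 ^ j * r" using r by simp
      with that show ?thesis by (simp add: d_def dist_commute max_def min_def)
    qed
    show "0 < 2 ^ j * r / \<rho> / 4" using r \<rho> by simp
    show "2 ^ j * r / \<rho> / 4 \<le> d y" if y: "y \<in> annulus x r j" for y
    proof -
      obtain i where i: "j = Suc (Suc i)" using j by (metis Suc_le_D numeral_2_eq_2 Suc_le_mono)
      have "2 * 2 ^ i * r \<le> dist y x" using y by (auto simp: annulus_def i dist_commute)
      moreover have "r \<le> 2 ^ i * r" using mult_right_mono[OF one_le_power[of 2 i], of r] r by simp
      moreover have "2 ^ j * r = 4 * (2 ^ i * r)" by (simp add: i)
      ultimately have "2 ^ j * r / 4 \<le> min (2 ^ j * r) (max 0 (dist y x - r))"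
        using r by linarith
      then have "2 ^ j * r / 4 / \<rho> \<le> d y" using \<rho> unfolding d_def by (intro divide_right_mono) auto
      then show ?thesis by (simp add: mult.commute)
    qed
  qed
qed

theorem proposition1p6:
  fixes M :: "'a::metric_space measure"
    and D :: "('a \<Rightarrow> complex) set"
    and L :: "('a \<Rightarrow> complex) \<Rightarrow> ('a \<Rightarrow> complex)"
    and E :: "real set \<Rightarrow> ('a \<Rightarrow> complex) \<Rightarrow> ('a \<Rightarrow> complex)"
    and n m \<kappa> :: real and \<kappa>\<^sub>0 :: nat
  assumes "homogeneous_type M n"
    and "emeasure M (space M) = \<infinity>"
    and "self_adjoint_operator M D L"
    and "nonneg_operator M D L"
    and "spectral_resolution M E D L"
    and "m > 0"
    and "\<kappa>\<^sub>0 = nat \<lfloor>n / 2\<rfloor> + 1"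
    and "\<kappa> > real \<kappa>\<^sub>0"
    and "PEV_2_2 M E n \<kappa> m"
  shows "\<exists>C>0. \<exists>c\<^sub>0>0. \<forall>(x\<^sub>B :: 'a) (r\<^sub>B :: real) (l :: real) (t :: real) (j :: nat).
    \<forall>f\<in>L2 M. \<forall>F :: real \<Rightarrow> complex.
      r\<^sub>B > 0 \<longrightarrow> l > 0 \<longrightarrow> j \<ge> 6 \<longrightarrow>
      F \<in> borel_measurable borel \<longrightarrow> closure {s. F s \<noteq> 0} \<subseteq> {-l..l} \<longrightarrow>
      ennreal (L2_norm M (cutoff (annulus x\<^sub>B r\<^sub>B j)
        (op_fun M E (\<lambda>s. exp (\<i> * complex_of_real (t * s)))
          (op_fun M E F (cutoff (ball x\<^sub>B r\<^sub>B) f)))))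
      \<le> ennreal (C * 2 powr (- (real j * real \<kappa>\<^sub>0))
            * (l powr (1 / m) * r\<^sub>B) powr (- real \<kappa>\<^sub>0 + n / 2)
            * (1 + l * \<bar>t\<bar>) ^ \<kappa>\<^sub>0
            * (l powr (1 / m) * min r\<^sub>B (l powr (- 1 / m))) powr (- c\<^sub>0))
        * Ck_norm (\<kappa>\<^sub>0 + 1) (\<lambda>s. F (l * s))
        * ennreal (L2_norm M f)"
proof -
  let ?K = "\<kappa>\<^sub>0"
  have K: "1 \<le> ?K" using assms(7) by simp
  have n: "0 < n" and sets: "sets M = sets borel" using assms(1) by (auto simp: homogeneous_type_def)
  have ball: "ball x r \<in> sets M" for x r by (simp add: sets)
  interpret nonneg_spectral_measure M E
  proof -
    have "spectral_measure M E" using assms(5) by unfold_locales (simp add: spectral_resolution_def)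
    then interpret spectral_measure M E .
    show "nonneg_spectral_measure M E"
      by unfold_locales (rule negative_part_null[OF assms(5,4)])
  qed
  obtain P where P: "0 < P" and pev: "\<And>x y t. 0 < t \<Longrightarrow>
      opnorm_2_2 M (\<lambda>f. cutoff (ball x (t powr (1 / m)))
        (op_fun M E (\<lambda>s. complex_of_real (exp (- t * s))) (cutoff (ball y (t powr (1 / m))) f)))
      \<le> ennreal (P * (1 + dist x y / t powr (1 / m)) powr (- n - \<kappa>))"
    using assms(9) unfolding PEV_2_2_def by blast
  obtain C\<^sub>0 where C\<^sub>0: "1 \<le> C\<^sub>0" and comm: "\<And>\<rho> T d R. \<lbrakk>0 < \<rho>; bounded_op M 1 T; bounded_weight M d R;
       \<And>x y. \<bar>d x - d y\<bar> \<le> dist x y / \<rho>;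
       \<And>x y f. f \<in> L2 M \<Longrightarrow> L2_norm M (cutoff (ball x \<rho>) (T (cutoff (ball y \<rho>) f)))
          \<le> P * (1 + dist x y / \<rho>) powr (- n - \<kappa>) * L2_norm M f\<rbrakk>
     \<Longrightarrow> commutator_bound M d ?K 1 C\<^sub>0 T"
    using commutator_bound_if_off_diagonal_decay[OF assms(1,2,8) less_imp_le[OF P]] by metis
  obtain A C where A: "0 \<le> A" and C: "0 \<le> C" and propagator: "\<And>(M :: 'a measure) E d R l t B F.
      \<lbrakk>nonneg_spectral_measure M E; bounded_weight M d R; 0 < l;
       commutator_bound M d ?K 1 C\<^sub>0 (op_fun M E (\<lambda>s. complex_of_real (exp (- (max 0 s / l)))));
       deriv_bound (Suc ?K) B (\<lambda>s. F (l * s)); \<And>s. l < \<bar>s\<bar> \<Longrightarrow> F s = 0; F \<in> borel_measurable borel\<rbrakk>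
      \<Longrightarrow> commutator_bound M d ?K (A * B) (C * (1 + l * \<bar>t\<bar>))
           (\<lambda>f. op_fun M E (\<lambda>s. exp (\<i> * complex_of_real (t * s))) (op_fun M E F f))"
    by (rule propagator_commutator_bound[OF K C\<^sub>0]) blast
  \<comment> \<open>The factor 4 stems from the lower bound 2^(j-2) r on the distance; the added 1
    makes the constant positive.\<close>
  define G where "G = A * (4 * C) ^ ?K + 1"
  have G: "0 < G" using A C by (simp add: G_def add_nonneg_pos)
  show ?thesis
  proof (rule exI[of _ G], rule conjI[OF G], rule exI[of _ "n / 2"], intro conjI allI ballI impI)
    show "0 < n / 2" using n by simp
    fix x\<^sub>B :: 'a and r\<^sub>B l t :: real and j :: nat and f and F :: "real \<Rightarrow> complex"
    assume f: "f \<in> L2 M" and r: "0 < r\<^sub>B" and l: "0 < l" and j: "6 \<le> j"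
      and Fm: "F \<in> borel_measurable borel" and supp: "closure {s. F s \<noteq> 0} \<subseteq> {- l..l}"
    \<comment> \<open>The spatial scale of the semigroup hypothesis at time 1/l.\<close>
    define \<rho> where "\<rho> = (1 / l) powr (1 / m)"
    have \<rho>: "0 < \<rho>" using l by (simp add: \<rho>_def)
    define R where "R = l powr (1 / m) * r\<^sub>B"
    have R: "0 < R" using l r by (simp add: R_def)
    have \<rho>l: "l powr (1 / m) = 1 / \<rho>" "l powr (- 1 / m) = \<rho>"
      using l by (simp_all add: \<rho>_def powr_divide powr_minus_divide)
    have Rr: "r\<^sub>B / \<rho> = R" by (simp add: R_def \<rho>l)
    have minR: "l powr (1 / m) * min r\<^sub>B (l powr (- 1 / m)) = min R 1"
      unfolding R_def \<rho>l using \<rho> by (simp add: min_def field_simps)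
    let ?e = "\<lambda>s. exp (\<i> * complex_of_real (t * s))"
    let ?Bf = "cutoff (ball x\<^sub>B r\<^sub>B) f"
    let ?u = "cutoff (annulus x\<^sub>B r\<^sub>B j) (op_fun M E ?e (op_fun M E F ?Bf))"
    let ?c = "G * 2 powr (- (real j * real ?K)) * R powr (- real ?K + n / 2) * (1 + l * \<bar>t\<bar>) ^ ?K
      * min R 1 powr (- (n / 2))"
    have lt: "0 < 1 + l * \<bar>t\<bar>" using l by (simp add: add_pos_nonneg)
    have c: "0 < ?c" using G R lt by simp
    have Bf: "?Bf \<in> L2 M" by (intro L2_cutoff f ball)
    have "ennreal (L2_norm M ?u) \<le> ennreal ?c * Ck_norm (?K + 1) (\<lambda>s. F (l * s)) * ennreal (L2_norm M f)"
    proof (cases "Ck_norm (?K + 1) (\<lambda>s. F (l * s)) = \<infinity>")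
      \<comment> \<open>The right side is infinite unless \<open>f\<close> is null. In that case it
        is infinity times 0, which is 0 in \<open>ennreal\<close>, and the left side has to vanish
        although \<open>F\<close> may be unbounded.\<close>
      case True
      show ?thesis
      proof (cases "L2_norm M f = 0")
        case False
        then have "0 < L2_norm M f" using L2_norm_nonneg[of M f] by linarith
        from ennreal_mult_infinity[OF c this] show ?thesis unfolding True by (simp only: infinity_ennreal_def top_greatest)
      next
        case True
        then have "AE x in M. ?Bf x = 0"
          using L2_norm_eq_0_iff[OF f] by (auto simp: cutoff_def)
        note v = op_fun_zero[OF Fm Bf this]
        have eb: "bounded_borel ?e"
          by (rule bounded_borelI[of _ 1]) (auto intro!: borel_measurable_continuous_onI continuous_intros)
        note S = implements_op_fun[OF eb]
        have "bounded_op M 1 (op_fun M E ?e)" by (rule implements_bounded_op[OF S]) simp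
        then have "L2_norm M (op_fun M E ?e (op_fun M E F ?Bf)) \<le> 1 * L2_norm M (op_fun M E F ?Bf)"
          using v(1) by (rule bounded_op_norm)
        also have "L2_norm M (op_fun M E F ?Bf) = 0" using v L2_norm_eq_0_iff by blast
        finally have "L2_norm M (op_fun M E ?e (op_fun M E F ?Bf)) \<le> 0" by simp
        moreover have "L2_norm M ?u \<le> L2_norm M (op_fun M E ?e (op_fun M E F ?Bf))"
          using ball by (intro L2_norm_cutoff_le implements_L2[OF S] v) (auto simp: annulus_def)
        ultimately show ?thesis by (simp add: ennreal_neg)
      qed
    next
      case False
      then obtain B where B: "0 \<le> B" "Ck_norm (?K + 1) (\<lambda>s. F (l * s)) = ennreal B"
          "deriv_bound (?K + 1) B (\<lambda>s. F (l * s))"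
        by (rule Ck_norm_finite)
      have F0: "F s = 0" if "l < \<bar>s\<bar>" for s
      proof (rule ccontr)
        assume "F s \<noteq> 0"
        then have "s \<in> {- l..l}" using closure_subset[of "{s. F s \<noteq> 0}"] supp by blast
        with that show False by auto
      qed
      let ?b = "\<lambda>s. complex_of_real (exp (- (max 0 s / l)))"
      have bb: "bounded_borel ?b" using l by (intro bounded_borelI[of _ 1]) auto
      have T: "bounded_op M 1 (op_fun M E ?b)"
        by (rule implements_bounded_op[OF implements_op_fun[OF bb]]) (use l in auto)
      \<comment> \<open>The symbol in the hypothesis is unbounded for s < 0; on s >= 0 it agrees
        with the bounded one.\<close>
      have Teq: "op_fun M E (\<lambda>s. complex_of_real (exp (- (1 / l) * s))) g = op_fun M E ?b g" if "g \<in> L2 M" for g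
        by (rule op_fun_cong[OF _ _ _ that]) (auto simp: max_def)
      have dec: "L2_norm M (cutoff (ball x \<rho>) (op_fun M E ?b (cutoff (ball y \<rho>) g)))
          \<le> P * (1 + dist x y / \<rho>) powr (- n - \<kappa>) * L2_norm M g" if g: "g \<in> L2 M" for x y g
      proof (rule opnorm_2_2_bound[OF _ _ _ g, where S = "\<lambda>g. cutoff (ball x \<rho>) (op_fun M E ?b (cutoff (ball y \<rho>) g))"])
        show "bounded_op M (1 * (1 * 1)) (\<lambda>g. cutoff (ball x \<rho>) (op_fun M E ?b (cutoff (ball y \<rho>) g)))"
          by (intro bounded_op_compose[OF bounded_op_cutoff[OF ball] bounded_op_compose[OF T bounded_op_cutoff[OF ball]]])
        show "0 \<le> P * (1 + dist x y / \<rho>) powr (- n - \<kappa>)" using P by simp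
        have "opnorm_2_2 M (\<lambda>g. cutoff (ball x \<rho>) (op_fun M E ?b (cutoff (ball y \<rho>) g)))
            = opnorm_2_2 M (\<lambda>g. cutoff (ball x \<rho>)
                (op_fun M E (\<lambda>s. complex_of_real (exp (- (1 / l) * s))) (cutoff (ball y \<rho>) g)))"
          unfolding opnorm_2_2_def
        proof (intro SUP_cong refl)
          fix g assume "g \<in> {g \<in> L2 M. L2_norm M g \<le> 1}"
          then have "cutoff (ball y \<rho>) g \<in> L2 M" by (intro L2_cutoff ball) auto
          from Teq[OF this] show "ennreal (L2_norm M (cutoff (ball x \<rho>) (op_fun M E ?b (cutoff (ball y \<rho>) g))))
              = ennreal (L2_norm M (cutoff (ball x \<rho>)
                  (op_fun M E (\<lambda>s. complex_of_real (exp (- (1 / l) * s))) (cutoff (ball y \<rho>) g))))"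
            by (simp only:)
        qed
        also have "\<dots> \<le> ennreal (P * (1 + dist x y / \<rho>) powr (- n - \<kappa>))"
          using pev[of "1 / l" x y] l unfolding \<rho>_def by simp
        finally show "opnorm_2_2 M (\<lambda>g. cutoff (ball x \<rho>) (op_fun M E ?b (cutoff (ball y \<rho>) g)))
            \<le> ennreal (P * (1 + dist x y / \<rho>) powr (- n - \<kappa>))" .
      qed
      have "L2_norm M ?u \<le> A * B * (C * (1 + l * \<bar>t\<bar>) / (2 ^ j * r\<^sub>B / \<rho> / 4)) ^ ?K * L2_norm M f"
      proof (rule annulus_decay[OF sets r \<rho> _ _ _ f])
        fix d R assume d: "bounded_weight M d R" and lip: "\<And>y z. \<bar>d y - d z\<bar> \<le> dist y z / \<rho>"
        have "commutator_bound M d ?K 1 C\<^sub>0 (op_fun M E ?b)"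
          by (rule comm[OF \<rho> T d lip dec])
        then show "commutator_bound M d ?K (A * B) (C * (1 + l * \<bar>t\<bar>)) (\<lambda>f. op_fun M E ?e (op_fun M E F f))"
          using propagator[OF nonneg_spectral_measure_axioms d l _ _ F0 Fm] B(3) by simp
      qed (use j C lt in auto)
      also have "\<dots> \<le> ?c * B * L2_norm M f"
      proof (rule mult_right_mono)
        let ?X = "(1 + l * \<bar>t\<bar>) ^ ?K * (2 powr (- (real j * real ?K)) * R powr (- real ?K))"
        have "C * (1 + l * \<bar>t\<bar>) / (2 ^ j * r\<^sub>B / \<rho> / 4) = 4 * C * ((1 + l * \<bar>t\<bar>) * (1 / (2 ^ j * R)))"
          by (simp add: Rr[symmetric])
        then have "(C * (1 + l * \<bar>t\<bar>) / (2 ^ j * r\<^sub>B / \<rho> / 4)) ^ ?K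
            = (4 * C) ^ ?K * ((1 + l * \<bar>t\<bar>) ^ ?K * (1 / (2 ^ j * R)) ^ ?K)"
          by (simp only: power_mult_distrib)
        also have "(1 / (2 ^ j * R)) ^ ?K = 2 powr (- (real j * real ?K)) * R powr (- real ?K)"
        proof -
          have "2 powr (- (real j * real ?K)) = 1 / (2 ^ j) ^ ?K"
            by (simp add: powr_minus_divide powr_realpow[symmetric] powr_powr)
          moreover have "R powr (- real ?K) = 1 / R ^ ?K"
            using R by (simp add: powr_minus_divide powr_realpow)
          ultimately show ?thesis by (simp add: power_divide power_mult_distrib)
        qed
        finally have eq: "(C * (1 + l * \<bar>t\<bar>) / (2 ^ j * r\<^sub>B / \<rho> / 4)) ^ ?K = (4 * C) ^ ?K * ?X" .
        have X: "0 \<le> ?X" using lt by simp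
        have "A * B * (C * (1 + l * \<bar>t\<bar>) / (2 ^ j * r\<^sub>B / \<rho> / 4)) ^ ?K = (A * (4 * C) ^ ?K) * (?X * B)"
          unfolding eq by (simp add: mult_ac)
        also have "\<dots> \<le> G * (?X * B)"
          using X B(1) by (intro mult_right_mono) (auto simp: G_def)
        also have "\<dots> \<le> G * (?X * B) * (R powr (n / 2) * min R 1 powr (- (n / 2)))"
          using mult_left_mono[OF min_powr_ge_1[OF R, of "n / 2"], of "G * (?X * B)"] G X B(1) n by simp
        also have "\<dots> = ?c * B" unfolding powr_add by (simp only: mult_ac)
        finally show "A * B * (C * (1 + l * \<bar>t\<bar>) / (2 ^ j * r\<^sub>B / \<rho> / 4)) ^ ?K \<le> ?c * B" .
      qed simp
      finally have "ennreal (L2_norm M ?u) \<le> ennreal (?c * B * L2_norm M f)" by (rule ennreal_leI)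
      also have "\<dots> = ennreal ?c * Ck_norm (?K + 1) (\<lambda>s. F (l * s)) * ennreal (L2_norm M f)"
        using c B(1) unfolding B(2) by (simp only: ennreal_mult less_imp_le mult_nonneg_nonneg L2_norm_nonneg)
      finally show ?thesis .
    qed
    then show "ennreal (L2_norm M ?u) \<le> ennreal (G * 2 powr (- (real j * real ?K))
            * (l powr (1 / m) * r\<^sub>B) powr (- real ?K + n / 2)
            * (1 + l * \<bar>t\<bar>) ^ ?K
            * (l powr (1 / m) * min r\<^sub>B (l powr (- 1 / m))) powr (- (n / 2)))
        * Ck_norm (?K + 1) (\<lambda>s. F (l * s)) * ennreal (L2_norm M f)"
      unfolding minR R_def[symmetric] .
  qed
qed

end
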